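(* Let $p:X\times(0,\infty)\to\mathbb{R}$ be a bounded measurable function such that $p(\cdot,\lambda_n)$ is continuous on $X$ for every $n\in\mathbb{N}$, and assume that $\lim_{n\to\infty}p(x,\lambda_n)=q(x)$ uniformly in $x\in X$, for some function $q:X\to\mathbb{R}$. Let $[A,B]$ be a bounded interval containing the eigenvalues of $P_\Lambda p(x,-\Delta)P_\Lambda$ for all $\Lambda>0$. Then for every continuous function $F$ on $[A,B]$, $$\lim_{\Lambda\to\infty}\frac{1}{d_\Lambda}\operatorname{Tr}F\bigl(P_\Lambda p(x,-\Delta)P_\Lambda\bigr)=\int_X F(q(x))\,d\mu(x).$$
   Context: The Sierpinski gasket and its Laplacian. $X\subset\mathbb{R}^2$ is the Sierpinski gasket: the unique nonempty compact set with $X=\bigcup_{j=1}^3F_j(X)$, where $F_j(x)=\frac12(x-a_j)+a_j$ and $a_1,a_2,a_3$ are non-collinear. For a word $w=w_1\cdots w_N$ in $\{1,2,3\}$, $F_w=F_{w_1}\circ\cdots\circ F_{w_N}$, and $F_w(X)$ is called an $N$-cell; $\mu$ is the unique Borel probability measure on $X$ giving each $N$-cell measure $3^{-N}$. Let $V_0=\{a_1,a_2,a_3\}$, $V_m=\bigcup_jF_j(V_{m-1})$, and $x\sim_m y$ if $x\neq y$ both lie in $F_w(V_0)$ for some word $w$ of length $m$. $\mathcal{E}$ is the standard self-similar symmetric resistance form $\mathcal{E}(u,u)=\lim_m(5/3)^m\sum_{x\sim_m y}(u(x)-u(y))^2$ (sum over unordered edges), with domain $\mathcal{F}\subset C(X)$.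 $\Delta$ is the Dirichlet Laplacian: the negative definite self-adjoint operator on $L^2(\mu)$ determined by $\mathcal{E}(u,v)=\int(-\Delta u)v\,d\mu$ for all $v\in\mathcal{F}$ with $v(a_1)=v(a_2)=v(a_3)=0$ (for $u\in\mathcal F$ also vanishing at the $a_j$). The spectrum $\operatorname{sp}(-\Delta)=\{\lambda_1\le\lambda_2\le\cdots\}\subset(0,\infty)$ consists of eigenvalues of finite multiplicity (repeated according to multiplicity) with $\lambda_n\to\infty$; $\{\varphi_n\}$ is an orthonormal basis of $L^2(\mu)$ of corresponding real eigenfunctions, and $D$ is the set of finite linear combinations of the $\varphi_n$. Pseudo-differential operators. For measurable $p:X\times(0,\infty)\to\mathbb{R}$, $p(x,-\Delta)$ is the operator $p(x,-\Delta)u(x)=\sum_n p(x,\lambda_n)\langle u,\varphi_n\rangle\varphi_n(x)$, $u\in D$. Projections. For $\Lambda>0$, $E_\Lambda$ is the span of all eigenfunctions of $-\Delta$ with eigenvalue $\le\Lambda$, $P_\Lambda$ is the orthogonal projection of $L^2(\mu)$ onto $E_\Lambda$, $d_\Lambda=\dim E_\Lambda$. The operator $P_\Lambda p(x,-\Delta)P_\Lambda$ is regarded as an operator on the finite-dimensional space $E_\Lambda$, and $\operatorname{Tr}F(P_\Lambda p(x,-\Delta)P_\Lambda)$ is the sum of $F(\sigma)$ over its eigenvalues $\sigma$, counted with multiplicity. *)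

theory Defs
  imports
    "HOL-Analysis.Analysis"
    "HOL-Probability.Probability_Measure"
    "HOL-Library.Function_Algebras"
    "Jordan_Normal_Form.Spectral_Radius"
begin

text \<open>
  The three vertices are a family \<open>a\<close> indexed by the three-element type \<^typ>\<open>3\<close>;
  words over the alphabet of three letters are lists of type \<open>3 list\<close>.
\<close>

type_synonym plane = "real^2"

definition gasket_map :: "(3 \<Rightarrow> plane) \<Rightarrow> 3 \<Rightarrow> plane \<Rightarrow> plane" where
  "gasket_map a j x = (1/2) *\<^sub>R (x - a j) + a j"

definition word_map :: "(3 \<Rightarrow> plane) \<Rightarrow> 3 list \<Rightarrow> plane \<Rightarrow> plane" where
  "word_map a w = foldr (\<lambda>j g. gasket_map a j \<circ> g) w id"

definition is_gasket :: "(3 \<Rightarrow> plane) \<Rightarrow> plane set \<Rightarrow> bool" where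
  "is_gasket a X \<longleftrightarrow>
     \<not> collinear (range a) \<and> compact X \<and> X \<noteq> {} \<and> X = (\<Union>j. gasket_map a j ` X)"

definition is_gasket_measure :: "(3 \<Rightarrow> plane) \<Rightarrow> plane set \<Rightarrow> plane measure \<Rightarrow> bool" where
  "is_gasket_measure a X \<mu> \<longleftrightarrow>
     prob_space \<mu> \<and> sets \<mu> = sets (restrict_space borel X) \<and>
     (\<forall>w. measure \<mu> (word_map a w ` X) = 1 / 3 ^ length w)"

definition square_integrable :: "plane measure \<Rightarrow> (plane \<Rightarrow> real) \<Rightarrow> bool" where
  "square_integrable \<mu> f \<longleftrightarrow> f \<in> borel_measurable \<mu> \<and> integrable \<mu> (\<lambda>x. (f x)\<^sup>2)"

definition L2_inner :: "plane measure \<Rightarrow> (plane \<Rightarrow> real) \<Rightarrow> (plane \<Rightarrow> real) \<Rightarrow> real" where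
  "L2_inner \<mu> f g = (\<integral>x. f x * g x \<partial>\<mu>)"

definition adjacent :: "(3 \<Rightarrow> plane) \<Rightarrow> nat \<Rightarrow> plane \<Rightarrow> plane \<Rightarrow> bool" where
  "adjacent a m x y \<longleftrightarrow>
     x \<noteq> y \<and>
     (\<exists>w. length w = m \<and> x \<in> word_map a w ` range a \<and> y \<in> word_map a w ` range a)"

text \<open>
  The bilinear (polarised) graph energies. The sum below runs over ordered pairs, hence
  the factor \<open>1/2\<close> turns it into a sum over unordered edges.
\<close>

definition graph_energy ::
    "(3 \<Rightarrow> plane) \<Rightarrow> nat \<Rightarrow> (plane \<Rightarrow> real) \<Rightarrow> (plane \<Rightarrow> real) \<Rightarrow> real" where
  "graph_energy a m u v =
     (5/3) ^ m * ((\<Sum>(x, y) \<in> {(x, y). adjacent a m x y}. (u x - u y) * (v x - v y)) / 2)"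

definition energy :: "(3 \<Rightarrow> plane) \<Rightarrow> (plane \<Rightarrow> real) \<Rightarrow> (plane \<Rightarrow> real) \<Rightarrow> real" where
  "energy a u v = lim (\<lambda>m. graph_energy a m u v)"

text \<open>
  A continuous function on \<open>X\<close> is represented by its extension by zero to the plane, so
  that two functions on \<open>X\<close> are equal iff their representatives are, and spans and
  dimensions of sets of functions have their usual meaning. The sequence of graph energies
  of a fixed function is nondecreasing, so convergence means that the limit is finite.
\<close>

definition energy_dom :: "(3 \<Rightarrow> plane) \<Rightarrow> plane set \<Rightarrow> (plane \<Rightarrow> real) set" where
  "energy_dom a X =
     {u. continuous_on X u \<and> (\<forall>x. x \<notin> X \<longrightarrow> u x = 0) \<and> convergent (\<lambda>m. graph_energy a m u u)}"

definition energy_dom0 :: "(3 \<Rightarrow> plane) \<Rightarrow> plane set \<Rightarrow> (plane \<Rightarrow> real) set" where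
  "energy_dom0 a X = {u \<in> energy_dom a X. \<forall>j. u (a j) = 0}"

text \<open>
  The graph of the operator: \<open>u\<close> lies in the domain of the Dirichlet Laplacian and is
  mapped to (the \<open>\<mu>\<close>-a.e. class of) \<open>f\<close>.
\<close>

definition dirichlet_laplacian ::
    "(3 \<Rightarrow> plane) \<Rightarrow> plane set \<Rightarrow> plane measure \<Rightarrow> (plane \<Rightarrow> real) \<Rightarrow> (plane \<Rightarrow> real) \<Rightarrow> bool" where
  "dirichlet_laplacian a X \<mu> u f \<longleftrightarrow>
     u \<in> energy_dom0 a X \<and> square_integrable \<mu> f \<and>
     (\<forall>v \<in> energy_dom0 a X. energy a u v = L2_inner \<mu> (\<lambda>x. - f x) v)"

definition eigenfunction ::
    "(3 \<Rightarrow> plane) \<Rightarrow> plane set \<Rightarrow> plane measure \<Rightarrow> real \<Rightarrow> (plane \<Rightarrow> real) \<Rightarrow> bool" where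
  "eigenfunction a X \<mu> l u \<longleftrightarrow>
     u \<noteq> (\<lambda>x. 0) \<and> dirichlet_laplacian a X \<mu> u (\<lambda>x. - (l * u x))"

definition eigenbasis ::
    "(3 \<Rightarrow> plane) \<Rightarrow> plane set \<Rightarrow> plane measure \<Rightarrow> (nat \<Rightarrow> real) \<Rightarrow> (nat \<Rightarrow> plane \<Rightarrow> real) \<Rightarrow> bool" where
  "eigenbasis a X \<mu> lam \<phi> \<longleftrightarrow>
     mono lam \<and> (\<forall>n. 0 < lam n) \<and> filterlim lam at_top sequentially \<and>
     (\<forall>n. eigenfunction a X \<mu> (lam n) (\<phi> n)) \<and>
     (\<forall>m n. L2_inner \<mu> (\<phi> m) (\<phi> n) = (if m = n then 1 else 0)) \<and>
     (\<forall>f. square_integrable \<mu> f \<longrightarrow>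
        (\<lambda>N. \<integral>x. (f x - (\<Sum>n<N. L2_inner \<mu> f (\<phi> n) * \<phi> n x))\<^sup>2 \<partial>\<mu>) \<longlonglongrightarrow> 0)"

interpretation rfun: vector_space "\<lambda>(c::real) (f::plane \<Rightarrow> real) x. c * f x"
  by unfold_locales (auto simp: fun_eq_iff algebra_simps)

definition eigenspace_upto ::
    "(3 \<Rightarrow> plane) \<Rightarrow> plane set \<Rightarrow> plane measure \<Rightarrow> real \<Rightarrow> (plane \<Rightarrow> real) set" where
  "eigenspace_upto a X \<mu> \<Lambda> = rfun.span {u. \<exists>l\<le>\<Lambda>. eigenfunction a X \<mu> l u}"

definition spectral_projection ::
    "(3 \<Rightarrow> plane) \<Rightarrow> plane set \<Rightarrow> plane measure \<Rightarrow> real \<Rightarrow> (plane \<Rightarrow> real) \<Rightarrow> plane \<Rightarrow> real" where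
  "spectral_projection a X \<mu> \<Lambda> f =
     (THE g. g \<in> eigenspace_upto a X \<mu> \<Lambda> \<and>
        (\<forall>h \<in> eigenspace_upto a X \<mu> \<Lambda>. L2_inner \<mu> (\<lambda>x. f x - g x) h = 0))"

text \<open>
  For \<open>u\<close> a finite linear combination of the \<open>\<phi> n\<close> only finitely many terms are nonzero.
\<close>

definition pseudo_diff_op ::
    "plane measure \<Rightarrow> (nat \<Rightarrow> real) \<Rightarrow> (nat \<Rightarrow> plane \<Rightarrow> real) \<Rightarrow> (plane \<Rightarrow> real \<Rightarrow> real) \<Rightarrow>
     (plane \<Rightarrow> real) \<Rightarrow> plane \<Rightarrow> real" where
  "pseudo_diff_op \<mu> lam \<phi> p u x = (\<Sum>n. p x (lam n) * L2_inner \<mu> u (\<phi> n) * \<phi> n x)"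

definition compression ::
    "(3 \<Rightarrow> plane) \<Rightarrow> plane set \<Rightarrow> plane measure \<Rightarrow> (nat \<Rightarrow> real) \<Rightarrow> (nat \<Rightarrow> plane \<Rightarrow> real) \<Rightarrow>
     (plane \<Rightarrow> real \<Rightarrow> real) \<Rightarrow> real \<Rightarrow> (plane \<Rightarrow> real) \<Rightarrow> plane \<Rightarrow> real" where
  "compression a X \<mu> lam \<phi> p \<Lambda> u =
     spectral_projection a X \<mu> \<Lambda>
       (pseudo_diff_op \<mu> lam \<phi> p (spectral_projection a X \<mu> \<Lambda> u))"

definition ordered_basis :: "(plane \<Rightarrow> real) list \<Rightarrow> (plane \<Rightarrow> real) set \<Rightarrow> bool" where
  "ordered_basis bs W \<longleftrightarrow>
     distinct bs \<and> rfun.independent (set bs) \<and> rfun.span (set bs) = W"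

text \<open>
  The matrix of the endomorphism \<open>T\<close> of \<open>W\<close> in some ordered basis of \<open>W\<close>, read as a complex
  matrix. Its spectrum and its characteristic polynomial do not depend on the basis.
\<close>

definition endo_matrix ::
    "(plane \<Rightarrow> real) set \<Rightarrow> ((plane \<Rightarrow> real) \<Rightarrow> plane \<Rightarrow> real) \<Rightarrow> complex mat" where
  "endo_matrix W T =
     (let bs = (SOME bs. ordered_basis bs W) in
      mat (length bs) (length bs)
        (\<lambda>(i, j). complex_of_real (rfun.representation (set bs) (T (bs ! j)) (bs ! i))))"

definition endo_eigenvalues ::
    "(plane \<Rightarrow> real) set \<Rightarrow> ((plane \<Rightarrow> real) \<Rightarrow> plane \<Rightarrow> real) \<Rightarrow> complex set" where
  "endo_eigenvalues W T = spectrum (endo_matrix W T)"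

text \<open>
  \<open>Tr F(T)\<close>: each eigenvalue is counted with its algebraic multiplicity. This is meant for
  operators whose eigenvalues are all real, where \<open>Re \<sigma>\<close> is just \<open>\<sigma>\<close>.
\<close>

definition trace_fun ::
    "(real \<Rightarrow> real) \<Rightarrow> (plane \<Rightarrow> real) set \<Rightarrow> ((plane \<Rightarrow> real) \<Rightarrow> plane \<Rightarrow> real) \<Rightarrow> real" where
  "trace_fun F W T =
     (\<Sum>\<sigma> \<in> endo_eigenvalues W T.
        real (Polynomial.order \<sigma> (char_poly (endo_matrix W T))) * F (Re \<sigma>))"

end

theory Submission
  imports Defs
begin

text \<open>
  Write \<open>d\<close> for the dimension of the spectral space at level \<open>\<Lambda>\<close>. The matrix of the compressed operator
  differs from the matrix of multiplication by \<open>q\<close> by a matrix of squared Hilbert-Schmidt norm \<open>o(d)\<close>,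
  because \<open>p(\<cdot>, \<lambda>\<^sub>n) \<rightarrow> q\<close> uniformly. It is not symmetric, but its spectrum is real by assumption, so in a
  Schur basis its nilpotent part is also \<open>o(d)\<close>, and its Schur vectors can be compared with approximate
  eigenvectors of multiplication by \<open>q\<close>. Such approximate eigenvectors are eigenfunctions of the Laplacian
  that are supported in a single small cell.

  That almost all eigenfunctions are of this kind is shown without spectral decimation. An
  eigenfunction with vanishing boundary values and vanishing normal derivatives can be scaled to any
  cell and extended by zero, and every antisymmetric eigenfunction (for the action of \<open>S\<^sub>3\<close>) is of this
  form. Let \<open>r(\<Lambda>)\<close> be the dimension of the orthogonal complement of all such eigenfunctions. An
  element of this complement is determined, up to finitely many values, by its orthogonal projections in
  the nine cells of level two, and it is orthogonal to a whole antisymmetric copy of the complement of level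
  \<open>\<Lambda>/25\<close> inside them. Thus \<open>r(\<Lambda>) \<le> 8 r(\<Lambda>/25) + 27\<close>, whereas \<open>d(\<Lambda>) \<ge> 9 d(\<Lambda>/25)\<close>, so that
  \<open>r(\<Lambda>) = o(d(\<Lambda>))\<close>.
\<close>

section \<open>Finite-dimensional subspaces and orthonormal systems\<close>

text \<open>Hilbert-Schmidt closeness alone says little about the eigenvalues of a non-symmetric
  matrix. Here the spectrum is real, so the Schur basis is real too, and its strictly triangular
  part is bounded by the antisymmetric part of the matrix, to which the symmetric comparison matrix
  contributes nothing.

  Antisymmetry on the gasket helps because antisymmetrising a test function makes it vanish at the
  three vertices. An antisymmetrised Dirichlet eigenfunction can therefore be tested against
  functions with free vertex values. Passing to a cell, energy scales by 5/3 and measure by 1/3, so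
  eigenvalues scale by 5 per level. Level two is the first level with a word, \<open>[1, 2]\<close>,
  that no nontrivial permutation of the letters fixes; this is where 25 and the nine cells come
  from.

  The function in the theorem is given on the interval only, and it is not evident that
  \<open>q\<close> takes values there. The limit is therefore proved first for bounded uniformly
  continuous functions on the line, and then applied to a distance from the interval in order to
  locate \<open>q\<close>.\<close>

locale real_vs = vector_space scale
  for scale :: "real \<Rightarrow> 'a::ab_group_add \<Rightarrow> 'a"
begin

text \<open>The function spaces below are infinite-dimensional, and \<open>dim\<close> has the
  default value 0 in infinite dimension; comparisons of dimensions therefore carry this
  predicate.\<close>

definition fin_dim :: "'a set \<Rightarrow> bool" where
  "fin_dim U \<longleftrightarrow> (\<exists>B. finite B \<and> U \<subseteq> span B)"

lemma fin_dim_span: "finite B \<Longrightarrow> fin_dim (span B)"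
  unfolding fin_dim_def by blast

lemma fin_dim_subset: "fin_dim V \<Longrightarrow> U \<subseteq> V \<Longrightarrow> fin_dim U"
  unfolding fin_dim_def by blast

lemma fin_dim_basis:
  assumes "fin_dim U"
  obtains B where "finite B" "B \<subseteq> U" "independent B" "U \<subseteq> span B" "card B = dim U"
proof -
  obtain D where D: "finite D" "U \<subseteq> span D"
    using assms unfolding fin_dim_def by blast
  obtain B where B: "B \<subseteq> U" "independent B" "U \<subseteq> span B" "card B = dim U"
    using basis_exists by blast
  have "finite B" using independent_span_bound[OF D(1) B(2)] B(1) D(2) by auto
  then show ?thesis using that B by blast
qed

lemma dim_mono_fin_dim:
  assumes "U \<subseteq> V" "fin_dim V"
  shows "dim U \<le> dim V"
proof -
  obtain B where B: "finite B" "B \<subseteq> V" "independent B" "V \<subseteq> span B" "card B = dim V"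
    by (rule fin_dim_basis[OF assms(2)])
  then show ?thesis using dim_le_card[of U B] assms(1) by auto
qed

lemma card_le_dim_fin_dim:
  assumes "independent B" "B \<subseteq> V" "fin_dim V"
  shows "finite B \<and> card B \<le> dim V"
proof -
  obtain D where D: "finite D" "D \<subseteq> V" "independent D" "V \<subseteq> span D" "card D = dim V"
    by (rule fin_dim_basis[OF assms(3)])
  then show ?thesis using independent_span_bound[OF D(1) assms(1)] assms(2) by auto
qed

lemma dim_kernel_one:
  assumes U: "subspace U" "fin_dim U"
    and add: "\<And>x y. x \<in> U \<Longrightarrow> y \<in> U \<Longrightarrow> L (x + y) = L x + L y"
    and scale: "\<And>c x. x \<in> U \<Longrightarrow> L (scale c x) = c * L x"
  shows "subspace {u\<in>U. L u = 0} \<and> dim U \<le> dim {u\<in>U. L u = 0} + 1"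
proof
  let ?K = "{u\<in>U. L u = 0}"
  have L0: "L 0 = 0" using scale[of 0 0] subspace_0[OF U(1)] by simp
  show "subspace ?K"
  proof (intro subspaceI)
    show "0 \<in> ?K" using L0 subspace_0[OF U(1)] by blast
    show "x + y \<in> ?K" if "x \<in> ?K" "y \<in> ?K" for x y
      using that add[of x y] subspace_add[OF U(1), of x y] by simp
    show "scale c x \<in> ?K" if "x \<in> ?K" for c x
      using that scale[of x c] subspace_scale[OF U(1), of x c] by simp
  qed
  have fK: "fin_dim ?K" by (rule fin_dim_subset[OF U(2)]) auto
  obtain B where B: "finite B" "B \<subseteq> ?K" "independent B" "?K \<subseteq> span B" "card B = dim ?K"
    by (rule fin_dim_basis[OF fK])
  show "dim U \<le> dim ?K + 1"
  proof (cases "\<exists>u\<in>U. L u \<noteq> 0")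
    case False
    then have "?K = U" by auto
    then show ?thesis by simp
  next
    case True
    then obtain u where u: "u \<in> U" "L u \<noteq> 0" by blast
    have "U \<subseteq> span (insert u B)"
    proof
      fix x assume x: "x \<in> U"
      let ?y = "x + scale (- (L x / L u)) u"
      have "?y \<in> U" using x u by (intro subspace_add[OF U(1)] subspace_scale[OF U(1)])
      moreover have "L ?y = 0"
        unfolding add[OF x subspace_scale[OF U(1) u(1)]] scale[OF u(1)] using u(2) by simp
      ultimately have "?y \<in> span B" using B(4) by auto
      then have "?y \<in> span (insert u B)" using span_mono[of B "insert u B"] by auto
      moreover have "scale (L x / L u) u \<in> span (insert u B)"
        by (simp add: span_base span_scale)
      ultimately have "?y + scale (L x / L u) u \<in> span (insert u B)" by (rule span_add)
      then show "x \<in> span (insert u B)" by (simp add: scale_minus_left)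
    qed
    then have "dim U \<le> card (insert u B)" using B(1) by (intro dim_le_card) auto
    also have "\<dots> \<le> card B + 1" using B(1) by (simp add: card_insert_if)
    finally show ?thesis using B(5) by simp
  qed
qed

text \<open>Each functional costs at most one dimension. Linearity is required on \<open>U\<close>
  only, since the functionals used later include inner products, which are bilinear only on a
  carrier.\<close>

lemma dim_kernel:
  assumes "finite I" and U: "subspace U" "fin_dim U"
    and add: "\<And>i x y. i \<in> I \<Longrightarrow> x \<in> U \<Longrightarrow> y \<in> U \<Longrightarrow> L i (x + y) = L i x + L i y"
    and scale: "\<And>i c x. i \<in> I \<Longrightarrow> x \<in> U \<Longrightarrow> L i (scale c x) = c * L i x"
  shows "subspace {u\<in>U. \<forall>i\<in>I. L i u = 0} \<and> dim U \<le> dim {u\<in>U. \<forall>i\<in>I. L i u = 0} + card I"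
  using assms(1) add scale
proof (induction I rule: finite_induct)
  case empty
  then show ?case using U(1) by simp
next
  case (insert j I)
  let ?K = "{u\<in>U. \<forall>i\<in>I. L i u = 0}"
  have IH: "subspace ?K" "dim U \<le> dim ?K + card I"
    using insert.IH insert.prems by auto
  have eq: "{u\<in>U. \<forall>i\<in>insert j I. L i u = 0} = {u\<in>?K. L j u = 0}" by auto
  have "subspace {u\<in>?K. L j u = 0} \<and> dim ?K \<le> dim {u\<in>?K. L j u = 0} + 1"
    using insert.prems by (intro dim_kernel_one IH fin_dim_subset[OF U(2)]) auto
  then show ?case unfolding eq using IH(2) insert.hyps by auto
qed

lemma kernel_nonzero:
  assumes "finite I" "subspace U" "fin_dim U" "card I < dim U"
    and "\<And>i x y. i \<in> I \<Longrightarrow> x \<in> U \<Longrightarrow> y \<in> U \<Longrightarrow> L i (x + y) = L i x + L i y"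
    and "\<And>i c x. i \<in> I \<Longrightarrow> x \<in> U \<Longrightarrow> L i (scale c x) = c * L i x"
  obtains u where "u \<in> U" "u \<noteq> 0" "\<And>i. i \<in> I \<Longrightarrow> L i u = 0"
proof -
  let ?K = "{u\<in>U. \<forall>i\<in>I. L i u = 0}"
  have "dim U \<le> dim ?K + card I" using dim_kernel[of I U L] assms by blast
  then have "dim ?K \<noteq> 0" using assms(4) by simp
  then have "\<not> ?K \<subseteq> {0}"
    using dim_le_card[of ?K "{}"] by auto
  then show ?thesis using that by blast
qed

end

text \<open>The carrier \<open>C\<close> will be the continuous functions on the gasket, extended by
  zero. On it the inner product is finite and definite, so functions can be used instead of classes
  modulo null sets.\<close>

locale ip_space = real_vs scale
  for scale :: "real \<Rightarrow> 'a::ab_group_add \<Rightarrow> 'a" (infixr "\<odot>" 75) +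
  fixes C :: "'a set" and ip :: "'a \<Rightarrow> 'a \<Rightarrow> real"
  assumes subspace_C: "subspace C"
    and ip_add: "x \<in> C \<Longrightarrow> y \<in> C \<Longrightarrow> z \<in> C \<Longrightarrow> ip (x + y) z = ip x z + ip y z"
    and ip_scale: "x \<in> C \<Longrightarrow> z \<in> C \<Longrightarrow> ip (c \<odot> x) z = c * ip x z"
    and ip_sym: "ip x y = ip y x"
    and ip_nonneg: "x \<in> C \<Longrightarrow> 0 \<le> ip x x"
    and ip_eq_0: "x \<in> C \<Longrightarrow> ip x x = 0 \<Longrightarrow> x = 0"
begin

lemma C_add: "x \<in> C \<Longrightarrow> y \<in> C \<Longrightarrow> x + y \<in> C"
  and C_scale: "x \<in> C \<Longrightarrow> c \<odot> x \<in> C"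
  and C_0: "0 \<in> C"
  and C_diff: "x \<in> C \<Longrightarrow> y \<in> C \<Longrightarrow> x - y \<in> C"
  and C_sum: "(\<And>i. i \<in> I \<Longrightarrow> f i \<in> C) \<Longrightarrow> (\<Sum>i\<in>I. f i) \<in> C"
  using subspace_C by (auto intro: subspace_add subspace_scale subspace_0 subspace_diff subspace_sum)

lemma span_in_C: "B \<subseteq> C \<Longrightarrow> span B \<subseteq> C"
  using span_minimal subspace_C by blast

lemma ip_0 [simp]: "z \<in> C \<Longrightarrow> ip 0 z = 0"
  using ip_scale[of 0 z 0] C_0 by simp

lemma ip_0_right [simp]: "z \<in> C \<Longrightarrow> ip z 0 = 0"
  using ip_0 ip_sym by metis

lemma ip_diff: "x \<in> C \<Longrightarrow> y \<in> C \<Longrightarrow> z \<in> C \<Longrightarrow> ip (x - y) z = ip x z - ip y z"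
  using ip_add[of "x - y" y z] C_diff by simp

lemma ip_add_right: "x \<in> C \<Longrightarrow> y \<in> C \<Longrightarrow> z \<in> C \<Longrightarrow> ip z (x + y) = ip z x + ip z y"
  using ip_add ip_sym by metis

lemma ip_diff_right: "x \<in> C \<Longrightarrow> y \<in> C \<Longrightarrow> z \<in> C \<Longrightarrow> ip z (x - y) = ip z x - ip z y"
  using ip_diff ip_sym by metis

lemma ip_scale_right: "x \<in> C \<Longrightarrow> z \<in> C \<Longrightarrow> ip z (c \<odot> x) = c * ip z x"
  using ip_scale ip_sym by metis

lemma ip_sum:
  assumes "\<And>i. i \<in> I \<Longrightarrow> f i \<in> C" "z \<in> C"
  shows "ip (\<Sum>i\<in>I. f i) z = (\<Sum>i\<in>I. ip (f i) z)"
  using assms by (induction I rule: infinite_finite_induct) (auto simp: ip_add C_sum)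

lemma ip_lincomb:
  assumes "\<And>i. i \<in> I \<Longrightarrow> f i \<in> C" "z \<in> C"
  shows "ip (\<Sum>i\<in>I. c i \<odot> f i) z = (\<Sum>i\<in>I. c i * ip (f i) z)"
  using assms by (subst ip_sum) (auto simp: C_scale ip_scale)

lemma ip_lincomb_right:
  assumes "\<And>i. i \<in> I \<Longrightarrow> f i \<in> C" "z \<in> C"
  shows "ip z (\<Sum>i\<in>I. c i \<odot> f i) = (\<Sum>i\<in>I. c i * ip z (f i))"
  using ip_lincomb[OF assms] by (simp add: ip_sym)

lemma ip_ortho_span:
  assumes "B \<subseteq> C" "z \<in> C" "\<And>b. b \<in> B \<Longrightarrow> ip z b = 0" "x \<in> span B"
  shows "ip z x = 0"
proof -
  have "subspace {x\<in>C. ip z x = 0}"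
    using assms(2) by (intro subspaceI) (auto simp: C_0 C_add C_scale ip_add_right ip_scale_right)
  then have "span B \<subseteq> {x\<in>C. ip z x = 0}"
    using assms(1,3) by (intro span_minimal) auto
  then show ?thesis using assms(4) by auto
qed

section \<open>Orthonormal systems\<close>

definition ons :: "'i set \<Rightarrow> ('i \<Rightarrow> 'a) \<Rightarrow> bool" where
  "ons I e \<longleftrightarrow> (\<forall>i\<in>I. e i \<in> C) \<and> (\<forall>i\<in>I. \<forall>j\<in>I. ip (e i) (e j) = (if i = j then 1 else 0))"

lemma ons_in_C: "ons I e \<Longrightarrow> i \<in> I \<Longrightarrow> e i \<in> C"
  unfolding ons_def by blast

lemma ons_ip: "ons I e \<Longrightarrow> i \<in> I \<Longrightarrow> j \<in> I \<Longrightarrow> ip (e i) (e j) = (if i = j then 1 else 0)"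
  unfolding ons_def by blast

lemma ons_ip_lincomb:
  assumes "ons I e" "finite I" "j \<in> I"
  shows "ip (\<Sum>i\<in>I. c i \<odot> e i) (e j) = c j"
proof -
  have "ip (\<Sum>i\<in>I. c i \<odot> e i) (e j) = (\<Sum>i\<in>I. c i * ip (e i) (e j))"
    using assms by (intro ip_lincomb) (auto intro: ons_in_C)
  also have "\<dots> = (\<Sum>i\<in>I. if i = j then c j else 0)"
    using assms by (intro sum.cong) (auto simp: ons_ip)
  also have "\<dots> = c j" using assms by simp
  finally show ?thesis .
qed

lemma ons_inj: "ons I e \<Longrightarrow> inj_on e I"
  unfolding ons_def inj_on_def by (metis zero_neq_one)

lemma ons_independent:
  assumes "ons I e" "finite I"
  shows "independent (e ` I)"
proof (rule independent_if_scalars_zero)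
  show "finite (e ` I)" using assms by simp
  fix f x assume s: "(\<Sum>x\<in>e ` I. f x \<odot> x) = 0" and "x \<in> e ` I"
  then obtain j where j: "j \<in> I" "x = e j" by blast
  have "(\<Sum>i\<in>I. f (e i) \<odot> e i) = 0"
    using s sum.reindex[OF ons_inj[OF assms(1)], of "\<lambda>x. f x \<odot> x"] by simp
  then show "f x = 0" using ons_ip_lincomb[OF assms j(1), of "\<lambda>i. f (e i)"] j
    by (simp add: ons_in_C[OF assms(1) j(1)])
qed

lemma ons_card_le_dim:
  assumes "ons I e" "finite I" "e ` I \<subseteq> U" "fin_dim U"
  shows "card I \<le> dim U"
  using card_le_dim_fin_dim[OF ons_independent[OF assms(1,2)] assms(3,4)]
    card_image[OF ons_inj[OF assms(1)]] by simp

lemma dim_span_ons: "ons I e \<Longrightarrow> finite I \<Longrightarrow> dim (span (e ` I)) = card I"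
  using dim_eq_card_independent[OF ons_independent[of I e]] dim_span card_image[OF ons_inj[of I e]]
  by simp

text \<open>Serves twice: nonnegativity of the left side is Bessel's inequality, and letting the
  system grow gives Parseval's identity for the eigenbasis.\<close>

lemma ip_residual:
  assumes "ons I e" "finite I" "x \<in> C"
  shows "ip (x - (\<Sum>i\<in>I. ip x (e i) \<odot> e i)) (x - (\<Sum>i\<in>I. ip x (e i) \<odot> e i))
    = ip x x - (\<Sum>i\<in>I. (ip x (e i))\<^sup>2)"
proof -
  let ?p = "\<Sum>i\<in>I. ip x (e i) \<odot> e i"
  have p: "?p \<in> C" using assms by (intro C_sum C_scale) (auto intro: ons_in_C)
  have xp: "ip ?p x = (\<Sum>i\<in>I. (ip x (e i))\<^sup>2)"
    using assms by (subst ip_lincomb) (auto intro: ons_in_C simp: power2_eq_square ip_sym[of x])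
  have "ip ?p ?p = (\<Sum>i\<in>I. ip x (e i) * ip ?p (e i))"
    using assms p by (subst ip_lincomb_right) (auto intro: ons_in_C)
  also have "\<dots> = (\<Sum>i\<in>I. (ip x (e i))\<^sup>2)"
    using ons_ip_lincomb[OF assms(1,2), of _ "\<lambda>i. ip x (e i)"]
    by (intro sum.cong) (simp_all add: power2_eq_square)
  finally have pp: "ip ?p ?p = (\<Sum>i\<in>I. (ip x (e i))\<^sup>2)" .
  show ?thesis
    using assms p pp xp ip_sym[of x ?p] by (simp add: ip_diff ip_diff_right C_diff)
qed

lemma bessel:
  assumes "ons I e" "finite I" "x \<in> C"
  shows "(\<Sum>i\<in>I. (ip x (e i))\<^sup>2) \<le> ip x x"
proof -
  let ?p = "\<Sum>i\<in>I. ip x (e i) \<odot> e i"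
  have "?p \<in> C" using assms by (intro C_sum C_scale) (auto intro: ons_in_C)
  then have "0 \<le> ip (x - ?p) (x - ?p)" using assms(3) by (intro ip_nonneg C_diff)
  then show ?thesis unfolding ip_residual[OF assms] by simp
qed

lemma ons_expand:
  assumes "ons I e" "finite I" "x \<in> span (e ` I)"
  shows "x = (\<Sum>i\<in>I. ip x (e i) \<odot> e i)"
proof -
  let ?p = "\<Sum>i\<in>I. ip x (e i) \<odot> e i"
  have eC: "e ` I \<subseteq> C" using ons_in_C[OF assms(1)] by auto
  have p: "?p \<in> span (e ` I)" by (intro span_sum span_scale span_base) auto
  then have xp: "x - ?p \<in> span (e ` I)" using assms by (intro span_diff)
  have C: "x \<in> C" "?p \<in> C" "x - ?p \<in> C" using xp p assms(3) span_in_C[OF eC] by auto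
  have "ip (x - ?p) (x - ?p) = 0"
  proof (rule ip_ortho_span[OF eC C(3) _ xp])
    fix b assume "b \<in> e ` I"
    then obtain j where j: "j \<in> I" "b = e j" by blast
    then show "ip (x - ?p) b = 0"
      using C ons_in_C[OF assms(1) j(1)] ons_ip_lincomb[OF assms(1,2) j(1)] by (simp add: ip_diff)
  qed
  then show ?thesis using ip_eq_0[OF C(3)] by simp
qed

lemma parseval:
  assumes "ons I e" "finite I" "x \<in> span (e ` I)" "y \<in> C"
  shows "ip x y = (\<Sum>i\<in>I. ip x (e i) * ip y (e i))"
proof -
  have "ip x y = ip (\<Sum>i\<in>I. ip x (e i) \<odot> e i) y" using ons_expand[OF assms(1-3)] by simp
  also have "\<dots> = (\<Sum>i\<in>I. ip x (e i) * ip y (e i))"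
    using assms by (subst ip_lincomb) (auto intro: ons_in_C simp: ip_sym[of y])
  finally show ?thesis .
qed

lemma parseval_sq:
  assumes "ons I e" "finite I" "x \<in> span (e ` I)" "x \<in> C"
  shows "(\<Sum>i\<in>I. (ip x (e i))\<^sup>2) = ip x x"
  using parseval[OF assms] by (simp add: power2_eq_square)

lemma normalize:
  assumes "x \<in> C" "x \<noteq> 0"
  shows "ip (inverse (sqrt (ip x x)) \<odot> x) (inverse (sqrt (ip x x)) \<odot> x) = 1"
    and "inverse (sqrt (ip x x)) \<noteq> 0"
proof -
  have "ip x x > 0" using assms ip_nonneg ip_eq_0 by (metis order_le_less)
  then have s: "sqrt (ip x x) > 0" "sqrt (ip x x) * sqrt (ip x x) = ip x x" by auto
  show "inverse (sqrt (ip x x)) \<noteq> 0" using s by simp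
  have "inverse t * (inverse t * (t * t)) = 1" if "t > 0" for t :: real
    using that by (simp add: field_simps)
  from this[OF s(1)] have "inverse (sqrt (ip x x)) * (inverse (sqrt (ip x x)) * ip x x) = 1"
    unfolding s(2) .
  then show "ip (inverse (sqrt (ip x x)) \<odot> x) (inverse (sqrt (ip x x)) \<odot> x) = 1"
    using assms s by (simp add: ip_scale ip_scale_right C_scale)
qed

text \<open>Fewer than \<open>dim U\<close> orthogonality conditions leave a nonzero vector of
  \<open>U\<close>; normalised, it extends the system.\<close>

lemma ons_exists:
  assumes U: "subspace U" "fin_dim U" "U \<subseteq> C"
  obtains e where "ons {..<dim U} e" "\<And>i. i < dim U \<Longrightarrow> e i \<in> U"
proof -
  have "k \<le> dim U \<Longrightarrow> \<exists>e. ons {..<k} e \<and> (\<forall>i<k. e i \<in> U)" for k :: nat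
  proof (induction k)
    case 0
    show ?case by (auto simp: ons_def)
  next
    case (Suc k)
    then obtain e where e: "ons {..<k} e" "\<forall>i<k. e i \<in> U" by auto
    obtain u where u: "u \<in> U" "u \<noteq> 0" "\<And>i. i \<in> {..<k} \<Longrightarrow> ip u (e i) = 0"
      using kernel_nonzero[of "{..<k}" U "\<lambda>i x. ip x (e i)"] U Suc.prems e(2)
      by (auto simp: ip_add ip_scale subset_iff)
    define v where "v = inverse (sqrt (ip u u)) \<odot> u"
    have uC: "u \<in> C" using u U by blast
    have v: "v \<in> U" "ip v v = 1" "v \<in> C"
      using normalize[OF uC u(2)] u(1) U(1) uC by (auto simp: v_def subspace_scale C_scale)
    have ve: "ip v (e i) = 0" if "i < k" for i
      using u(3) that e(2) U(3) uC by (auto simp: v_def ip_scale subset_iff)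
    have "ons {..<Suc k} (e(k := v))"
      using e v ve ip_sym U(3) unfolding ons_def by (auto simp: less_Suc_eq)
    moreover have "\<forall>i<Suc k. (e(k := v)) i \<in> U" using e v by (auto simp: less_Suc_eq)
    ultimately show ?case by blast
  qed
  then show ?thesis using that by blast
qed

lemma ons_spans:
  assumes "ons I e" "finite I" "e ` I \<subseteq> U" "fin_dim U" "U \<subseteq> C" "subspace U" "card I = dim U"
  shows "span (e ` I) = U"
proof
  show "span (e ` I) \<subseteq> U" using assms span_minimal by blast
  show "U \<subseteq> span (e ` I)"
  proof
    fix x assume x: "x \<in> U"
    show "x \<in> span (e ` I)"
    proof (rule ccontr)
      assume n: "x \<notin> span (e ` I)"
      then have ind: "independent (insert x (e ` I))" and "x \<notin> e ` I"
        using ons_independent[OF assms(1,2)] span_base by (auto simp: independent_insert)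
      have "card (insert x (e ` I)) \<le> dim U"
        using card_le_dim_fin_dim[OF ind _ assms(4)] x assms(3) by auto
      then show False using \<open>x \<notin> e ` I\<close> assms(2,7) card_image[OF ons_inj[OF assms(1)]] by simp
    qed
  qed
qed

text \<open>Orthogonality to \<open>V\<close> can be tested on a basis of \<open>V\<close>, so it
  amounts to \<open>dim V\<close> linear conditions.\<close>

lemma ortho_complement_dim:
  assumes U: "subspace U" "fin_dim U" "U \<subseteq> C" and V: "fin_dim V" "V \<subseteq> C"
  shows "dim U \<le> dim {u\<in>U. \<forall>v\<in>V. ip u v = 0} + dim V"
proof -
  obtain B where B: "finite B" "B \<subseteq> V" "independent B" "V \<subseteq> span B" "card B = dim V"
    by (rule fin_dim_basis[OF V(1)])
  have BC: "B \<subseteq> C" using B V by blast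
  have eq: "{u\<in>U. \<forall>v\<in>V. ip u v = 0} = {u\<in>U. \<forall>b\<in>B. ip u b = 0}"
    using B U(3) ip_ortho_span[OF BC] by blast
  have "dim U \<le> dim {u\<in>U. \<forall>b\<in>B. ip u b = 0} + card B"
    using dim_kernel[of B U "\<lambda>b x. ip x b"] U B(1) BC by (auto simp: ip_add ip_scale subset_iff)
  then show ?thesis using eq B(5) by simp
qed

lemma ortho_nonzero:
  assumes U: "subspace U" "fin_dim U" "U \<subseteq> C" and V: "fin_dim V" "V \<subseteq> C" and "dim V < dim U"
  obtains u where "u \<in> U" "u \<noteq> 0" "\<And>v. v \<in> V \<Longrightarrow> ip u v = 0"
proof -
  have "dim {u\<in>U. \<forall>v\<in>V. ip u v = 0} \<noteq> 0"
    using ortho_complement_dim[OF U V] assms(6) by linarith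
  then have "\<not> {u\<in>U. \<forall>v\<in>V. ip u v = 0} \<subseteq> {0}"
    using dim_le_card[of "{u\<in>U. \<forall>v\<in>V. ip u v = 0}" "{}"] by auto
  then show ?thesis using that by blast
qed

text \<open>Stated modulo \<open>U\<close> instead of by a formula for \<open>g\<close>: the Schur
  basis only uses that \<open>f\<close> and \<open>g\<close> generate the same space over
  \<open>U\<close>.\<close>

lemma gram_schmidt_step:
  assumes U: "subspace U" "fin_dim U" "U \<subseteq> C" and f: "f \<in> C" "f \<notin> U"
  obtains g c where "g - c \<odot> f \<in> U" "c \<noteq> 0" "ip g g = 1" "\<And>u. u \<in> U \<Longrightarrow> ip g u = 0" "g \<in> C"
proof -
  obtain e where e: "ons {..<dim U} e" "\<And>i. i < dim U \<Longrightarrow> e i \<in> U"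
    using ons_exists[OF U] by blast
  have sp: "span (e ` {..<dim U}) = U"
    using e by (intro ons_spans U) auto
  define p where "p = (\<Sum>i<dim U. ip f (e i) \<odot> e i)"
  have p: "p \<in> U" unfolding p_def using e(2) by (intro subspace_sum subspace_scale U) auto
  then have pC: "p \<in> C" "f - p \<in> C" using U(3) f(1) C_diff by auto
  have ne: "f - p \<noteq> 0" using p f(2) by auto
  have "ip (f - p) u = 0" if "u \<in> U" for u
  proof (rule ip_ortho_span[of "e ` {..<dim U}"])
    show "e ` {..<dim U} \<subseteq> C" using e U by auto
    fix b assume "b \<in> e ` {..<dim U}"
    then obtain j where j: "j \<in> {..<dim U}" "b = e j" by blast
    then show "ip (f - p) b = 0"
      using ons_ip_lincomb[OF e(1) _ j(1), of "\<lambda>i. ip f (e i)"] f(1) pC ons_in_C[OF e(1) j(1)]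
      by (simp add: ip_diff p_def)
  qed (use that sp pC in auto)
  note o = this
  define c where "c = inverse (sqrt (ip (f - p) (f - p)))"
  show ?thesis
  proof (rule that[of "c \<odot> (f - p)" c])
    have "c \<odot> (f - p) - c \<odot> f = (- c) \<odot> p" by (simp add: scale_right_diff_distrib scale_minus_left)
    then show "c \<odot> (f - p) - c \<odot> f \<in> U" using p U(1) by (metis subspace_scale)
    show "c \<noteq> 0" "ip (c \<odot> (f - p)) (c \<odot> (f - p)) = 1"
      using normalize[OF pC(2) ne] by (auto simp: c_def)
    show "ip (c \<odot> (f - p)) u = 0" if "u \<in> U" for u
      using o[OF that] that U(3) pC by (auto simp: ip_scale subset_iff)
    show "c \<odot> (f - p) \<in> C" using pC C_scale by blast
  qed
qed

text \<open>The matrix acts after orthogonal projection onto the span of \<open>\<phi>\<close>, so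
  the operator is available on the whole carrier and its adjoint is given by the transposed
  matrix.\<close>

definition mat_op :: "nat \<Rightarrow> (nat \<Rightarrow> 'a) \<Rightarrow> (nat \<Rightarrow> nat \<Rightarrow> real) \<Rightarrow> 'a \<Rightarrow> 'a" where
  "mat_op d \<phi> M x = (\<Sum>m<d. (\<Sum>n<d. M m n * ip x (\<phi> n)) \<odot> \<phi> m)"

lemma mat_op_in_span: "mat_op d \<phi> M x \<in> span (\<phi> ` {..<d})"
  unfolding mat_op_def by (intro span_sum span_scale span_base) auto

lemma mat_op_in_C: "ons {..<d} \<phi> \<Longrightarrow> mat_op d \<phi> M x \<in> C"
  unfolding mat_op_def by (intro C_sum C_scale) (auto intro: ons_in_C)

lemma ip_mat_op:
  assumes "ons {..<d} \<phi>" "y \<in> C"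
  shows "ip (mat_op d \<phi> M x) y = (\<Sum>m<d. \<Sum>n<d. M m n * ip x (\<phi> n) * ip y (\<phi> m))"
proof -
  have "ip (mat_op d \<phi> M x) y = (\<Sum>m<d. (\<Sum>n<d. M m n * ip x (\<phi> n)) * ip (\<phi> m) y)"
    unfolding mat_op_def using assms by (intro ip_lincomb) (auto intro: ons_in_C)
  then show ?thesis by (simp add: sum_distrib_right ip_sym[of y])
qed

lemma ip_mat_op_transpose:
  assumes "ons {..<d} \<phi>" "x \<in> C" "y \<in> C"
  shows "ip (mat_op d \<phi> M x) y = ip x (mat_op d \<phi> (\<lambda>m n. M n m) y)"
proof -
  have "ip (mat_op d \<phi> M x) y = (\<Sum>n<d. \<Sum>m<d. M m n * ip x (\<phi> n) * ip y (\<phi> m))"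
    unfolding ip_mat_op[OF assms(1,3)] by (rule sum.swap)
  also have "\<dots> = ip (mat_op d \<phi> (\<lambda>m n. M n m) y) x"
    unfolding ip_mat_op[OF assms(1,2)] by (simp add: ac_simps)
  finally show ?thesis by (simp add: ip_sym)
qed

lemma ip_mat_op_diff:
  assumes "ons {..<d} \<phi>" "y \<in> C"
  shows "ip (mat_op d \<phi> (\<lambda>m n. M m n - N m n) x) y = ip (mat_op d \<phi> M x) y - ip (mat_op d \<phi> N x) y"
  unfolding ip_mat_op[OF assms] by (simp add: left_diff_distrib sum_subtractf)

text \<open>The Hilbert-Schmidt norm does not grow when measured in another orthonormal system:
  written as inner products with the rows \<open>a m\<close>, the left side becomes, after
  exchanging the sums, one Bessel sum per row.\<close>

lemma hilbert_schmidt_bound: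
  assumes \<phi>: "ons {..<d} \<phi>" and \<psi>: "ons I \<psi>" "finite I"
  shows "(\<Sum>i\<in>I. ip (mat_op d \<phi> M (\<psi> i)) (mat_op d \<phi> M (\<psi> i))) \<le> (\<Sum>m<d. \<Sum>n<d. (M m n)\<^sup>2)"
proof -
  define a where "a m = (\<Sum>n<d. M m n \<odot> \<phi> n)" for m
  have aC: "a m \<in> C" for m unfolding a_def by (intro C_sum C_scale) (auto intro: ons_in_C[OF \<phi>])
  have comp: "ip (mat_op d \<phi> M x) (\<phi> m) = ip x (a m)" if "m < d" "x \<in> C" for x m
  proof -
    have "ip (mat_op d \<phi> M x) (\<phi> m) = (\<Sum>n<d. M m n * ip x (\<phi> n))"
      unfolding mat_op_def using that \<phi> by (intro ons_ip_lincomb) auto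
    also have "\<dots> = ip x (a m)"
      unfolding a_def using that by (subst ip_lincomb_right) (auto intro: ons_in_C[OF \<phi>])
    finally show ?thesis .
  qed
  have "(\<Sum>i\<in>I. ip (mat_op d \<phi> M (\<psi> i)) (mat_op d \<phi> M (\<psi> i))) =
        (\<Sum>i\<in>I. \<Sum>m<d. (ip (\<psi> i) (a m))\<^sup>2)"
  proof (rule sum.cong[OF refl])
    fix i assume i: "i \<in> I"
    have "ip (mat_op d \<phi> M (\<psi> i)) (mat_op d \<phi> M (\<psi> i)) = (\<Sum>m<d. (ip (mat_op d \<phi> M (\<psi> i)) (\<phi> m))\<^sup>2)"
      using mat_op_in_span mat_op_in_C[OF \<phi>] by (intro parseval_sq[OF \<phi>, symmetric]) auto
    also have "\<dots> = (\<Sum>m<d. (ip (\<psi> i) (a m))\<^sup>2)"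
      using comp ons_in_C[OF \<psi>(1) i] by simp
    finally show "ip (mat_op d \<phi> M (\<psi> i)) (mat_op d \<phi> M (\<psi> i)) = (\<Sum>m<d. (ip (\<psi> i) (a m))\<^sup>2)" .
  qed
  also have "\<dots> = (\<Sum>m<d. \<Sum>i\<in>I. (ip (a m) (\<psi> i))\<^sup>2)"
    by (subst sum.swap) (simp add: ip_sym)
  also have "\<dots> \<le> (\<Sum>m<d. ip (a m) (a m))"
    using bessel[OF \<psi> aC] by (intro sum_mono)
  also have "\<dots> = (\<Sum>m<d. \<Sum>n<d. (M m n)\<^sup>2)"
  proof (rule sum.cong[OF refl])
    fix m
    have am: "ip (a m) (\<phi> n) = M m n" if "n < d" for n
      unfolding a_def using that \<phi> by (intro ons_ip_lincomb) auto
    have "a m \<in> span (\<phi> ` {..<d})"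
      unfolding a_def by (intro span_sum span_scale span_base) auto
    then have "(\<Sum>n<d. (ip (a m) (\<phi> n))\<^sup>2) = ip (a m) (a m)"
      using aC by (intro parseval_sq[OF \<phi>]) auto
    then show "ip (a m) (a m) = (\<Sum>n<d. (M m n)\<^sup>2)" using am by simp
  qed
  finally show ?thesis .
qed

text \<open>
  A matrix with real spectrum that is close to a symmetric one in the Hilbert-Schmidt norm is
  nearly normal: in a Schur basis its strictly upper triangular part is controlled by its
  antisymmetric part. Hence the squared overlaps of Schur vectors with approximate eigenvectors
  of the symmetric matrix form weights that match up the two spectra.
\<close>

lemma schur_overlap_bound:
  assumes \<phi>: "ons {..<d} \<phi>" and \<psi>: "ons {..<d} \<psi>" "\<psi> ` {..<d} \<subseteq> span (\<phi> ` {..<d})"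
    and tri: "\<And>i k. i \<le> k \<Longrightarrow> k < d \<Longrightarrow>
      ip (mat_op d \<phi> M (\<psi> i)) (\<psi> k) = (if i = k then s i else 0)"
    and sym: "\<And>m n. S m n = S n m"
    and e: "ons J e" "finite J"
    and approx: "\<And>j. j \<in> J \<Longrightarrow>
      ip (mat_op d \<phi> S (e j) - c j \<odot> e j) (mat_op d \<phi> S (e j) - c j \<odot> e j) \<le> \<delta>"
  shows "(\<Sum>i<d. \<Sum>j\<in>J. (s i - c j)\<^sup>2 * (ip (\<psi> i) (e j))\<^sup>2)
           \<le> 15 * (\<Sum>m<d. \<Sum>n<d. (M m n - S m n)\<^sup>2) + 3 * \<delta> * card J"
proof -
  define H where "H = (\<Sum>m<d. \<Sum>n<d. (M m n - S m n)\<^sup>2)"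
  define T where "T = mat_op d \<phi> M"
  define Q where "Q = mat_op d \<phi> S"
  define D where "D = mat_op d \<phi> (\<lambda>m n. M m n - S m n)"
  define N where "N i = T (\<psi> i) - s i \<odot> \<psi> i" for i
  have psiC: "\<psi> i \<in> C" if "i < d" for i using ons_in_C[OF \<psi>(1)] that by auto
  have eC: "e j \<in> C" if "j \<in> J" for j using ons_in_C[OF e(1) that] .
  have opC: "T x \<in> C" "Q x \<in> C" "D x \<in> C" for x
    unfolding T_def Q_def D_def using mat_op_in_C[OF \<phi>] by auto
  have NC: "N i \<in> C" if "i < d" for i unfolding N_def using opC psiC[OF that] C_diff C_scale by auto
  have spE: "span (\<psi> ` {..<d}) = span (\<phi> ` {..<d})"
    using \<psi> dim_span_ons[OF \<phi>] span_in_C[of "\<phi> ` {..<d}"] ons_in_C[OF \<phi>]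
    by (intro ons_spans fin_dim_span) auto
  have Nspan: "N i \<in> span (\<psi> ` {..<d})" if "i < d" for i
  proof -
    have "T (\<psi> i) \<in> span (\<psi> ` {..<d})" unfolding T_def spE by (rule mat_op_in_span)
    moreover have "\<psi> i \<in> span (\<psi> ` {..<d})" using that by (intro span_base) auto
    ultimately show ?thesis unfolding N_def by (metis span_diff span_scale)
  qed
  have ipN: "ip (N i) (\<psi> k) = (if k < i then ip (T (\<psi> i)) (\<psi> k) else 0)" if "i < d" "k < d" for i k
    using that tri[of i k] opC psiC ons_ip[OF \<psi>(1), of i k]
    by (auto simp: N_def ip_diff ip_scale C_scale T_def)
  have "(\<Sum>i<d. ip (N i) (N i)) \<le> 4 * H"
  proof -
    \<comment> \<open>Twice the antisymmetric part. For \<open>k < i\<close> its entry equals that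
      of \<open>N i\<close>, because \<open>T (\<psi> k)\<close> has no component along
      \<open>\<psi> i\<close>.\<close>
    define K where "K = mat_op d \<phi> (\<lambda>m n. M m n - M n m)"
    have "ip (N i) (N i) \<le> ip (K (\<psi> i)) (K (\<psi> i))" if i: "i < d" for i
    proof -
      have "ip (N i) (N i) = (\<Sum>k<d. (ip (N i) (\<psi> k))\<^sup>2)"
        using parseval_sq[OF \<psi>(1) _ Nspan[OF i] NC[OF i]] by simp
      also have "\<dots> \<le> (\<Sum>k<d. (ip (K (\<psi> i)) (\<psi> k))\<^sup>2)"
      proof (rule sum_mono)
        fix k assume "k \<in> {..<d}"
        then have k: "k < d" by simp
        show "(ip (N i) (\<psi> k))\<^sup>2 \<le> (ip (K (\<psi> i)) (\<psi> k))\<^sup>2"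
        proof (cases "k < i")
          case True
          have "ip (K (\<psi> i)) (\<psi> k) = ip (T (\<psi> i)) (\<psi> k) - ip (\<psi> i) (T (\<psi> k))"
            unfolding K_def T_def ip_mat_op_diff[OF \<phi> psiC[OF k]]
            using ip_mat_op_transpose[OF \<phi> psiC[OF i] psiC[OF k], of "\<lambda>m n. M n m"] by simp
          moreover have "ip (T (\<psi> k)) (\<psi> i) = 0"
            using tri[of k i] True i by (simp add: T_def)
          ultimately show ?thesis using ipN[OF i k] True by (simp add: ip_sym)
        next
          case False
          then show ?thesis using ipN[OF i k] by simp
        qed
      qed
      also have "\<dots> \<le> ip (K (\<psi> i)) (K (\<psi> i))"
        using bessel[OF \<psi>(1)] mat_op_in_C[OF \<phi>] by (simp add: K_def)
      finally show ?thesis .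
    qed
    then have "(\<Sum>i<d. ip (N i) (N i)) \<le> (\<Sum>i<d. ip (K (\<psi> i)) (K (\<psi> i)))"
      by (intro sum_mono) auto
    also have "\<dots> \<le> (\<Sum>m<d. \<Sum>n<d. (M m n - M n m)\<^sup>2)"
      unfolding K_def by (rule hilbert_schmidt_bound[OF \<phi> \<psi>(1)]) simp
    \<comment> \<open>The symmetric \<open>S\<close> cancels in the difference of \<open>M\<close>
      and its transpose; what remains is at most 2 H + 2 H.\<close>
    also have "\<dots> \<le> (\<Sum>m<d. \<Sum>n<d. 2 * (M m n - S m n)\<^sup>2 + 2 * (M n m - S n m)\<^sup>2)"
    proof (intro sum_mono)
      fix m n
      have "0 \<le> ((M m n - S m n) + (M n m - S n m))\<^sup>2" by simp
      then show "(M m n - M n m)\<^sup>2 \<le> 2 * (M m n - S m n)\<^sup>2 + 2 * (M n m - S n m)\<^sup>2"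
        using sym[of m n] by (simp add: power2_eq_square algebra_simps)
    qed
    also have "\<dots> = 2 * H + 2 * (\<Sum>m<d. \<Sum>n<d. (M n m - S n m)\<^sup>2)"
      unfolding H_def by (simp add: sum.distrib sum_distrib_left)
    also have "(\<Sum>m<d. \<Sum>n<d. (M n m - S n m)\<^sup>2) = H"
      unfolding H_def by (rule sum.swap)
    finally show ?thesis by simp
  qed
  note Nbound = this
  have key: "(s i - c j)\<^sup>2 * (ip (\<psi> i) (e j))\<^sup>2 \<le>
      3 * (ip (D (\<psi> i)) (e j))\<^sup>2 + 3 * (ip (N i) (e j))\<^sup>2 + 3 * (ip (Q (e j) - c j \<odot> e j) (\<psi> i))\<^sup>2"
    if i: "i < d" and j: "j \<in> J" for i j
  proof -
    have "ip (D (\<psi> i)) (e j) = ip (T (\<psi> i)) (e j) - ip (Q (\<psi> i)) (e j)"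
      unfolding D_def T_def Q_def by (rule ip_mat_op_diff[OF \<phi> eC[OF j]])
    moreover have "ip (Q (\<psi> i)) (e j) = ip (Q (e j)) (\<psi> i)"
    proof -
      have "(\<lambda>m n. S n m) = S" using sym by auto
      then show ?thesis
        using ip_mat_op_transpose[OF \<phi> psiC[OF i] eC[OF j], of S] by (simp add: Q_def ip_sym)
    qed
    moreover have "ip (N i) (e j) = ip (T (\<psi> i)) (e j) - s i * ip (\<psi> i) (e j)"
      unfolding N_def using opC psiC[OF i] eC[OF j] by (simp add: ip_diff ip_scale C_scale)
    moreover have "ip (Q (e j) - c j \<odot> e j) (\<psi> i) = ip (Q (e j)) (\<psi> i) - c j * ip (\<psi> i) (e j)"
      using opC psiC[OF i] eC[OF j] by (simp add: ip_diff ip_scale C_scale ip_sym[of "e j"])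
    \<comment> \<open>\<open>D\<close> is \<open>T\<close> minus \<open>Q\<close> and
      \<open>N\<close> is \<open>T\<close> minus its diagonal, so \<open>T\<close> cancels; the
      symmetry of \<open>S\<close> moves \<open>Q\<close> onto \<open>e j\<close>.\<close>
    ultimately have eq: "(s i - c j) * ip (\<psi> i) (e j) =
        ip (D (\<psi> i)) (e j) - ip (N i) (e j) + ip (Q (e j) - c j \<odot> e j) (\<psi> i)"
      by (simp add: algebra_simps)
    have "(x - y + z)\<^sup>2 \<le> 3 * x\<^sup>2 + 3 * y\<^sup>2 + 3 * z\<^sup>2" for x y z :: real
    proof -
      have "0 \<le> (x + y)\<^sup>2 + (y + z)\<^sup>2 + (x - z)\<^sup>2" by simp
      then show ?thesis by (simp add: power2_eq_square algebra_simps)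
    qed
    from this[of "ip (D (\<psi> i)) (e j)" "ip (N i) (e j)" "ip (Q (e j) - c j \<odot> e j) (\<psi> i)"]
    show ?thesis unfolding eq[symmetric] by (simp add: power_mult_distrib)
  qed
  have "(\<Sum>i<d. \<Sum>j\<in>J. (s i - c j)\<^sup>2 * (ip (\<psi> i) (e j))\<^sup>2) \<le>
    (\<Sum>i<d. \<Sum>j\<in>J. 3 * (ip (D (\<psi> i)) (e j))\<^sup>2 + 3 * (ip (N i) (e j))\<^sup>2
        + 3 * (ip (Q (e j) - c j \<odot> e j) (\<psi> i))\<^sup>2)"
    using key by (intro sum_mono) auto
  also have "\<dots> = 3 * (\<Sum>i<d. \<Sum>j\<in>J. (ip (D (\<psi> i)) (e j))\<^sup>2)
      + 3 * (\<Sum>i<d. \<Sum>j\<in>J. (ip (N i) (e j))\<^sup>2)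
      + 3 * (\<Sum>i<d. \<Sum>j\<in>J. (ip (Q (e j) - c j \<odot> e j) (\<psi> i))\<^sup>2)"
    by (simp add: sum.distrib sum_distrib_left)
  also have "(\<Sum>i<d. \<Sum>j\<in>J. (ip (Q (e j) - c j \<odot> e j) (\<psi> i))\<^sup>2) =
      (\<Sum>j\<in>J. \<Sum>i<d. (ip (Q (e j) - c j \<odot> e j) (\<psi> i))\<^sup>2)" by (rule sum.swap)
  also have "(\<Sum>i<d. \<Sum>j\<in>J. (ip (D (\<psi> i)) (e j))\<^sup>2) \<le> (\<Sum>i<d. ip (D (\<psi> i)) (D (\<psi> i)))"
    using bessel[OF e] opC by (intro sum_mono) auto
  also have "(\<Sum>i<d. ip (D (\<psi> i)) (D (\<psi> i))) \<le> H"
    unfolding D_def H_def by (rule hilbert_schmidt_bound[OF \<phi> \<psi>(1)]) simp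
  also have "(\<Sum>i<d. \<Sum>j\<in>J. (ip (N i) (e j))\<^sup>2) \<le> (\<Sum>i<d. ip (N i) (N i))"
    using bessel[OF e] NC by (intro sum_mono) auto
  also note Nbound
  also have "(\<Sum>j\<in>J. \<Sum>i<d. (ip (Q (e j) - c j \<odot> e j) (\<psi> i))\<^sup>2) \<le> (\<Sum>j\<in>J. \<delta>)"
  proof (rule sum_mono)
    fix j assume j: "j \<in> J"
    have "(\<Sum>i<d. (ip (Q (e j) - c j \<odot> e j) (\<psi> i))\<^sup>2) \<le> ip (Q (e j) - c j \<odot> e j) (Q (e j) - c j \<odot> e j)"
      using bessel[OF \<psi>(1)] opC eC[OF j] C_scale C_diff by simp
    also have "\<dots> \<le> \<delta>" using approx[OF j] by (simp add: Q_def)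
    finally show "(\<Sum>i<d. (ip (Q (e j) - c j \<odot> e j) (\<psi> i))\<^sup>2) \<le> \<delta>" .
  qed
  \<comment> \<open>15 = 3 * (1 + 4): the factor 3 comes from the square of three terms,
    \<open>D\<close> contributes H and \<open>N\<close> contributes 4 H.\<close>
  finally show ?thesis by (simp add: H_def mult_ac)
qed

lemma trace_comparison:
  fixes G :: "real \<Rightarrow> real"
  assumes \<psi>: "ons {..<d} \<psi>" and e: "ons J e" "finite J" "e ` J \<subseteq> span (\<psi> ` {..<d})"
    and G: "\<And>i. i < d \<Longrightarrow> \<bar>G (s i)\<bar> \<le> b"
      "\<And>i j. i < d \<Longrightarrow> j \<in> J \<Longrightarrow> \<bar>G (s i) - G (c j)\<bar> \<le> \<epsilon> + L * (s i - c j)\<^sup>2"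
    and near: "(\<Sum>i<d. \<Sum>j\<in>J. (s i - c j)\<^sup>2 * (ip (\<psi> i) (e j))\<^sup>2) \<le> h"
    and "0 \<le> \<epsilon>" "0 \<le> L"
  shows "\<bar>(\<Sum>i<d. G (s i)) - (\<Sum>j\<in>J. G (c j))\<bar> \<le> b * (real d - card J) + \<epsilon> * card J + L * h"
proof -
  define w where "w i j = (ip (\<psi> i) (e j))\<^sup>2" for i j
  have eC: "e j \<in> C" if "j \<in> J" for j using ons_in_C[OF e(1) that] .
  have wj: "(\<Sum>i<d. w i j) = 1" if j: "j \<in> J" for j
  proof -
    have "(\<Sum>i<d. w i j) = (\<Sum>i<d. (ip (e j) (\<psi> i))\<^sup>2)" by (simp add: w_def ip_sym)
    also have "\<dots> = ip (e j) (e j)" using e(3) j by (intro parseval_sq[OF \<psi>] eC[OF j]) auto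
    finally show ?thesis using ons_ip[OF e(1) j j] by simp
  qed
  have wi: "(\<Sum>j\<in>J. w i j) \<le> 1" if "i < d" for i
    using bessel[OF e(1,2), of "\<psi> i"] ons_in_C[OF \<psi>, of i] ons_ip[OF \<psi>, of i i] that
    by (auto simp: w_def)
  have w0: "0 \<le> w i j" for i j by (simp add: w_def)
  have "(\<Sum>j\<in>J. G (c j)) = (\<Sum>j\<in>J. \<Sum>i<d. w i j * G (c j))"
    by (intro sum.cong refl) (simp add: wj flip: sum_distrib_right)
  then have c: "(\<Sum>j\<in>J. G (c j)) = (\<Sum>i<d. \<Sum>j\<in>J. w i j * G (c j))"
    by (simp add: sum.swap[of _ J])
  have s: "(\<Sum>i<d. G (s i)) = (\<Sum>i<d. (1 - (\<Sum>j\<in>J. w i j)) * G (s i)) + (\<Sum>i<d. \<Sum>j\<in>J. w i j * G (s i))"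
    by (simp add: left_diff_distrib sum_subtractf sum_distrib_right)
  have cJ: "(\<Sum>i<d. \<Sum>j\<in>J. w i j) = card J"
    by (subst sum.swap) (simp add: wj)
  have "\<bar>\<Sum>i<d. (1 - (\<Sum>j\<in>J. w i j)) * G (s i)\<bar> \<le> (\<Sum>i<d. (1 - (\<Sum>j\<in>J. w i j)) * b)"
    using wi G(1) by (intro order_trans[OF sum_abs] sum_mono) (auto simp: abs_mult intro!: mult_left_mono)
  also have "\<dots> = b * (real d - card J)"
    unfolding sum_distrib_right[symmetric] sum_subtractf cJ by simp
  finally have 1: "\<bar>\<Sum>i<d. (1 - (\<Sum>j\<in>J. w i j)) * G (s i)\<bar> \<le> b * (real d - card J)" .
  have "\<bar>(\<Sum>i<d. \<Sum>j\<in>J. w i j * G (s i)) - (\<Sum>i<d. \<Sum>j\<in>J. w i j * G (c j))\<bar>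
      = \<bar>\<Sum>i<d. \<Sum>j\<in>J. w i j * (G (s i) - G (c j))\<bar>"
    by (simp add: right_diff_distrib sum_subtractf)
  also have "\<dots> \<le> (\<Sum>i<d. \<Sum>j\<in>J. \<bar>w i j * (G (s i) - G (c j))\<bar>)"
    by (intro order_trans[OF sum_abs] sum_mono sum_abs)
  also have "\<dots> \<le> (\<Sum>i<d. \<Sum>j\<in>J. w i j * (\<epsilon> + L * (s i - c j)\<^sup>2))"
    using w0 G(2) by (intro sum_mono) (auto simp: abs_mult intro!: mult_left_mono)
  also have "\<dots> = \<epsilon> * (\<Sum>i<d. \<Sum>j\<in>J. w i j) + L * (\<Sum>i<d. \<Sum>j\<in>J. (s i - c j)\<^sup>2 * w i j)"
    by (simp add: distrib_left sum.distrib sum_distrib_left mult.left_commute mult.commute[of _ "w _ _"])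
  also have "\<dots> \<le> \<epsilon> * card J + L * h"
    unfolding cJ using mult_left_mono[OF near assms(9)] by (simp add: w_def)
  finally have 2: "\<bar>(\<Sum>i<d. \<Sum>j\<in>J. w i j * G (s i)) - (\<Sum>i<d. \<Sum>j\<in>J. w i j * G (c j))\<bar> \<le> \<epsilon> * card J + L * h" .
  show ?thesis unfolding c s using 1 2 by linarith
qed

end

section \<open>Schur bases and the characteristic polynomial\<close>

context ip_space
begin

lemma mat_op_add: "ons {..<d} \<phi> \<Longrightarrow> x \<in> C \<Longrightarrow> y \<in> C \<Longrightarrow> mat_op d \<phi> M (x + y) = mat_op d \<phi> M x + mat_op d \<phi> M y"
  by (simp add: mat_op_def ip_add ons_in_C distrib_left sum.distrib scale_left_distrib)

lemma mat_op_scale: "ons {..<d} \<phi> \<Longrightarrow> x \<in> C \<Longrightarrow> mat_op d \<phi> M (c \<odot> x) = c \<odot> mat_op d \<phi> M x"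
  by (simp add: mat_op_def ip_scale ons_in_C scale_sum_right sum_distrib_left mult.left_commute)

lemma mat_op_0: "ons {..<d} \<phi> \<Longrightarrow> mat_op d \<phi> M 0 = 0"
  by (simp add: mat_op_def ons_in_C)

lemma mat_op_lincomb:
  assumes "ons {..<d} \<phi>" "\<And>i. i \<in> I \<Longrightarrow> f i \<in> C"
  shows "mat_op d \<phi> M (\<Sum>i\<in>I. c i \<odot> f i) = (\<Sum>i\<in>I. c i \<odot> mat_op d \<phi> M (f i))"
  using assms(2)
  by (induction I rule: infinite_finite_induct)
     (auto simp: mat_op_0[OF assms(1)] mat_op_add[OF assms(1)] mat_op_scale[OF assms(1)] C_sum C_scale)

lemma mat_op_basis:
  assumes "ons {..<d} \<phi>" "n < d"
  shows "mat_op d \<phi> M (\<phi> n) = (\<Sum>m<d. M m n \<odot> \<phi> m)"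
  unfolding mat_op_def
proof (rule sum.cong[OF refl])
  fix m
  have "(\<Sum>k<d. M m k * ip (\<phi> n) (\<phi> k)) = (\<Sum>k<d. if k = n then M m n else 0)"
    using assms by (intro sum.cong) (auto simp: ons_ip)
  then show "(\<Sum>k<d. M m k * ip (\<phi> n) (\<phi> k)) \<odot> \<phi> m = M m n \<odot> \<phi> m" using assms(2) by simp
qed

text \<open>A similarity to an upper triangular matrix yields a flag of invariant subspaces
  \<open>U i\<close>. Gram-Schmidt along the flag keeps the flag and makes the basis orthonormal.
  All data stay real because the characteristic polynomial splits over the reals.\<close>

lemma schur_basis:
  fixes M :: "nat \<Rightarrow> nat \<Rightarrow> real"
  assumes \<phi>: "ons {..<d} \<phi>"
    and cp: "char_poly (mat d d (\<lambda>(i, j). M i j)) = (\<Prod>x\<leftarrow>es. [:- x, 1:])" and len: "length es = d"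
  obtains \<psi> where "ons {..<d} \<psi>" "\<psi> ` {..<d} \<subseteq> span (\<phi> ` {..<d})"
    "\<And>i k. i \<le> k \<Longrightarrow> k < d \<Longrightarrow> ip (mat_op d \<phi> M (\<psi> i)) (\<psi> k) = (if i = k then es ! i else 0)"
proof -
  define A where "A = mat d d (\<lambda>(i, j). M i j)"
  have A: "A \<in> carrier_mat d d" by (simp add: A_def)
  obtain B P Q where sd: "schur_decomposition A es = (B, P, Q)" by (metis surj_pair)
  have "similar_mat_wit A B P Q" "upper_triangular B" "diag_mat B = es"
    using schur_decomposition[OF A _ sd] cp by (auto simp: A_def)
  note sw = similar_mat_witD2[OF A this(1)] and ut = this(2) and dg = this(3)
  have B: "B \<in> carrier_mat d d" and P: "P \<in> carrier_mat d d" and Q: "Q \<in> carrier_mat d d"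
    using sw by auto
  have "A * P = P * B * (Q * P)" unfolding sw(3) using B P Q by (simp add: assoc_mult_mat[of _ d d _ d _ d])
  then have AP: "A * P = P * B" using sw(2) B P by simp
  have APe: "(\<Sum>n<d. M m n * P $$ (n, i)) = (\<Sum>k<d. P $$ (m, k) * B $$ (k, i))" if "m < d" "i < d" for m i
  proof -
    have "(A * P) $$ (m, i) = (\<Sum>n<d. M m n * P $$ (n, i))"
      using that P by (simp add: A_def scalar_prod_def lessThan_atLeast0)
    moreover have "(P * B) $$ (m, i) = (\<Sum>k<d. P $$ (m, k) * B $$ (k, i))"
      using that P B by (simp add: scalar_prod_def lessThan_atLeast0)
    ultimately show ?thesis using AP by simp
  qed
  have PQe: "(\<Sum>i<d. P $$ (m, i) * Q $$ (i, n)) = (if m = n then 1 else 0)" if "m < d" "n < d" for m n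
  proof -
    have "(P * Q) $$ (m, n) = (\<Sum>i<d. P $$ (m, i) * Q $$ (i, n))"
      using that P Q by (simp add: scalar_prod_def lessThan_atLeast0)
    then show ?thesis using sw(1) that by simp
  qed
  have Bdiag: "B $$ (i, i) = es ! i" if "i < d" for i
    using dg that B by (auto simp: diag_mat_def)
  have Btri: "B $$ (k, i) = 0" if "i < k" "k < d" for i k
    using ut that B by auto
  define f where "f i = (\<Sum>n<d. P $$ (n, i) \<odot> \<phi> n)" for i
  have phiC: "\<phi> n \<in> C" if "n < d" for n using ons_in_C[OF \<phi>] that by auto
  have fE: "f i \<in> span (\<phi> ` {..<d})" for i
    unfolding f_def by (intro span_sum span_scale span_base) auto
  have EC: "span (\<phi> ` {..<d}) \<subseteq> C" using phiC by (intro span_in_C) auto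
  have fC: "f i \<in> C" for i using fE EC by auto
  define T where "T = mat_op d \<phi> M"
  have Tf: "T (f i) = (\<Sum>k<d. B $$ (k, i) \<odot> f k)" if i: "i < d" for i
  proof -
    have "T (f i) = (\<Sum>n<d. P $$ (n, i) \<odot> (\<Sum>m<d. M m n \<odot> \<phi> m))"
      unfolding T_def f_def using phiC by (subst mat_op_lincomb[OF \<phi>]) (auto simp: mat_op_basis[OF \<phi>])
    also have "\<dots> = (\<Sum>m<d. (\<Sum>n<d. M m n * P $$ (n, i)) \<odot> \<phi> m)"
      by (simp add: scale_sum_right scale_sum_left mult.commute, rule sum.swap)
    also have "\<dots> = (\<Sum>m<d. (\<Sum>k<d. P $$ (m, k) * B $$ (k, i)) \<odot> \<phi> m)"
      using APe[OF _ i] by simp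
    also have "\<dots> = (\<Sum>k<d. B $$ (k, i) \<odot> f k)"
      unfolding f_def
      by (simp add: scale_sum_right scale_sum_left mult.commute, rule sum.swap)
    finally show ?thesis .
  qed
  have phif: "\<phi> n = (\<Sum>i<d. Q $$ (i, n) \<odot> f i)" if n: "n < d" for n
  proof -
    have "(\<Sum>i<d. Q $$ (i, n) \<odot> f i) = (\<Sum>m<d. (\<Sum>i<d. P $$ (m, i) * Q $$ (i, n)) \<odot> \<phi> m)"
      unfolding f_def
      by (simp add: scale_sum_right scale_sum_left mult.commute, rule sum.swap)
    also have "\<dots> = (\<Sum>m<d. if m = n then \<phi> n else 0)"
      using PQe[OF _ n] by (intro sum.cong) auto
    finally show ?thesis using n by simp
  qed
  define U where "U i = span (f ` {..<i})" for i
  have Usub: "subspace (U i)" and Ufd: "fin_dim (U i)" and UC: "U i \<subseteq> C" for i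
    unfolding U_def using fC by (auto intro!: fin_dim_span span_in_C)
  have Umono: "U i \<subseteq> U k" if "i \<le> k" for i k
    unfolding U_def using that by (intro span_mono) auto
  have fU: "f k \<in> U i" if "k < i" for i k unfolding U_def using that by (intro span_base) auto
  \<comment> \<open>A dependence among the \<open>f i\<close> would let fewer than \<open>d\<close>
    vectors generate the span of the orthonormal \<open>\<phi>\<close>.\<close>
  have fnot: "f i \<notin> U i" if i: "i < d" for i
  proof
    assume "f i \<in> U i"
    moreover have "f ` {..<i} \<subseteq> f ` ({..<d} - {i})" using i by (intro image_mono) auto
    then have "U i \<subseteq> span (f ` ({..<d} - {i}))" unfolding U_def by (rule span_mono)
    ultimately have fi: "f i \<in> span (f ` ({..<d} - {i}))" by blast
    have "span (\<phi> ` {..<d}) \<subseteq> span (f ` ({..<d} - {i}))"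
    proof (rule span_minimal)
      have "f j \<in> span (f ` ({..<d} - {i}))" if "j < d" for j
        using fi that span_base[of "f j" "f ` ({..<d} - {i})"] by (cases "j = i") auto
      then show "\<phi> ` {..<d} \<subseteq> span (f ` ({..<d} - {i}))"
        using phif by (auto intro!: span_sum span_scale)
    qed auto
    then have "dim (span (\<phi> ` {..<d})) \<le> card (f ` ({..<d} - {i}))" by (intro dim_le_card) auto
    also have "\<dots> \<le> card ({..<d} - {i})" by (intro card_image_le) auto
    also have "\<dots> < d" using i by simp
    finally show False using dim_span_ons[OF \<phi>] by simp
  qed
  have "\<exists>g c. g - c \<odot> f i \<in> U i \<and> c \<noteq> 0 \<and> ip g g = 1 \<and> (\<forall>u\<in>U i. ip g u = 0) \<and> g \<in> C" if "i < d" for i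
    using gram_schmidt_step[OF Usub Ufd UC fC fnot[OF that]] by metis
  then obtain \<psi> c where psi: "\<And>i. i < d \<Longrightarrow> \<psi> i - c i \<odot> f i \<in> U i" "\<And>i. i < d \<Longrightarrow> ip (\<psi> i) (\<psi> i) = 1"
      "\<And>i u. i < d \<Longrightarrow> u \<in> U i \<Longrightarrow> ip (\<psi> i) u = 0" "\<And>i. i < d \<Longrightarrow> \<psi> i \<in> C"
    by metis
  have psiU: "\<psi> i \<in> U k" if "i < k" "i < d" for i k
  proof -
    have "\<psi> i - c i \<odot> f i \<in> U k" using psi(1)[OF that(2)] Umono[of i k] that(1) by auto
    moreover have "c i \<odot> f i \<in> U k" using fU[OF that(1)] Usub by (intro subspace_scale)
    ultimately have "(\<psi> i - c i \<odot> f i) + c i \<odot> f i \<in> U k" using Usub subspace_add by blast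
    then show ?thesis by simp
  qed
  have ons: "ons {..<d} \<psi>"
    unfolding ons_def
  proof (intro conjI ballI)
    fix i j assume ij: "i \<in> {..<d}" "j \<in> {..<d}"
    show "\<psi> i \<in> C" using psi(4) ij by auto
    show "ip (\<psi> i) (\<psi> j) = (if i = j then 1 else 0)"
      using psi(2)[of i] psi(3)[of i "\<psi> j"] psi(3)[of j "\<psi> i"] psiU[of i j] psiU[of j i] ij
      by (cases i j rule: linorder_cases) (auto simp: ip_sym[of "\<psi> i" "\<psi> j"])
  qed
  have TU: "T u \<in> U i" if u: "u \<in> U i" and i: "i \<le> d" for u i
  proof -
    have Tfk: "T (f k) \<in> U i" if k: "k < i" for k
    proof -
      have "B $$ (j, k) \<odot> f j \<in> U i" if "j < d" for j
      proof (cases "j \<le> k")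
        case True then show ?thesis using fU[of j i] k Usub by (intro subspace_scale) auto
      next
        case False then show ?thesis using Btri[of k j] that Usub subspace_0 by auto
      qed
      then show ?thesis using Tf[of k] k i Usub by (auto intro!: subspace_sum)
    qed
    have sub: "subspace {x\<in>C. T x \<in> U i}"
      using Usub subspace_0[OF Usub] unfolding T_def
      by (intro subspaceI)
         (auto simp: C_0 C_add C_scale mat_op_0[OF \<phi>] mat_op_add[OF \<phi>] mat_op_scale[OF \<phi>] subspace_add subspace_scale)
    have "span (f ` {..<i}) \<subseteq> {x\<in>C. T x \<in> U i}"
      by (rule span_minimal[OF _ sub]) (use fC Tfk in auto)
    then show ?thesis using u by (auto simp: U_def)
  qed
  have Tpsi: "T (\<psi> i) - es ! i \<odot> \<psi> i \<in> U i" if i: "i < d" for i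
  proof -
    define v where "v = \<psi> i - c i \<odot> f i"
    have v: "v \<in> U i" "v \<in> C" using psi(1)[OF i] UC by (auto simp: v_def)
    have "T (f i) = (\<Sum>k<d. if k < i then B $$ (k, i) \<odot> f k else 0) + es ! i \<odot> f i"
    proof -
      have "T (f i) = (\<Sum>k<d. (if k < i then B $$ (k, i) \<odot> f k else 0) + (if k = i then es ! i \<odot> f i else 0))"
        unfolding Tf[OF i] using Btri[of i] Bdiag[OF i] by (intro sum.cong) (auto simp: not_less_iff_gr_or_eq)
      then show ?thesis using i by (simp add: sum.distrib)
    qed
    then have r: "T (f i) - es ! i \<odot> f i \<in> U i"
      using fU Usub subspace_0[OF Usub] by (auto intro!: subspace_sum subspace_scale)
    have psi_eq: "\<psi> i = c i \<odot> f i + v" by (simp add: v_def)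
    have "T (\<psi> i) = c i \<odot> T (f i) + T v"
      unfolding psi_eq T_def using fC v by (simp add: mat_op_add[OF \<phi>] mat_op_scale[OF \<phi>] C_scale)
    then have "T (\<psi> i) - es ! i \<odot> \<psi> i = c i \<odot> (T (f i) - es ! i \<odot> f i) + (T v - es ! i \<odot> v)"
      unfolding psi_eq by (simp add: scale_right_distrib scale_right_diff_distrib mult.commute)
    moreover have "c i \<odot> (T (f i) - es ! i \<odot> f i) \<in> U i" using r Usub subspace_scale by blast
    moreover have "T v - es ! i \<odot> v \<in> U i" using TU[OF v(1)] i v(1) Usub[of i] by (simp add: subspace_diff subspace_scale)
    ultimately show ?thesis using Usub subspace_add by metis
  qed
  have tri: "ip (T (\<psi> i)) (\<psi> k) = (if i = k then es ! i else 0)" if "i \<le> k" "k < d" for i k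
  proof -
    let ?n = "T (\<psi> i) - es ! i \<odot> \<psi> i"
    have n: "?n \<in> U k" "?n \<in> C" using Tpsi[of i] Umono[of i k] UC that by auto
    have "ip (T (\<psi> i)) (\<psi> k) = ip (?n + es ! i \<odot> \<psi> i) (\<psi> k)" by simp
    also have "\<dots> = ip ?n (\<psi> k) + es ! i * ip (\<psi> i) (\<psi> k)"
      using n psi(4) that by (subst ip_add) (auto simp: ip_scale C_scale)
    also have "\<dots> = (if i = k then es ! i else 0)"
      using psi(3)[OF that(2) n(1)] ons_ip[OF ons, of i k] that by (auto simp: ip_sym)
    finally show ?thesis .
  qed
  have "\<psi> i \<in> span (\<phi> ` {..<d})" if "i < d" for i
    using psiU[OF that that] fE span_minimal[of "f ` {..<d}" "span (\<phi> ` {..<d})"] by (auto simp: U_def)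
  then have "\<psi> ` {..<d} \<subseteq> span (\<phi> ` {..<d})" by auto
  then show ?thesis using that[OF ons] tri by (simp add: T_def)
qed

end


section \<open>Characteristic polynomials with real roots\<close>

lemma order_prod_list_linear:
  "Polynomial.order x (\<Prod>a\<leftarrow>as. [:- a, 1:]) = count_list as (x::complex)"
proof (induction as)
  case (Cons a as)
  have nz: "(\<Prod>a\<leftarrow>as. [:- a, 1:]) \<noteq> (0 :: complex poly)" for as
    by (induction as) (auto simp del: mult_pCons_left)
  have "Polynomial.order x [:- a, 1:] = (if a = x then 1 else 0)"
    using order_power_n_n[of a 1] by (auto simp: order_0I)
  then show ?case using Cons nz[of "a # as"] by (simp add: order_mult del: mult_pCons_left)
qed (simp add: order_0I)

lemma map_poly_of_real_linear_factors:
  "map_poly complex_of_real (\<Prod>x\<leftarrow>es. [:- x, 1:]) = (\<Prod>x\<leftarrow>es. [:- complex_of_real x, 1:])"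
proof -
  interpret h: map_poly_inj_idom_hom complex_of_real ..
  show ?thesis by (induction es) (auto simp: h.hom_mult simp del: mult_pCons_left)
qed

lemma sum_list_conv_sum_count:
  fixes f :: "'a \<Rightarrow> real"
  assumes "finite A" "set xs \<subseteq> A"
  shows "(\<Sum>x\<leftarrow>xs. f x) = (\<Sum>x\<in>A. real (count_list xs x) * f x)"
  using assms(2)
proof (induction xs)
  case (Cons a xs)
  have "(\<Sum>x\<in>A. real (count_list (a # xs) x) * f x)
      = (\<Sum>x\<in>A. real (count_list xs x) * f x + (if x = a then f a else 0))"
    by (intro sum.cong) (auto simp: algebra_simps)
  then show ?case using Cons assms(1) by (simp add: sum.distrib)
qed simp

text \<open>Over the complex numbers the polynomial splits in any case. Its roots are real by
  assumption, and the embedding of real into complex polynomials is injective, so the factorisation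
  descends.\<close>

lemma real_char_poly_split:
  fixes M :: "real mat"
  assumes M: "M \<in> carrier_mat d d"
    and sp: "spectrum (map_mat complex_of_real M) \<subseteq> complex_of_real ` S"
  obtains es where "length es = d" "set es \<subseteq> S" "char_poly M = (\<Prod>x\<leftarrow>es. [:- x, 1:])"
proof -
  have MC: "map_mat complex_of_real M \<in> carrier_mat d d" using M by simp
  obtain as where as: "char_poly (map_mat complex_of_real M) = (\<Prod>a\<leftarrow>as. [:- a, 1:])" "length as = d"
    using char_poly_factorized[OF MC] by blast
  have "set as \<subseteq> complex_of_real ` S"
  proof
    fix z assume "z \<in> set as"
    then have "poly (\<Prod>a\<leftarrow>as. [:- a, 1:]) z = 0" by (auto simp: poly_prod_list prod_list_zero_iff)
    then show "z \<in> complex_of_real ` S"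
      using sp spectrum_root_char_poly[OF MC] as(1) by auto
  qed
  define es where "es = map Re as"
  have es: "map complex_of_real es = as" "set es \<subseteq> S"
    using \<open>set as \<subseteq> _\<close> by (auto simp: es_def intro!: map_idI)
  interpret h: map_poly_inj_idom_hom complex_of_real ..
  have "map_poly complex_of_real (\<Prod>x\<leftarrow>es. [:- x, 1:]) = (\<Prod>x\<leftarrow>es. [:- complex_of_real x, 1:])"
    by (rule map_poly_of_real_linear_factors)
  also have "\<dots> = (\<Prod>a\<leftarrow>as. [:- a, 1:])" by (simp add: o_def flip: es(1))
  also have "\<dots> = map_poly complex_of_real (char_poly M)"
    unfolding as(1)[symmetric] by (rule of_real_hom.char_poly_hom[OF M])
  finally have "char_poly M = (\<Prod>x\<leftarrow>es. [:- x, 1:])" using h.injectivity by metis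
  moreover have "length es = d" using as(2) by (simp add: es_def)
  ultimately show ?thesis using that es(2) by blast
qed

text \<open>Trades distinct eigenvalues weighted by multiplicity for a list with repetitions, which
  can be indexed like a Schur basis.\<close>

lemma sum_order_eq_sum_list:
  assumes A: "A \<in> carrier_mat d d" and cp: "char_poly A = (\<Prod>x\<leftarrow>es. [:- complex_of_real x, 1:])"
  shows "(\<Sum>z\<in>spectrum A. real (Polynomial.order z (char_poly A)) * F (Re z)) = (\<Sum>x\<leftarrow>es. F x)"
proof -
  let ?as = "map complex_of_real es"
  have cp': "char_poly A = (\<Prod>a\<leftarrow>?as. [:- a, 1:])" using cp by (simp add: o_def)
  have "spectrum A = set ?as"
    unfolding spectrum_root_char_poly[OF A] cp' by (auto simp: poly_prod_list prod_list_zero_iff)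
  then have "(\<Sum>z\<in>spectrum A. real (Polynomial.order z (char_poly A)) * F (Re z))
      = (\<Sum>z\<in>set ?as. real (count_list ?as z) * F (Re z))"
    unfolding cp' order_prod_list_linear by simp
  also have "\<dots> = (\<Sum>z\<leftarrow>?as. F (Re z))" by (rule sum_list_conv_sum_count[symmetric]) auto
  also have "\<dots> = (\<Sum>x\<leftarrow>es. F x)" by (simp add: o_def)
  finally show ?thesis .
qed

locale function_ip_space = ip_space "\<lambda>(c::real) (f :: plane \<Rightarrow> real) x. c * f x" C ip for C ip
begin

text \<open>\<open>endo_matrix\<close> refers to a basis picked by choice, so similarity to
  \<open>M\<close> is the most that can be expected; \<open>P\<close> and \<open>Q\<close> are the
  changes of basis between it and \<open>\<phi>\<close>.\<close>

lemma endo_matrix_similar: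
  fixes M :: "nat \<Rightarrow> nat \<Rightarrow> real"
  assumes \<phi>: "ons {..<d} \<phi>"
    and T: "\<And>u. u \<in> rfun.span (\<phi> ` {..<d}) \<Longrightarrow> T u = mat_op d \<phi> M u"
  obtains A where "A \<in> carrier_mat d d"
    "endo_matrix (rfun.span (\<phi> ` {..<d})) T = map_mat complex_of_real A"
    "similar_mat A (mat d d (\<lambda>(i, j). M i j))"
proof -
  define W where "W = rfun.span (\<phi> ` {..<d})"
  have phiC: "\<phi> n \<in> C" if "n < d" for n using ons_in_C[OF \<phi>] that by auto
  have WC: "W \<subseteq> C" unfolding W_def using phiC by (intro span_in_C) auto
  have "\<exists>bs. ordered_basis bs W"
  proof
    show "ordered_basis (map \<phi> [0..<d]) W"
      using ons_inj[OF \<phi>] ons_independent[OF \<phi>]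
      by (simp add: ordered_basis_def distinct_map W_def lessThan_atLeast0)
  qed
  define bs where "bs = (SOME bs. ordered_basis bs W)"
  have bs: "ordered_basis bs W" unfolding bs_def using \<open>\<exists>bs. _\<close> by (rule someI_ex)
  then have dist: "distinct bs" and ind: "rfun.independent (set bs)" and spn: "rfun.span (set bs) = W"
    by (auto simp: ordered_basis_def)
  have len: "length bs = d"
  proof -
    have "length bs = rfun.dim (set bs)" using dist ind by (simp add: rfun.dim_eq_card_independent distinct_card)
    also have "\<dots> = rfun.dim W" using rfun.dim_span[of "set bs"] spn by simp
    also have "\<dots> = d" unfolding W_def using dim_span_ons[OF \<phi>] by simp
    finally show ?thesis .
  qed
  define r where "r x i = rfun.representation (set bs) x (bs ! i)" for x i
  have bW: "bs ! j \<in> W" if "j < d" for j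
    using that len spn rfun.span_base[of "bs ! j" "set bs"] by auto
  have phiW: "\<phi> n \<in> W" if "n < d" for n
    unfolding W_def using that by (intro rfun.span_base) auto
  have r_lincomb: "r (\<Sum>k\<in>K. (\<lambda>x. c k * g k x)) i = (\<Sum>k\<in>K. c k * r (g k) i)"
    if "\<And>k. k \<in> K \<Longrightarrow> g k \<in> W" "finite K" for K :: "nat set" and c g i
    using that(2,1)
  proof (induction K rule: finite_induct)
    case empty
    show ?case unfolding r_def sum.empty rfun.representation_zero by simp
  next
    case (insert k K)
    have m: "g k \<in> rfun.span (set bs)" "(\<lambda>x. c k * g k x) \<in> rfun.span (set bs)"
        "(\<Sum>k\<in>K. (\<lambda>x. c k * g k x)) \<in> rfun.span (set bs)"
      using insert.prems spn by (auto intro!: rfun.span_sum rfun.span_scale)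
    have "r (\<Sum>k\<in>insert k K. (\<lambda>x. c k * g k x)) i = r ((\<lambda>x. c k * g k x) + (\<Sum>k\<in>K. (\<lambda>x. c k * g k x))) i"
      using insert.hyps by simp
    also have "\<dots> = c k * r (g k) i + r (\<Sum>k\<in>K. (\<lambda>x. c k * g k x)) i"
      unfolding r_def rfun.representation_add[OF ind m(3,2)] rfun.representation_scale[OF ind m(1)] by simp
    finally have "r (\<Sum>k\<in>insert k K. (\<lambda>x. c k * g k x)) i = c k * r (g k) i + r (\<Sum>k\<in>K. (\<lambda>x. c k * g k x)) i" .
    moreover have "r (\<Sum>k\<in>K. (\<lambda>x. c k * g k x)) i = (\<Sum>k\<in>K. c k * r (g k) i)"
      by (rule insert.IH) (use insert.prems in auto)
    ultimately show ?case unfolding sum.insert[OF insert.hyps, of "\<lambda>k. c k * r (g k) i"] by simp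
  qed
  define A where "A = mat d d (\<lambda>(i, j). r (T (bs ! j)) i)"
  define P where "P = mat d d (\<lambda>(n, i). ip (bs ! i) (\<phi> n))"
  define Q where "Q = mat d d (\<lambda>(i, n). r (\<phi> n) i)"
  define MM where "MM = mat d d (\<lambda>(i, j). M i j)"
  have carr: "A \<in> carrier_mat d d" "P \<in> carrier_mat d d" "Q \<in> carrier_mat d d" "MM \<in> carrier_mat d d"
    by (auto simp: A_def P_def Q_def MM_def)
  have phi_expand: "\<phi> n = (\<Sum>i<d. (\<lambda>x. r (\<phi> n) i * (bs ! i) x))" if n: "n < d" for n
  proof -
    have "(\<Sum>b\<in>set bs. (\<lambda>x. rfun.representation (set bs) (\<phi> n) b * b x)) = \<phi> n"
      using rfun.sum_representation_eq[OF ind, of "\<phi> n" "set bs"] phiW[OF n] spn by simp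
    moreover have "(\<Sum>b\<in>set bs. (\<lambda>x. rfun.representation (set bs) (\<phi> n) b * b x))
        = (\<Sum>i<d. (\<lambda>x. r (\<phi> n) i * (bs ! i) x))"
      unfolding r_def using dist len
      by (simp add: sum_list_distinct_conv_sum_set[symmetric] sum_list_sum_nth lessThan_atLeast0)
    ultimately show ?thesis by simp
  qed
  have "P * Q = 1\<^sub>m d"
  proof (rule eq_matI)
    fix m n assume "m < dim_row (1\<^sub>m d)" "n < dim_col (1\<^sub>m d)"
    then have mn: "m < d" "n < d" by auto
    have "(P * Q) $$ (m, n) = (\<Sum>i<d. r (\<phi> n) i * ip (bs ! i) (\<phi> m))"
      using mn by (simp add: P_def Q_def scalar_prod_def lessThan_atLeast0 mult.commute)
    also have "\<dots> = ip (\<Sum>i<d. (\<lambda>x. r (\<phi> n) i * (bs ! i) x)) (\<phi> m)"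
      using bW WC phiC[OF mn(1)] by (intro ip_lincomb[symmetric]) auto
    also have "\<dots> = ip (\<phi> n) (\<phi> m)" using phi_expand[OF mn(2)] by simp
    finally show "(P * Q) $$ (m, n) = 1\<^sub>m d $$ (m, n)" using mn by (simp add: ons_ip[OF \<phi>])
  qed (use carr in auto)
  note PQ = this mat_mult_left_right_inverse[OF carr(2,3) this]
  have "A = Q * MM * P"
  proof (rule eq_matI)
    fix i j assume "i < dim_row (Q * MM * P)" "j < dim_col (Q * MM * P)"
    then have ij: "i < d" "j < d" using carr by auto
    have "A $$ (i, j) = r (T (bs ! j)) i" using ij by (simp add: A_def)
    also have "T (bs ! j) = (\<Sum>m<d. (\<lambda>x. (\<Sum>n<d. M m n * ip (bs ! j) (\<phi> n)) * \<phi> m x))"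
      using T bW[OF ij(2)] by (simp add: W_def mat_op_def)
    also have "r \<dots> i = (\<Sum>m<d. (\<Sum>n<d. M m n * ip (bs ! j) (\<phi> n)) * r (\<phi> m) i)"
      using phiW by (intro r_lincomb) auto
    also have "\<dots> = (\<Sum>m<d. \<Sum>n<d. r (\<phi> m) i * M m n * ip (bs ! j) (\<phi> n))"
      by (simp add: sum_distrib_right sum_distrib_left mult_ac)
    also have "\<dots> = (\<Sum>n<d. (\<Sum>m<d. r (\<phi> m) i * M m n) * ip (bs ! j) (\<phi> n))"
      by (subst sum.swap) (simp add: sum_distrib_right)
    also have "\<dots> = (Q * MM * P) $$ (i, j)"
      using ij by (simp add: Q_def MM_def P_def scalar_prod_def lessThan_atLeast0)
    finally show "A $$ (i, j) = (Q * MM * P) $$ (i, j)" .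
  qed (use carr in auto)
  then have "similar_mat_wit A MM Q P"
    using carr PQ by (intro similar_mat_witI[of _ _ d]) auto
  then have "similar_mat A MM" by (auto simp: similar_mat_def)
  moreover have "endo_matrix W T = map_mat complex_of_real A"
    unfolding endo_matrix_def Let_def bs_def[symmetric] A_def r_def len by auto
  ultimately show ?thesis using that carr by (simp add: W_def MM_def)
qed

text \<open>The same numbers \<open>s i\<close> form the diagonal of the triangular matrix and the
  spectrum counted by \<open>trace_fun\<close>. This links the defined trace to
  \<open>schur_overlap_bound\<close>.\<close>

lemma trace_fun_via_schur:
  fixes M :: "nat \<Rightarrow> nat \<Rightarrow> real"
  assumes \<phi>: "ons {..<d} \<phi>"
    and T: "\<And>u. u \<in> rfun.span (\<phi> ` {..<d}) \<Longrightarrow> T u = mat_op d \<phi> M u"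
    and real: "endo_eigenvalues (rfun.span (\<phi> ` {..<d})) T \<subseteq> complex_of_real ` S"
  obtains \<psi> s where "ons {..<d} \<psi>" "\<psi> ` {..<d} \<subseteq> rfun.span (\<phi> ` {..<d})"
    "\<And>i k. i \<le> k \<Longrightarrow> k < d \<Longrightarrow> ip (mat_op d \<phi> M (\<psi> i)) (\<psi> k) = (if i = k then s i else 0)"
    "\<And>i. i < d \<Longrightarrow> s i \<in> S"
    "\<And>F. trace_fun F (rfun.span (\<phi> ` {..<d})) T = (\<Sum>i<d. F (s i))"
proof -
  obtain A where A: "A \<in> carrier_mat d d"
    "endo_matrix (rfun.span (\<phi> ` {..<d})) T = map_mat complex_of_real A"
    "similar_mat A (mat d d (\<lambda>(i, j). M i j))"
    using endo_matrix_similar[where T = T, OF \<phi> T] by blast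
  obtain es where es: "length es = d" "set es \<subseteq> S" "char_poly A = (\<Prod>x\<leftarrow>es. [:- x, 1:])"
    using real_char_poly_split[OF A(1), of S] real unfolding endo_eigenvalues_def A(2) by blast
  have cpM: "char_poly (mat d d (\<lambda>(i, j). M i j)) = (\<Prod>x\<leftarrow>es. [:- x, 1:])"
    using char_poly_similar[OF A(3)] es(3) by simp
  obtain \<psi> where psi: "ons {..<d} \<psi>" "\<psi> ` {..<d} \<subseteq> rfun.span (\<phi> ` {..<d})"
    "\<And>i k. i \<le> k \<Longrightarrow> k < d \<Longrightarrow> ip (mat_op d \<phi> M (\<psi> i)) (\<psi> k) = (if i = k then es ! i else 0)"
    using schur_basis[OF \<phi> cpM es(1)] by blast
  have "char_poly (map_mat complex_of_real A) = map_poly complex_of_real (\<Prod>x\<leftarrow>es. [:- x, 1:])"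
    unfolding es(3)[symmetric] by (rule of_real_hom.char_poly_hom[OF A(1)])
  also have "\<dots> = (\<Prod>x\<leftarrow>es. [:- complex_of_real x, 1:])"
    by (rule map_poly_of_real_linear_factors)
  finally have cp: "char_poly (map_mat complex_of_real A) = (\<Prod>x\<leftarrow>es. [:- complex_of_real x, 1:])" .
  have AC: "map_mat complex_of_real A \<in> carrier_mat d d" using A by simp
  have "trace_fun F (rfun.span (\<phi> ` {..<d})) T = (\<Sum>i<d. F (es ! i))" for F
    unfolding trace_fun_def endo_eigenvalues_def A(2) sum_order_eq_sum_list[OF AC cp]
    by (simp add: sum_list_sum_nth es(1) lessThan_atLeast0)
  then show ?thesis using that[of \<psi> "\<lambda>i. es ! i"] psi es by (auto simp: subset_iff)
qed

end

section \<open>Geometry of the gasket\<close>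

lemma sum_bij_3: "bij (s :: 3 \<Rightarrow> 3) \<Longrightarrow> (\<Sum>j\<in>UNIV. f (s j)) = (\<Sum>j\<in>UNIV. f j)"
  by (rule sum.reindex_bij_betw)

section \<open>Words, cell maps and barycentric coordinates\<close>

definition words :: "nat \<Rightarrow> 3 list set" where
  "words n = {w. length w = n}"

lemma words_0 [simp]: "words 0 = {[]}"
  by (auto simp: words_def)

lemma finite_words [simp]: "finite (words n)"
  using finite_lists_length_eq[of "UNIV :: 3 set" n] by (simp add: words_def)

lemma card_words: "card (words n) = 3 ^ n"
  using card_lists_length_eq[of "UNIV :: 3 set" n] by (simp add: words_def)

lemma sum_words_Suc: "(\<Sum>w\<in>words (Suc n). f w) = (\<Sum>j\<in>UNIV. \<Sum>w\<in>words n. f (j # w))"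
proof -
  have "(\<Sum>j\<in>UNIV. \<Sum>w\<in>words n. f (j # w)) = (\<Sum>(j, w)\<in>UNIV \<times> words n. f (j # w))"
    by (simp add: sum.cartesian_product)
  also have "\<dots> = (\<Sum>w\<in>words (Suc n). f w)"
    by (rule sum.reindex_bij_witness[of _ "\<lambda>w. (hd w, tl w)" "\<lambda>(j, w). j # w"])
       (auto simp: words_def length_Suc_conv)
  finally show ?thesis by simp
qed

lemma word_map_Nil [simp]: "word_map a [] = id"
  by (simp add: word_map_def)

lemma word_map_Cons [simp]: "word_map a (j # w) x = gasket_map a j (word_map a w x)"
  by (simp add: word_map_def)

lemma gasket_map_inverse: "2 *\<^sub>R gasket_map a j x - a j = x"
  by (simp add: gasket_map_def algebra_simps flip: scaleR_2)

lemma gasket_map_inj: "gasket_map a j x = gasket_map a j y \<longleftrightarrow> x = y"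
  by (metis gasket_map_inverse)

lemma gasket_map_vertex: "gasket_map a j (a j) = a j"
  by (simp add: gasket_map_def)

lemma gasket_map_swap: "gasket_map a j (a i) = gasket_map a i (a j)"
  by (simp add: gasket_map_def algebra_simps flip: scaleR_2)

lemma dist_gasket_map: "dist (gasket_map a j x) (gasket_map a j y) = dist x y / 2"
  by (simp add: gasket_map_def dist_norm flip: scaleR_diff_right)

lemma continuous_on_gasket_map: "continuous_on S (gasket_map a j)"
  unfolding gasket_map_def by (intro continuous_intros)

lemma dist_word_map: "dist (word_map a w x) (word_map a w y) = dist x y / 2 ^ length w"
  by (induction w) (auto simp: dist_gasket_map)

lemma continuous_on_word_map: "continuous_on S (word_map a w)"
proof (rule lipschitz_on_continuous_on)
  show "1-lipschitz_on S (word_map a w)"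
    by (rule lipschitz_onI) (auto simp: dist_word_map divide_le_eq mult_le_cancel_left1)
qed

definition cross2 :: "plane \<Rightarrow> plane \<Rightarrow> real" where
  "cross2 u v = u $ 1 * v $ 2 - u $ 2 * v $ 1"

text \<open>The barycentric coordinates of \<open>x\<close>, as quotients of signed triangle
  areas.\<close>

definition bary :: "(3 \<Rightarrow> plane) \<Rightarrow> plane \<Rightarrow> 3 \<Rightarrow> real" where
  "bary a x j = (if j = 1 then cross2 (a 2 - x) (a 3 - x)
     else if j = 2 then cross2 (a 3 - x) (a 1 - x) else cross2 (a 1 - x) (a 2 - x))
       / cross2 (a 2 - a 1) (a 3 - a 1)"

lemma cross2_nonzero:
  assumes "\<not> collinear (range a)"
  shows "cross2 (a 2 - a 1) (a (3::3) - a 1) \<noteq> 0"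
proof
  define e f where "e = a 2 - a 1" and "f = a 3 - a 1"
  assume "cross2 (a 2 - a 1) (a 3 - a 1) = 0"
  then have z: "e $ 1 * f $ 2 = e $ 2 * f $ 1" by (simp add: cross2_def e_def f_def)
  have r: "range a = {a 1, a 2, a 3}"
  proof -
    have "a j \<in> {a 1, a 2, a 3}" for j using exhaust_3[of j] by auto
    then show ?thesis by blast
  qed
  have "collinear {0, e, f}"
  proof (cases "e = 0")
    case True
    then show ?thesis by simp
  next
    case False
    then have "(e $ 1)\<^sup>2 + (e $ 2)\<^sup>2 \<noteq> 0"
      by (auto simp: Finite_Cartesian_Product.vec_eq_iff forall_2 sum_power2_eq_zero_iff)
    then have n: "(e $ 1)\<^sup>2 + (e $ 2)\<^sup>2 \<noteq> 0" "(e $ 1) * (e $ 1) + (e $ 2) * (e $ 2) \<noteq> 0"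
      by (auto simp: power2_eq_square)
    have "f = ((e $ 1 * f $ 1 + e $ 2 * f $ 2) / ((e $ 1)\<^sup>2 + (e $ 2)\<^sup>2)) *\<^sub>R e"
    proof -
      have "f $ 1 * ((e $ 1)\<^sup>2 + (e $ 2)\<^sup>2) = (e $ 1 * f $ 1 + e $ 2 * f $ 2) * e $ 1"
        using z by (simp add: power2_eq_square algebra_simps)
      moreover have "f $ 2 * ((e $ 1)\<^sup>2 + (e $ 2)\<^sup>2) = (e $ 1 * f $ 1 + e $ 2 * f $ 2) * e $ 2"
        using z by (simp add: power2_eq_square algebra_simps)
      ultimately show ?thesis using n by (simp add: Finite_Cartesian_Product.vec_eq_iff forall_2 eq_divide_eq)
    qed
    then show ?thesis using collinear_lemma by blast
  qed
  then have "collinear {a 2, a 1, a 3}" using collinear_3[of "a 2" "a 1" "a 3"] by (simp add: e_def f_def)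
  then show False using assms r by (simp add: insert_commute)
qed

section \<open>Cells and their overlaps\<close>

locale gasket =
  fixes a :: "3 \<Rightarrow> plane" and X :: "plane set" and \<mu> :: "plane measure"
  assumes gasket: "is_gasket a X" and gasket_measure: "is_gasket_measure a X \<mu>"
begin

abbreviation "F \<equiv> gasket_map a"
abbreviation "cell_map \<equiv> word_map a"

lemma compact_X: "compact X" and X_ne: "X \<noteq> {}" and X_eq: "X = (\<Union>j. F j ` X)"
  and nondegenerate: "cross2 (a 2 - a 1) (a 3 - a 1) \<noteq> 0"
  using gasket cross2_nonzero[of a] by (auto simp: is_gasket_def)

lemma closed_X: "closed X"
  using compact_X compact_imp_closed by blast

lemma F_in_X: "x \<in> X \<Longrightarrow> F j x \<in> X"
  using X_eq by blast

lemma X_cases: assumes "x \<in> X" obtains j y where "y \<in> X" "x = F j y"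
  using assms X_eq by blast

lemma cell_map_in_X: "x \<in> X \<Longrightarrow> cell_map w x \<in> X"
  by (induction w) (auto simp: F_in_X)

lemma infdist_F:
  assumes "closed K" "K \<noteq> {}" "\<And>z. z \<in> K \<Longrightarrow> F j z \<in> K"
  shows "infdist (F j y) K \<le> infdist y K / 2"
proof -
  obtain z where z: "z \<in> K" "infdist y K = dist y z"
    using infdist_attains_inf[OF assms(1,2)] by metis
  have "infdist (F j y) K \<le> dist (F j y) (F j z)" using z assms(3) by (intro infdist_le) auto
  then show ?thesis using z by (simp add: dist_gasket_map)
qed

text \<open>A point of \<open>K\<close> at maximal distance from \<open>X\<close> is the image of a
  point of \<open>K\<close> at least twice as far away, so the maximum is 0. This places the
  vertices, and later the images of \<open>X\<close> under symmetries, inside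
  \<open>X\<close>.\<close>

lemma invariant_compact_subset:
  assumes K: "compact K" "K \<subseteq> (\<Union>j. F j ` K)"
  shows "K \<subseteq> X"
proof (cases "K = {}")
  case False
  have "continuous_on K (\<lambda>x. infdist x X)" by (intro continuous_intros)
  then obtain x where x: "x \<in> K" "\<And>y. y \<in> K \<Longrightarrow> infdist y X \<le> infdist x X"
    using continuous_attains_sup[OF K(1) False] by blast
  obtain j y where y: "y \<in> K" "x = F j y" using x(1) K(2) by auto
  have "infdist x X \<le> infdist y X / 2"
    unfolding y(2) by (rule infdist_F[OF closed_X X_ne F_in_X])
  then have "infdist x X \<le> 0" using x(2)[OF y(1)] by simp
  then have "infdist y X = 0" if "y \<in> K" for y using x(2)[OF that] infdist_nonneg[of y X] by linarith
  then show ?thesis using in_closed_iff_infdist_zero[OF closed_X X_ne] by auto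
qed simp

lemma vertex_in_X: "a j \<in> X"
proof -
  have "a j \<in> F j ` {a j}" by (simp add: gasket_map_vertex)
  then have "{a j} \<subseteq> (\<Union>j'. F j' ` {a j})" by blast
  then show ?thesis using invariant_compact_subset[of "{a j}"] by simp
qed

lemma bary_sum: "(\<Sum>j\<in>UNIV. bary a x j) = 1"
proof -
  have "cross2 (a 2 - x) (a 3 - x) + cross2 (a 3 - x) (a 1 - x) + cross2 (a 1 - x) (a 2 - x)
      = cross2 (a 2 - a 1) (a 3 - a 1)"
    by (simp add: cross2_def algebra_simps)
  then show ?thesis using nondegenerate
    by (simp add: sum_3 bary_def flip: add_divide_distrib)
qed

lemma bary_unique:
  assumes "(\<Sum>j\<in>UNIV. c j) = 1"
  shows "bary a (\<Sum>j\<in>UNIV. c j *\<^sub>R a j) j = c j"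
proof -
  define D where "D = cross2 (a 2 - a 1) (a 3 - a 1)"
  have c1: "c 1 = 1 - c 2 - c 3" using assms by (simp add: sum_3)
  have D: "D \<noteq> 0" using nondegenerate by (simp add: D_def)
  let ?x = "\<Sum>j\<in>UNIV. c j *\<^sub>R a j"
  have "cross2 (a 2 - ?x) (a 3 - ?x) = c 1 * D" "cross2 (a 3 - ?x) (a 1 - ?x) = c 2 * D"
     "cross2 (a 1 - ?x) (a 2 - ?x) = c 3 * D"
    unfolding sum_3 c1 D_def cross2_def by (simp_all add: algebra_simps)
  then have "bary a ?x 1 = c 1" "bary a ?x 2 = c 2" "bary a ?x 3 = c 3"
    using D by (simp_all add: bary_def flip: D_def)
  moreover have "j = 1 \<or> j = 2 \<or> j = 3" by (rule exhaust_3)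
  ultimately show ?thesis by auto
qed

lemma bary_combine: "(\<Sum>j\<in>UNIV. bary a x j *\<^sub>R a j) = x"
proof -
  define D where "D = cross2 (a 2 - a 1) (a 3 - a 1)"
  have D: "D \<noteq> 0" using nondegenerate by (simp add: D_def)
  have "D *\<^sub>R (\<Sum>j\<in>UNIV. bary a x j *\<^sub>R a j) = cross2 (a 2 - x) (a 3 - x) *\<^sub>R a 1
      + cross2 (a 3 - x) (a 1 - x) *\<^sub>R a 2 + cross2 (a 1 - x) (a 2 - x) *\<^sub>R a 3"
    using D by (simp add: sum_3 bary_def scaleR_add_right flip: D_def)
  also have "\<dots> = D *\<^sub>R x"
    unfolding Finite_Cartesian_Product.vec_eq_iff forall_2 by (simp add: D_def cross2_def algebra_simps)
  finally show ?thesis using D by simp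
qed

lemma bary_eqI: assumes "\<And>j. bary a x j = bary a y j" shows "x = y"
proof -
  have "x = (\<Sum>j\<in>UNIV. bary a x j *\<^sub>R a j)" by (rule bary_combine[symmetric])
  also have "\<dots> = y" unfolding assms by (rule bary_combine)
  finally show ?thesis .
qed

lemma bary_F: "bary a (F i x) j = bary a x j / 2 + (if i = j then 1/2 else 0)"
proof -
  let ?c = "\<lambda>j. bary a x j / 2 + (if i = j then 1/2 else 0)"
  have s: "(\<Sum>j\<in>UNIV. ?c j) = 1"
    using bary_sum[of x] by (simp add: sum.distrib flip: sum_divide_distrib)
  have "(\<Sum>j\<in>UNIV. ?c j *\<^sub>R a j) = (\<Sum>j\<in>UNIV. (1/2) *\<^sub>R (bary a x j *\<^sub>R a j) + (if i = j then (1/2) *\<^sub>R a j else 0))"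
    by (intro sum.cong) (auto simp: scaleR_add_left)
  also have "\<dots> = (1/2) *\<^sub>R x + (1/2) *\<^sub>R a i"
    unfolding sum.distrib scaleR_sum_right[symmetric] bary_combine by simp
  also have "\<dots> = F i x" by (simp add: gasket_map_def algebra_simps flip: scaleR_2)
  finally show ?thesis using bary_unique[OF s, of j] by simp
qed

lemma bary_vertex: "bary a (a i) j = (if i = j then 1 else 0)"
  using bary_F[of i "a i" j] by (auto simp: gasket_map_vertex)

lemma continuous_on_bary: "continuous_on S (\<lambda>x. bary a x j)"
proof -
  have c: "continuous_on S (\<lambda>x. cross2 (f x) (g x))" if "continuous_on S f" "continuous_on S g" for f g
    unfolding cross2_def using that by (intro continuous_intros)
  show ?thesis unfolding bary_def
    by (cases "j = 1"; cases "j = 2") (auto intro!: continuous_on_divide c continuous_intros simp: nondegenerate)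
qed

text \<open>The minimum over \<open>X\<close> is attained at some \<open>F i z\<close> and is hence
  at least half of itself.\<close>

lemma bary_nonneg: assumes "x \<in> X" shows "0 \<le> bary a x j"
proof -
  obtain y where y: "y \<in> X" "\<And>z. z \<in> X \<Longrightarrow> bary a y j \<le> bary a z j"
    using continuous_attains_inf[OF compact_X X_ne continuous_on_bary[of X j]] by blast
  obtain i z where z: "z \<in> X" "y = F i z" using X_cases[OF y(1)] by blast
  have "bary a z j / 2 \<le> bary a y j" unfolding z(2) bary_F by simp
  then have "0 \<le> bary a y j" using y(2)[OF z(1)] by linarith
  then show ?thesis using y(2)[OF assms] by linarith
qed

lemma bary_eq_1: assumes "x \<in> X" "1 \<le> bary a x j" shows "x = a j"
proof (rule bary_eqI)
  fix k
  have "sum (bary a x) UNIV = bary a x j + sum (bary a x) (UNIV - {j})"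
    by (simp add: sum.remove)
  moreover have nn: "\<And>k. k \<in> UNIV - {j} \<Longrightarrow> 0 \<le> bary a x k" using bary_nonneg[OF assms(1)] by blast
  then have "0 \<le> sum (bary a x) (UNIV - {j})" by (intro sum_nonneg)
  ultimately have "bary a x j = 1" "sum (bary a x) (UNIV - {j}) = 0"
    using bary_sum[of x] assms(2) by linarith+
  then have "\<forall>k\<in>UNIV - {j}. bary a x k = 0"
    using nn by (subst (asm) sum_nonneg_eq_0_iff) auto
  then show "bary a x k = bary a (a j) k"
    using \<open>bary a x j = 1\<close> by (auto simp: bary_vertex)
qed

text \<open>Coordinate \<open>j\<close> is at least 1/2 on the cell of \<open>j\<close> and at most
  1/2 on the other cells, so a common point of two cells takes the extreme value in both.\<close>

lemma F_overlap:
  assumes "x \<in> X" "y \<in> X" "F i x = F j y" "i \<noteq> j"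
  shows "x = a j" "y = a i"
proof -
  have "bary a (F i x) j = bary a (F j y) j" "bary a (F i x) i = bary a (F j y) i" using assms by auto
  then have "1 \<le> bary a x j" "1 \<le> bary a y i"
    using assms(4) bary_nonneg[OF assms(2), of j] bary_nonneg[OF assms(1), of i] by (auto simp: bary_F)
  then show "x = a j" "y = a i" using bary_eq_1 assms by auto
qed

text \<open>All coordinates of \<open>c\<close> being positive, the first letter of a nonempty word
  can be read off as the index of the only coordinate of the image that exceeds 1/2.\<close>

lemma cell_map_inj_center:
  assumes c: "\<And>j. 0 < bary a c j"
  shows "length w = length w' \<Longrightarrow> cell_map w c = cell_map w' c \<Longrightarrow> w = w'"
proof (induction w arbitrary: w')
  case (Cons j w)
  then obtain i v where w': "w' = i # v" "length w = length v" by (metis Suc_length_conv length_Cons)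
  have pos: "0 < bary a (cell_map u c) k" for u k
    using c by (induction u) (auto simp: bary_F add_pos_pos)
  have lt: "bary a (cell_map u c) k < 1" for u k
  proof -
    obtain l where l: "l \<noteq> k" by (metis (full_types) zero_neq_one)
    have "bary a (cell_map u c) k + bary a (cell_map u c) l = sum (bary a (cell_map u c)) {k, l}" using l by simp
    also have "\<dots> \<le> sum (bary a (cell_map u c)) UNIV" using pos less_imp_le by (intro sum_mono2) auto
    finally show ?thesis using bary_sum[of "cell_map u c"] pos[of u l] by linarith
  qed
  have e: "F j (cell_map w c) = F i (cell_map v c)" using Cons.prems w' by simp
  then have "bary a (F j (cell_map w c)) j = bary a (F i (cell_map v c)) j" by simp
  then have "i = j" using pos[of w j] lt[of v j] by (auto simp: bary_F split: if_splits)
  then show ?case using e Cons.IH[of v] w' by (simp add: gasket_map_inj)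
qed simp

lemma cell_map_diff: "cell_map w x - cell_map w y = (1 / 2 ^ length w) *\<^sub>R (x - y)"
  by (induction w) (simp_all add: gasket_map_def flip: scaleR_diff_right)

lemma bary_cell_map_diff: "bary a (cell_map w x) k - bary a (cell_map w y) k = (bary a x k - bary a y k) / 2 ^ length w"
proof (induction w)
  case (Cons j w)
  have "bary a (cell_map (j # w) x) k - bary a (cell_map (j # w) y) k = (bary a (cell_map w x) k - bary a (cell_map w y) k) / 2"
    by (simp add: bary_F diff_divide_distrib)
  then show ?case using Cons by simp
qed simp

text \<open>Cells of one level share vertices but not edges: the direction of an edge determines its
  end indices, and an end point then determines the image of the barycentre \<open>c\<close> and so
  the word. As \<open>adjacent\<close> relates points, this is what allows edges to be counted cell
  by cell.\<close>

lemma cell_map_edge_inj: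
  assumes "length w = length w'" "i \<noteq> j" "cell_map w (a i) = cell_map w' (a i')" "cell_map w (a j) = cell_map w' (a j')"
  shows "w = w' \<and> i = i' \<and> j = j'"
proof -
  have b: "bary a (a i) k - bary a (a j) k = bary a (a i') k - bary a (a j') k" for k
    using bary_cell_map_diff[of w "a i" k "a j"] bary_cell_map_diff[of w' "a i'" k "a j'"] assms by simp
  have ij: "i = i'" "j = j'"
    using b[of i] b[of j] assms(2) by (auto simp: bary_vertex split: if_splits)
  define c where "c = (\<Sum>j\<in>UNIV. (1/3) *\<^sub>R a j)"
  have bc: "bary a c k = 1/3" for k unfolding c_def by (rule bary_unique) (simp add: sum_3)
  have "cell_map w c = cell_map w' c"
    using cell_map_diff[of w c "a i", unfolded diff_eq_eq] cell_map_diff[of w' c "a i", unfolded diff_eq_eq]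
      assms(1,3) ij by simp
  then show ?thesis using cell_map_inj_center[of c w w'] bc assms(1) ij by simp
qed

section \<open>Graph energies cell by cell\<close>

definition Q0 :: "(plane \<Rightarrow> real) \<Rightarrow> (plane \<Rightarrow> real) \<Rightarrow> real" where
  "Q0 u v = (\<Sum>i\<in>UNIV. \<Sum>j\<in>UNIV. (u (a i) - u (a j)) * (v (a i) - v (a j))) / 2"

lemma graph_energy_words:
  "graph_energy a m u v = (5/3) ^ m * (\<Sum>w\<in>words m. Q0 (\<lambda>x. u (cell_map w x)) (\<lambda>x. v (cell_map w x)))"
proof -
  let ?I = "words m \<times> {(i :: 3, j). i \<noteq> j}"
  let ?h = "\<lambda>(w, i, j). (cell_map w (a i), cell_map w (a j))"
  let ?g = "\<lambda>(x, y). (u x - u y) * (v x - v y)"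
  have inj: "inj_on ?h ?I"
  proof (rule inj_onI)
    fix s t assume "s \<in> ?I" "t \<in> ?I" "?h s = ?h t"
    then obtain w i j w' i' j' where "s = (w, i, j)" "t = (w', i', j')" "length w = length w'" "i \<noteq> j"
        "cell_map w (a i) = cell_map w' (a i')" "cell_map w (a j) = cell_map w' (a j')"
      by (auto simp: words_def)
    then show "s = t" using cell_map_edge_inj[of w w' i j i' j'] by simp
  qed
  have img: "?h ` ?I = {(x, y). adjacent a m x y}"
  proof (intro equalityI subsetI)
    fix z assume "z \<in> ?h ` ?I"
    then obtain w i j where z: "z = (cell_map w (a i), cell_map w (a j))" "length w = m" "i \<noteq> j"
      by (auto simp: words_def)
    then have "cell_map w (a i) \<noteq> cell_map w (a j)" using cell_map_edge_inj[of w w i j i i] by auto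
    then show "z \<in> {(x, y). adjacent a m x y}" using z by (auto simp: adjacent_def)
  next
    fix z assume "z \<in> {(x, y). adjacent a m x y}"
    then obtain w i j where z: "z = (cell_map w (a i), cell_map w (a j))" "length w = m" "cell_map w (a i) \<noteq> cell_map w (a j)"
      by (auto simp: adjacent_def)
    then have "(w, i, j) \<in> ?I" by (auto simp: words_def)
    then show "z \<in> ?h ` ?I" using z by force
  qed
  have "(\<Sum>(x, y) \<in> {(x, y). adjacent a m x y}. (u x - u y) * (v x - v y)) = (\<Sum>t\<in>?I. ?g (?h t))"
    unfolding img[symmetric] using sum.reindex[OF inj, of ?g] by (simp add: o_def)
  also have "\<dots> = (\<Sum>w\<in>words m. \<Sum>p\<in>{(i :: 3, j). i \<noteq> j}. ?g (?h (w, p)))"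
    by (simp add: sum.cartesian_product split_def)
  also have "\<dots> = (\<Sum>w\<in>words m. 2 * Q0 (\<lambda>x. u (cell_map w x)) (\<lambda>x. v (cell_map w x)))"
  proof (rule sum.cong[OF refl])
    fix w
    have "(\<Sum>p\<in>{(i :: 3, j). i \<noteq> j}. ?g (?h (w, p))) = (\<Sum>p\<in>UNIV \<times> UNIV. ?g (?h (w, p)))"
      by (intro sum.mono_neutral_left) auto
    also have "\<dots> = (\<Sum>i\<in>UNIV. \<Sum>j\<in>UNIV. ?g (?h (w, i, j)))"
      by (simp add: sum.cartesian_product split_def)
    finally show "(\<Sum>p\<in>{(i :: 3, j). i \<noteq> j}. ?g (?h (w, p))) = 2 * Q0 (\<lambda>x. u (cell_map w x)) (\<lambda>x. v (cell_map w x))"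
      by (simp add: Q0_def)
  qed
  finally show ?thesis unfolding graph_energy_def by (simp flip: sum_distrib_left)
qed

text \<open>Restriction to a cell, rescaled to the whole gasket; the cutoff keeps one representative
  per function on \<open>X\<close>.\<close>

definition pull :: "3 \<Rightarrow> (plane \<Rightarrow> real) \<Rightarrow> plane \<Rightarrow> real" where
  "pull j u x = (if x \<in> X then u (F j x) else 0)"

abbreviation "GE \<equiv> graph_energy a"

lemma graph_energy_0: "GE 0 u v = Q0 u v"
  by (simp add: graph_energy_words)

lemma graph_energy_Suc: "GE (Suc m) u v = (5/3) * (\<Sum>j\<in>UNIV. GE m (pull j u) (pull j v))"
proof -
  have "Q0 (\<lambda>x. pull j u (cell_map w x)) (\<lambda>x. pull j v (cell_map w x)) = Q0 (\<lambda>x. u (cell_map (j # w) x)) (\<lambda>x. v (cell_map (j # w) x))" for j w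
    by (simp add: Q0_def pull_def cell_map_in_X vertex_in_X)
  then show ?thesis unfolding graph_energy_words sum_words_Suc
    by (simp add: mult.assoc flip: sum_distrib_left)
qed

text \<open>The values subtracted in \<open>p\<close>, \<open>q\<close>, \<open>r\<close> are the
  harmonic extension to the edge midpoints (the 1/5-2/5 rule), which minimises the energy of the
  next level. The factor 5/3 makes this minimum equal to \<open>Q0 u u\<close>; the excess is a sum
  of squares.\<close>

lemma Q0_le: "Q0 u u \<le> (5/3) * (\<Sum>j\<in>UNIV. Q0 (pull j u) (pull j u))"
proof -
  define m12 m13 m23 where "m12 = u (F 1 (a 2))" and "m13 = u (F 1 (a 3))" and "m23 = u (F 2 (a 3))"
  define u1 u2 u3 where "u1 = u (a 1)" and "u2 = u (a 2)" and "u3 = u (a 3)"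
  have e: "u (F 2 (a 1)) = m12" "u (F 3 (a 1)) = m13" "u (F 3 (a 2)) = m23"
    "u (F 1 (a 1)) = u1" "u (F 2 (a 2)) = u2" "u (F 3 (a 3)) = u3"
    "u (F 1 (a 2)) = m12" "u (F 1 (a 3)) = m13" "u (F 2 (a 3)) = m23"
    unfolding m12_def m13_def m23_def u1_def u2_def u3_def
    by (simp_all add: gasket_map_vertex gasket_map_swap[of a 2 1] gasket_map_swap[of a 3 1] gasket_map_swap[of a 3 2])
  define p q r where "p = m12 - (2 * u1 + 2 * u2 + u3) / 5" and "q = m13 - (2 * u1 + u2 + 2 * u3) / 5"
    and "r = m23 - (u1 + 2 * u2 + 2 * u3) / 5"
  have m: "m12 = p + (2 * u1 + 2 * u2 + u3) / 5" "m13 = q + (2 * u1 + u2 + 2 * u3) / 5"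
    "m23 = r + (u1 + 2 * u2 + 2 * u3) / 5" by (simp_all add: p_def q_def r_def)
  have "(5/3) * (\<Sum>j\<in>UNIV. Q0 (pull j u) (pull j u)) = Q0 u u
      + (5/3) * (2 * p\<^sup>2 + 2 * q\<^sup>2 + 2 * r\<^sup>2 + (p - q)\<^sup>2 + (p - r)\<^sup>2 + (q - r)\<^sup>2)"
    unfolding Q0_def pull_def sum_3 if_P[OF vertex_in_X] e u1_def[symmetric] u2_def[symmetric] u3_def[symmetric] m
    by (simp add: power2_eq_square field_simps)
  then show ?thesis by simp
qed

lemma graph_energy_mono: "GE m u u \<le> GE (Suc m) u u"
proof (induction m arbitrary: u)
  case 0
  show ?case unfolding graph_energy_Suc graph_energy_0 by (rule Q0_le)
next
  case (Suc m)
  then show ?case unfolding graph_energy_Suc[of "Suc m"] graph_energy_Suc[of m] by (intro mult_left_mono sum_mono) auto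
qed

end

section \<open>Measure, energy and symmetries\<close>

context gasket
begin

definition CX :: "(plane \<Rightarrow> real) set" where
  "CX = {u. continuous_on X u \<and> (\<forall>x. x \<notin> X \<longrightarrow> u x = 0)}"

definition dom :: "(plane \<Rightarrow> real) set" where "dom = energy_dom a X"

definition dom0 :: "(plane \<Rightarrow> real) set" where "dom0 = energy_dom0 a X"

definition ip :: "(plane \<Rightarrow> real) \<Rightarrow> (plane \<Rightarrow> real) \<Rightarrow> real" where "ip = L2_inner \<mu>"

abbreviation "EN \<equiv> energy a"

lemma CX_I: "continuous_on X u \<Longrightarrow> (\<And>x. x \<notin> X \<Longrightarrow> u x = 0) \<Longrightarrow> u \<in> CX"
  by (simp add: CX_def)

lemma CX_cong: "continuous_on X v \<Longrightarrow> (\<And>x. x \<in> X \<Longrightarrow> u x = v x) \<Longrightarrow> (\<And>x. x \<notin> X \<Longrightarrow> u x = 0) \<Longrightarrow> u \<in> CX"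
  by (auto simp: CX_def cong: continuous_on_cong)

lemma CX_cont: "u \<in> CX \<Longrightarrow> continuous_on X u" and CX_out: "u \<in> CX \<Longrightarrow> x \<notin> X \<Longrightarrow> u x = 0"
  by (auto simp: CX_def)

lemma CX_mult: "u \<in> CX \<Longrightarrow> v \<in> CX \<Longrightarrow> (\<lambda>x. u x * v x) \<in> CX"
  by (auto simp: CX_def intro: continuous_intros)

lemma CX_eqI: "u \<in> CX \<Longrightarrow> v \<in> CX \<Longrightarrow> (\<And>x. x \<in> X \<Longrightarrow> u x = v x) \<Longrightarrow> u = v"
  by (force simp: CX_def)

lemma subspace_CX: "rfun.subspace CX"
  by (rule rfun.subspaceI) (auto simp: CX_def intro: continuous_intros)

section \<open>Integrals as limits of averages over cells\<close>

lemma prob_mu: "prob_space \<mu>" and sets_mu: "sets \<mu> = sets (restrict_space borel X)"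
  and measure_cell: "measure \<mu> (cell_map w ` X) = 1 / 3 ^ length w"
  using gasket_measure by (auto simp: is_gasket_measure_def)

lemma space_mu: "space \<mu> = X"
  using sets_eq_imp_space_eq[OF sets_mu] by (simp add: space_restrict_space)

lemma CX_measurable: "u \<in> CX \<Longrightarrow> u \<in> borel_measurable \<mu>"
  using borel_measurable_continuous_on_restrict[OF CX_cont] measurable_cong_sets[OF sets_mu refl] by blast

lemma CX_bounded: assumes "u \<in> CX" obtains B where "\<And>x. \<bar>u x\<bar> \<le> B"
proof -
  have "bounded (u ` X)" using compact_continuous_image[OF CX_cont[OF assms] compact_X] compact_imp_bounded by blast
  then obtain B where "0 < B" "\<And>x. x \<in> X \<Longrightarrow> \<bar>u x\<bar> \<le> B" using bounded_pos by (auto simp: bounded_pos)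
  then have "\<bar>u x\<bar> \<le> B" for x using CX_out[OF assms, of x] by (cases "x \<in> X") auto
  then show ?thesis using that by blast
qed

lemma CX_integrable: assumes "u \<in> CX" shows "integrable \<mu> u"
proof -
  interpret prob_space \<mu> by (rule prob_mu)
  obtain B where "\<And>x. \<bar>u x\<bar> \<le> B" using CX_bounded[OF assms] by blast
  then show ?thesis by (intro integrable_const_bound[of _ B] CX_measurable[OF assms]) auto
qed

lemma cell_sets: "cell_map w ` X \<in> sets \<mu>"
proof -
  have "compact (cell_map w ` X)" by (rule compact_continuous_image[OF continuous_on_word_map compact_X])
  then have "cell_map w ` X \<in> sets borel" by (intro borel_closed compact_imp_closed)
  moreover have "cell_map w ` X \<subseteq> X" using cell_map_in_X by blast
  ultimately show ?thesis unfolding sets_mu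
    using borel_closed[OF closed_X] by (subst sets_restrict_space_iff) auto
qed

lemma cells_cover: assumes "x \<in> X" shows "\<exists>w\<in>words n. x \<in> cell_map w ` X"
  using assms
proof (induction n arbitrary: x)
  case 0
  then show ?case by simp
next
  case (Suc n)
  obtain j y where y: "y \<in> X" "x = F j y" using X_cases[OF Suc.prems] by blast
  obtain w where w: "w \<in> words n" "y \<in> cell_map w ` X" using Suc.IH[OF y(1)] by blast
  then have "j # w \<in> words (Suc n)" "x \<in> cell_map (j # w) ` X" using y by (auto simp: words_def)
  then show ?case by blast
qed

text \<open>The cells cover \<open>X\<close>, so the sum is at least 1, while its integral is
  exactly 1. This disposes of the overlaps without any statement about null sets of points.\<close>

lemma cell_indicator_sum: "AE x in \<mu>. (\<Sum>w\<in>words n. indicator (cell_map w ` X) x :: real) = 1"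
proof -
  interpret prob_space \<mu> by (rule prob_mu)
  let ?s = "\<lambda>x. \<Sum>w\<in>words n. indicator (cell_map w ` X) x :: real"
  have int: "integrable \<mu> ?s" using cell_sets by (intro Bochner_Integration.integrable_sum integrable_real_indicator) (auto simp: emeasure_finite less_top[symmetric])
  have ge: "1 \<le> ?s x" if x: "x \<in> space \<mu>" for x
  proof -
    obtain w where w: "w \<in> words n" "x \<in> cell_map w ` X" using cells_cover[of x n] x by (auto simp: space_mu)
    then show ?thesis using member_le_sum[of w "words n" "\<lambda>w. indicator (cell_map w ` X) x :: real"] by simp
  qed
  have "(\<integral>x. ?s x \<partial>\<mu>) = (\<Sum>w\<in>words n. measure \<mu> (cell_map w ` X))"
    using cell_sets by (subst Bochner_Integration.integral_sum) (auto simp: emeasure_finite less_top[symmetric])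
  also have "\<dots> = (\<Sum>w\<in>words n. 1 / 3 ^ n)" by (intro sum.cong) (auto simp: measure_cell words_def)
  also have "\<dots> = 1" by (simp add: card_words)
  finally have "(\<integral>x. ?s x - 1 \<partial>\<mu>) = 0" using int prob_space by simp
  moreover have "AE x in \<mu>. 0 \<le> ?s x - 1" using ge by (auto intro!: AE_I2)
  ultimately have "AE x in \<mu>. ?s x - 1 = 0"
    using int by (subst integral_nonneg_eq_0_iff_AE[symmetric]) auto
  then show ?thesis by eventually_elim simp
qed

text \<open>A Riemann sum with one sample point per cell, always in the relative position
  \<open>b\<close>. The measure is prescribed on cells only; its self-similarity and its symmetry
  are read off from these sums in the limit.\<close>

definition avg :: "nat \<Rightarrow> plane \<Rightarrow> (plane \<Rightarrow> real) \<Rightarrow> real" where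
  "avg n b f = (\<Sum>w\<in>words n. f (cell_map w b)) / 3 ^ n"

lemma cell_diam: obtains D where "0 < D" "\<And>w x y. x \<in> X \<Longrightarrow> y \<in> X \<Longrightarrow> dist (cell_map w x) (cell_map w y) \<le> D / 2 ^ length w"
proof -
  obtain e where e: "\<And>x y. x \<in> X \<Longrightarrow> y \<in> X \<Longrightarrow> dist x y \<le> e"
    using compact_imp_bounded[OF compact_X] by (auto simp: bounded_two_points)
  then have "dist (cell_map w x) (cell_map w y) \<le> (\<bar>e\<bar> + 1) / 2 ^ length w" if "x \<in> X" "y \<in> X" for w x y
    unfolding dist_word_map using e[OF that] by (intro divide_right_mono) auto
  then show ?thesis using that[of "\<bar>e\<bar> + 1"] by auto
qed

lemma cell_oscillation:
  assumes f: "continuous_on X f" and "0 < \<epsilon>"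
  shows "\<exists>n0. \<forall>n\<ge>n0. \<forall>w\<in>words n. \<forall>x\<in>X. \<forall>y\<in>X. \<bar>f (cell_map w x) - f (cell_map w y)\<bar> < (\<epsilon> :: real)"
proof -
  have "uniformly_continuous_on X f" using compact_uniformly_continuous[OF f compact_X] .
  then obtain d where d: "0 < d" "\<And>x y. x \<in> X \<Longrightarrow> y \<in> X \<Longrightarrow> dist y x < d \<Longrightarrow> dist (f y) (f x) < \<epsilon>"
    using assms(2) unfolding uniformly_continuous_on_def by metis
  obtain D where D: "0 < D" "\<And>w x y. x \<in> X \<Longrightarrow> y \<in> X \<Longrightarrow> dist (cell_map w x) (cell_map w y) \<le> D / 2 ^ length w"
    using cell_diam by blast
  have "(\<lambda>n. D / 2 ^ n) \<longlonglongrightarrow> 0" by (rule LIMSEQ_divide_realpow_zero) simp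
  then have "eventually (\<lambda>n. D / 2 ^ n < d) sequentially" using d(1) by (rule order_tendstoD)
  then obtain n0 where n0: "\<And>n. n \<ge> n0 \<Longrightarrow> D / 2 ^ n < d" by (auto simp: eventually_sequentially)
  show ?thesis
  proof (intro exI allI ballI impI)
    fix n w x y assume "n \<ge> n0" "w \<in> words n" "x \<in> X" "y \<in> X"
    then have "dist (cell_map w x) (cell_map w y) < d" using D(2)[of x y w] n0[of n] by (simp add: words_def)
    then show "\<bar>f (cell_map w x) - f (cell_map w y)\<bar> < \<epsilon>"
      using d(2)[of "cell_map w y" "cell_map w x"] cell_map_in_X \<open>x \<in> X\<close> \<open>y \<in> X\<close> by (simp add: dist_real_def)
  qed
qed

lemma avg_close:
  assumes f: "f \<in> CX" and b: "b \<in> X"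
    and osc: "\<And>w x. w \<in> words n \<Longrightarrow> x \<in> X \<Longrightarrow> \<bar>f (cell_map w x) - f (cell_map w b)\<bar> \<le> \<epsilon>"
  shows "\<bar>(\<integral>x. f x \<partial>\<mu>) - avg n b f\<bar> \<le> \<epsilon>"
proof -
  interpret prob_space \<mu> by (rule prob_mu)
  let ?g = "\<lambda>w x. indicator (cell_map w ` X) x * (f x - f (cell_map w b))"
  have ind: "integrable \<mu> (indicator (cell_map w ` X) :: _ \<Rightarrow> real)" for w
    using cell_sets by (intro integrable_real_indicator) (auto simp: emeasure_finite less_top[symmetric])
  have intf: "integrable \<mu> (\<lambda>x. indicator (cell_map w ` X) x * f x)" for w
    using integrable_mult_indicator[OF cell_sets CX_integrable[OF f]] by simp
  have intg: "integrable \<mu> (?g w)" for w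
    using Bochner_Integration.integrable_diff[OF intf[of w] integrable_mult_left[OF ind[of w], of "f (cell_map w b)"]]
    by (simp add: right_diff_distrib)
  have "(\<integral>x. f x \<partial>\<mu>) = (\<integral>x. (\<Sum>w\<in>words n. indicator (cell_map w ` X) x * f x) \<partial>\<mu>)"
  proof (rule integral_cong_AE)
    show "f \<in> borel_measurable \<mu>" using CX_measurable[OF f] .
    show "(\<lambda>x. \<Sum>w\<in>words n. indicator (cell_map w ` X) x * f x) \<in> borel_measurable \<mu>"
      using intf by (intro borel_measurable_sum) auto
    show "AE x in \<mu>. f x = (\<Sum>w\<in>words n. indicator (cell_map w ` X) x * f x)"
      using cell_indicator_sum[of n] by eventually_elim (simp flip: sum_distrib_right)
  qed
  also have "\<dots> = (\<Sum>w\<in>words n. (\<integral>x. indicator (cell_map w ` X) x * f x \<partial>\<mu>))"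
    using intf by (intro Bochner_Integration.integral_sum)
  also have "\<dots> = (\<Sum>w\<in>words n. (\<integral>x. ?g w x \<partial>\<mu>) + f (cell_map w b) / 3 ^ n)"
  proof (rule sum.cong[OF refl])
    fix w assume w: "w \<in> words n"
    have "(\<integral>x. indicator (cell_map w ` X) x * f x \<partial>\<mu>) = (\<integral>x. ?g w x + indicator (cell_map w ` X) x * f (cell_map w b) \<partial>\<mu>)"
      by (intro Bochner_Integration.integral_cong) (auto simp: algebra_simps)
    also have "\<dots> = (\<integral>x. ?g w x \<partial>\<mu>) + measure \<mu> (cell_map w ` X) * f (cell_map w b)"
      using intg ind cell_sets by (subst Bochner_Integration.integral_add) auto
    finally show "(\<integral>x. indicator (cell_map w ` X) x * f x \<partial>\<mu>) = (\<integral>x. ?g w x \<partial>\<mu>) + f (cell_map w b) / 3 ^ n"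
      using w by (simp add: measure_cell words_def)
  qed
  finally have eq: "(\<integral>x. f x \<partial>\<mu>) - avg n b f = (\<Sum>w\<in>words n. \<integral>x. ?g w x \<partial>\<mu>)"
    by (simp add: sum.distrib avg_def sum_divide_distrib)
  have "\<bar>\<integral>x. ?g w x \<partial>\<mu>\<bar> \<le> \<epsilon> * (1 / 3 ^ n)" if w: "w \<in> words n" for w
  proof -
    have "\<bar>\<integral>x. ?g w x \<partial>\<mu>\<bar> \<le> (\<integral>x. \<bar>?g w x\<bar> \<partial>\<mu>)" by (rule integral_abs_bound)
    also have "\<dots> \<le> (\<integral>x. \<epsilon> * indicator (cell_map w ` X) x \<partial>\<mu>)"
    proof (rule integral_mono)
      show "integrable \<mu> (\<lambda>x. \<bar>?g w x\<bar>)" using intg by (rule integrable_abs)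
      show "integrable \<mu> (\<lambda>x. \<epsilon> * indicator (cell_map w ` X) x)" using ind by (intro integrable_mult_right)
      show "\<bar>?g w x\<bar> \<le> \<epsilon> * indicator (cell_map w ` X) x" for x
        using osc[OF w] by (cases "x \<in> cell_map w ` X") auto
    qed
    also have "\<dots> = \<epsilon> * (1 / 3 ^ n)" using cell_sets[of w] w by (simp add: measure_cell words_def)
    finally show ?thesis .
  qed
  then have "\<bar>\<Sum>w\<in>words n. \<integral>x. ?g w x \<partial>\<mu>\<bar> \<le> (\<Sum>w\<in>words n. \<epsilon> * (1 / 3 ^ n))"
    by (intro order_trans[OF sum_abs] sum_mono) auto
  then show ?thesis unfolding eq by (simp add: card_words)
qed

lemma avg_tendsto:
  assumes f: "f \<in> CX" and b: "b \<in> X"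
  shows "(\<lambda>n. avg n b f) \<longlonglongrightarrow> (\<integral>x. f x \<partial>\<mu>)"
proof (rule LIMSEQ_I)
  fix r :: real assume r: "0 < r"
  obtain n0 where n0: "\<forall>n\<ge>n0. \<forall>w\<in>words n. \<forall>x\<in>X. \<forall>y\<in>X. \<bar>f (cell_map w x) - f (cell_map w y)\<bar> < r / 2"
    using cell_oscillation[OF CX_cont[OF f], of "r / 2"] r by auto
  have "norm (avg n b f - (\<integral>x. f x \<partial>\<mu>)) < r" if "n \<ge> n0" for n
    using avg_close[OF f b, of n "r / 2"] n0 b r that by (force simp: abs_minus_commute)
  then show "\<exists>n0. \<forall>n\<ge>n0. norm (avg n b f - (\<integral>x. f x \<partial>\<mu>)) < r" by blast
qed

lemma avg_Suc: assumes "b \<in> X" shows "avg (Suc n) b f = (\<Sum>j\<in>UNIV. avg n b (pull j f)) / 3"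
  using assms cell_map_in_X by (simp add: avg_def sum_words_Suc pull_def sum_divide_distrib mult.commute)

lemma pull_CX: assumes "u \<in> CX" shows "pull j u \<in> CX"
proof (rule CX_cong)
  show "continuous_on X (u \<circ> F j)"
    using CX_cont[OF assms] F_in_X
    by (intro continuous_on_compose continuous_on_gasket_map) (auto intro: continuous_on_subset)
qed (auto simp: pull_def)

lemma integral_pull: assumes "f \<in> CX" shows "(\<integral>x. f x \<partial>\<mu>) = (\<Sum>j\<in>UNIV. \<integral>x. pull j f x \<partial>\<mu>) / 3"
proof -
  obtain b where b: "b \<in> X" using X_ne by blast
  have "(\<lambda>n. (\<Sum>j\<in>UNIV. avg n b (pull j f)) / 3) \<longlonglongrightarrow> (\<Sum>j\<in>UNIV. \<integral>x. pull j f x \<partial>\<mu>) / 3"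
    using avg_tendsto[OF pull_CX[OF assms] b] by (intro tendsto_intros) auto
  moreover have "(\<lambda>n. avg (Suc n) b f) \<longlonglongrightarrow> (\<integral>x. f x \<partial>\<mu>)"
    using avg_tendsto[OF assms b] by (rule LIMSEQ_Suc)
  ultimately show ?thesis unfolding avg_Suc[OF b] by (rule LIMSEQ_unique[rotated])
qed

end

sublocale gasket \<subseteq> function_ip_space CX ip
proof (unfold_locales)
  show "rfun.subspace CX" by (rule subspace_CX)
next
  fix x y z assume *: "x \<in> CX" "y \<in> CX" "z \<in> CX"
  have "integrable \<mu> (\<lambda>t. x t * z t)" "integrable \<mu> (\<lambda>t. y t * z t)"
    using CX_integrable CX_mult * by blast+
  then show "ip (x + y) z = ip x z + ip y z" by (simp add: ip_def L2_inner_def distrib_right)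
next
  fix x z c
  show "ip (\<lambda>t. c * x t) z = c * ip x z" by (simp add: ip_def L2_inner_def mult.assoc)
next
  fix x y show "ip x y = ip y x" by (simp add: ip_def L2_inner_def mult.commute)
next
  fix x show "0 \<le> ip x x" by (simp add: ip_def L2_inner_def)
next
  fix f assume f: "f \<in> CX" and z: "ip f f = 0"
  have sq: "(\<lambda>x. f x * f x) \<in> CX" using CX_mult f by blast
  show "f = 0"
  proof (rule ccontr)
    assume "f \<noteq> 0"
    then obtain x where x: "f x \<noteq> 0" by (auto simp: fun_eq_iff)
    then have xX: "x \<in> X" using CX_out[OF f] by blast
    \<comment> \<open>Definiteness: a continuous function that is nonzero at a point is bounded away
      from 0 on a whole small cell around it, and cells have positive measure.\<close>
    define e where "e = (f x * f x) / 2"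
    have e: "0 < e" "f x * f x = 2 * e" using x by (auto simp: e_def zero_less_mult_iff)
    obtain n where n: "\<forall>w\<in>words n. \<forall>x\<in>X. \<forall>y\<in>X. \<bar>f (cell_map w x) * f (cell_map w x) - f (cell_map w y) * f (cell_map w y)\<bar> < e"
      using cell_oscillation[OF CX_cont[OF sq] e(1)] by blast
    obtain w y where w: "w \<in> words n" "y \<in> X" "x = cell_map w y" using cells_cover[OF xX, of n] by blast
    have "e * indicator (cell_map w ` X) t \<le> f t * f t" for t
    proof (cases "t \<in> cell_map w ` X")
      case True
      then obtain s where s: "s \<in> X" "t = cell_map w s" by blast
      have "\<bar>f x * f x - f t * f t\<bar> < e" using n w s by blast
      then show ?thesis using True e by simp
    qed auto
    then have "(\<integral>t. e * indicator (cell_map w ` X) t \<partial>\<mu>) \<le> (\<integral>t. f t * f t \<partial>\<mu>)"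
      using CX_integrable[OF sq] cell_sets[of w] prob_space.emeasure_le_1[OF prob_mu, of "cell_map w ` X"]
      by (intro integral_mono) (auto intro!: integrable_real_indicator simp: less_top[symmetric] top_unique)
    then have "e * measure \<mu> (cell_map w ` X) \<le> 0" using z cell_sets[of w] by (simp add: ip_def L2_inner_def)
    then show False using e(1) by (simp add: measure_cell mult_le_0_iff field_simps)
  qed
qed

section \<open>The energy form and its domain\<close>

context gasket
begin

lemma graph_energy_add: "GE m (u + u') v = GE m u v + GE m u' v"
  and graph_energy_scale: "GE m (\<lambda>x. c * u x) v = c * GE m u v"
  and graph_energy_sym: "GE m u v = GE m v u"
  unfolding graph_energy_words Q0_def
  by (simp_all add: algebra_simps sum.distrib sum_distrib_left sum_subtractf add_divide_distrib diff_divide_distrib)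

lemma graph_energy_nonneg: "0 \<le> GE m u u"
proof -
  have "0 \<le> Q0 v v" for v unfolding Q0_def by (simp add: sum_nonneg)
  then show ?thesis unfolding graph_energy_words by (intro mult_nonneg_nonneg sum_nonneg) auto
qed

lemma graph_energy_diff: "GE m (u - u') v = GE m u v - GE m u' v"
  using graph_energy_add[of m "u - u'" u' v] by simp

lemma graph_energy_add_right: "GE m v (u + u') = GE m v u + GE m v u'"
  and graph_energy_diff_right: "GE m v (u - u') = GE m v u - GE m v u'"
  using graph_energy_add[of m u u' v] graph_energy_diff[of m u u' v] graph_energy_sym[of m v] by simp_all

lemma graph_energy_incseq: "incseq (\<lambda>m. GE m u u)"
  using graph_energy_mono by (rule incseq_SucI)

lemma dom_iff: "u \<in> dom \<longleftrightarrow> u \<in> CX \<and> (\<exists>B. \<forall>m. GE m u u \<le> B)"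
proof -
  have "convergent (\<lambda>m. GE m u u) \<longleftrightarrow> (\<exists>B. \<forall>m. GE m u u \<le> B)"
  proof
    assume "convergent (\<lambda>m. GE m u u)"
    then have "Bseq (\<lambda>m. GE m u u)" by (rule convergent_imp_Bseq)
    then show "\<exists>B. \<forall>m. GE m u u \<le> B" by (auto simp: Bseq_def abs_le_iff)
  next
    assume "\<exists>B. \<forall>m. GE m u u \<le> B"
    then obtain B where "\<And>m. GE m u u \<le> B" by blast
    then obtain L where "(\<lambda>m. GE m u u) \<longlonglongrightarrow> L" using incseq_convergent[OF graph_energy_incseq] by blast
    then show "convergent (\<lambda>m. GE m u u)" by (rule convergentI)
  qed
  then show ?thesis by (auto simp: dom_def energy_dom_def CX_def)
qed

lemma dom_CX: "u \<in> dom \<Longrightarrow> u \<in> CX"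
  by (simp add: dom_iff)

lemma subspace_dom: "rfun.subspace dom"
proof (rule rfun.subspaceI)
  have "GE m 0 0 = 0" for m using graph_energy_scale[of m 0 0 0] by (simp add: zero_fun_def)
  then show "0 \<in> dom" using C_0 by (auto simp: dom_iff)
next
  fix u v assume u: "u \<in> dom" and v: "v \<in> dom"
  obtain A B where AB: "\<And>m. GE m u u \<le> A" "\<And>m. GE m v v \<le> B" using u v by (auto simp: dom_iff)
  have "GE m (u + v) (u + v) \<le> 2 * A + 2 * B" for m
  proof -
    \<comment> \<open>The parallelogram law, with the energy of the difference discarded.\<close>
    have "0 \<le> GE m (u - v) (u - v)" by (rule graph_energy_nonneg)
    then have "GE m (u + v) (u + v) \<le> 2 * GE m u u + 2 * GE m v v"
      by (simp add: graph_energy_add graph_energy_diff graph_energy_add_right graph_energy_diff_right)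
    then show ?thesis using AB[of m] by linarith
  qed
  then show "u + v \<in> dom" using C_add[OF dom_CX[OF u] dom_CX[OF v]] unfolding dom_iff by blast
next
  fix c u assume u: "u \<in> dom"
  obtain A where A: "\<And>m. GE m u u \<le> A" using u by (auto simp: dom_iff)
  have "GE m (\<lambda>x. c * u x) (\<lambda>x. c * u x) \<le> c * (c * A)" for m
  proof -
    have "GE m (\<lambda>x. c * u x) (\<lambda>x. c * u x) = (c * c) * GE m u u"
      using graph_energy_scale[of m c u u] graph_energy_scale[of m c u "\<lambda>x. c * u x"]
        graph_energy_sym[of m u "\<lambda>x. c * u x"] by simp
    also have "\<dots> \<le> (c * c) * A" using A by (intro mult_left_mono) auto
    finally show ?thesis by simp
  qed
  then show "(\<lambda>x. c * u x) \<in> dom" using C_scale[OF dom_CX[OF u], of c] unfolding dom_iff by blast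
qed

text \<open>Polarisation: the domain provides convergence for equal arguments only, and
  \<open>energy\<close>, being defined by \<open>lim\<close>, is meaningful only where there is
  convergence.\<close>

lemma graph_energy_tendsto:
  assumes "u \<in> dom" "v \<in> dom"
  shows "(\<lambda>m. GE m u v) \<longlonglongrightarrow> EN u v"
proof -
  have c: "convergent (\<lambda>m. GE m w w)" if "w \<in> dom" for w using that by (simp add: dom_def energy_dom_def)
  have "convergent (\<lambda>m. GE m (u + v) (u + v) - GE m u u - GE m v v)"
    using assms subspace_dom by (intro convergent_diff c rfun.subspace_add)
  then have "convergent (\<lambda>m. 2 * GE m u v)"
    by (simp add: graph_energy_add graph_energy_add_right graph_energy_sym[of _ v u])
  then have "convergent (\<lambda>m. (1/2) * (2 * GE m u v))" by (rule convergent_mult[OF convergent_const])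
  then show ?thesis by (simp add: energy_def convergent_LIMSEQ_iff)
qed

lemma energy_add: "u \<in> dom \<Longrightarrow> u' \<in> dom \<Longrightarrow> v \<in> dom \<Longrightarrow> EN (u + u') v = EN u v + EN u' v"
  using LIMSEQ_unique[OF graph_energy_tendsto[of "u + u'" v] ] rfun.subspace_add[OF subspace_dom, of u u']
    tendsto_add[OF graph_energy_tendsto graph_energy_tendsto, of u v u' v]
  by (simp add: graph_energy_add)

lemma energy_scale: "u \<in> dom \<Longrightarrow> v \<in> dom \<Longrightarrow> EN (\<lambda>x. c * u x) v = c * EN u v"
  using LIMSEQ_unique[OF graph_energy_tendsto[of "\<lambda>x. c * u x" v]] rfun.subspace_scale[OF subspace_dom, of u c]
    tendsto_mult[OF tendsto_const graph_energy_tendsto, of u v c]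
  by (simp add: graph_energy_scale)

lemma energy_sym: "EN u v = EN v u"
  unfolding energy_def using graph_energy_sym by simp

lemma energy_nonneg: "u \<in> dom \<Longrightarrow> 0 \<le> EN u u"
  using graph_energy_tendsto graph_energy_nonneg by (intro LIMSEQ_le_const[of "\<lambda>m. GE m u u"]) auto

lemma pull_dom: assumes "u \<in> dom" shows "pull j u \<in> dom"
proof -
  obtain B where B: "\<And>m. GE m u u \<le> B" using assms by (auto simp: dom_iff)
  have "GE m (pull j u) (pull j u) \<le> B" for m
  proof -
    have "GE m (pull j u) (pull j u) \<le> (\<Sum>j\<in>UNIV. GE m (pull j u) (pull j u))"
      by (intro member_le_sum graph_energy_nonneg) auto
    also have "\<dots> \<le> GE (Suc m) u u"
      unfolding graph_energy_Suc using sum_nonneg[of UNIV "\<lambda>j. GE m (pull j u) (pull j u)"] graph_energy_nonneg by simp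
    finally show ?thesis using B[of "Suc m"] by linarith
  qed
  then show ?thesis using pull_CX dom_CX[OF assms] by (auto simp: dom_iff)
qed

lemma energy_pull: assumes "u \<in> dom" "v \<in> dom" shows "EN u v = (5/3) * (\<Sum>j\<in>UNIV. EN (pull j u) (pull j v))"
proof -
  have "(\<lambda>m. GE (Suc m) u v) \<longlonglongrightarrow> (5/3) * (\<Sum>j\<in>UNIV. EN (pull j u) (pull j v))"
    unfolding graph_energy_Suc using assms by (intro tendsto_intros graph_energy_tendsto pull_dom)
  then show ?thesis using LIMSEQ_Suc[OF graph_energy_tendsto[OF assms]] LIMSEQ_unique by blast
qed

lemma pull_mult: "pull j (\<lambda>x. u x * v x) = (\<lambda>x. pull j u x * pull j v x)"
  by (auto simp: pull_def)

lemma ip_pull: assumes "u \<in> CX" "v \<in> CX" shows "ip u v = (\<Sum>j\<in>UNIV. ip (pull j u) (pull j v)) / 3"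
  unfolding ip_def L2_inner_def using integral_pull[OF CX_mult[OF assms]] by (simp add: pull_mult)

lemma dom0_iff: "u \<in> dom0 \<longleftrightarrow> u \<in> dom \<and> (\<forall>j. u (a j) = 0)"
  by (simp add: dom0_def dom_def energy_dom0_def)

lemma dom0_dom: "u \<in> dom0 \<Longrightarrow> u \<in> dom" and dom0_CX: "u \<in> dom0 \<Longrightarrow> u \<in> CX"
  by (simp_all add: dom0_iff dom_CX)

lemma subspace_dom0: "rfun.subspace dom0"
  using rfun.subspace_0[OF subspace_dom] rfun.subspace_add[OF subspace_dom] rfun.subspace_scale[OF subspace_dom]
  by (intro rfun.subspaceI) (auto simp: dom0_iff)

section \<open>Extension by zero from a cell\<close>

definition push :: "3 \<Rightarrow> (plane \<Rightarrow> real) \<Rightarrow> plane \<Rightarrow> real" where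
  "push j u y = (if y \<in> F j ` X then u (2 *\<^sub>R y - a j) else 0)"

lemma push_add: "push j (u + v) = push j u + push j v"
  and push_scale: "push j (\<lambda>x. c * u x) = (\<lambda>x. c * push j u x)"
  by (auto simp: push_def fun_eq_iff)

lemma push_F: "x \<in> X \<Longrightarrow> push j u (F j x) = u x"
  by (auto simp: push_def gasket_map_inverse)

text \<open>Distinct cells meet only in images of vertices, where \<open>u\<close> vanishes, so the
  extension from one cell leaves nothing on the others.\<close>

lemma pull_push:
  assumes "u \<in> CX" "\<And>j. u (a j) = 0"
  shows "pull i (push j u) = (if i = j then u else 0)"
proof
  fix x
  show "pull i (push j u) x = (if i = j then u else 0) x"
  proof (cases "x \<in> X")
    case x: True
    show ?thesis
    proof (cases "i = j")
      case True then show ?thesis using x by (simp add: pull_def push_F)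
    next
      case False
      have "push j u (F i x) = 0"
      proof (cases "F i x \<in> F j ` X")
        case True
        then obtain y where y: "y \<in> X" "F i x = F j y" by blast
        then have "y = a i" using F_overlap[OF x y(1) y(2) False] by blast
        then show ?thesis using y push_F[OF y(1), of j u] assms(2) by simp
      qed (simp add: push_def)
      then show ?thesis using False x by (simp add: pull_def)
    qed
  next
    case False
    then show ?thesis using CX_out[OF assms(1)] by (auto simp: pull_def)
  qed
qed

lemma CX_glue:
  assumes "\<And>j. pull j g \<in> CX" "\<And>x. x \<notin> X \<Longrightarrow> g x = 0"
  shows "g \<in> CX"
proof (rule CX_I)
  have "continuous_on (\<Union>j\<in>UNIV. F j ` X) g"
  proof (rule continuous_on_closed_Union)
    fix j
    show "closed (F j ` X)"
      using compact_continuous_image[OF continuous_on_gasket_map compact_X] compact_imp_closed by blast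
    have "continuous_on (F j ` X) (pull j g \<circ> (\<lambda>y. 2 *\<^sub>R y - a j))"
    proof (rule continuous_on_compose)
      have "(\<lambda>y. 2 *\<^sub>R y - a j) ` F j ` X = X" by (auto simp: image_image gasket_map_inverse)
      then show "continuous_on ((\<lambda>y. 2 *\<^sub>R y - a j) ` F j ` X) (pull j g)" using CX_cont[OF assms(1)] by simp
    qed (intro continuous_intros)
    then show "continuous_on (F j ` X) g"
      by (rule continuous_on_eq) (auto simp: pull_def gasket_map_inverse)
  qed auto
  then show "continuous_on X g" using X_eq by simp
qed (use assms in auto)

lemma push_out: "x \<notin> X \<Longrightarrow> push j u x = 0"
  using F_in_X by (auto simp: push_def)

lemma push_dom0: assumes u: "u \<in> dom0" shows "push j u \<in> dom0"
proof -
  have r: "pull i (push j u) = (if i = j then u else 0)" for i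
    using u by (intro pull_push) (auto simp: dom0_iff dom_CX)
  have CX: "push j u \<in> CX"
  proof (rule CX_glue)
    show "pull i (push j u) \<in> CX" for i unfolding r using dom0_CX[OF u] C_0 by simp
  qed (rule push_out)
  obtain B where B: "\<And>m. GE m u u \<le> B" using u by (auto simp: dom0_iff dom_iff)
  have z: "GE m 0 0 = 0" for m using graph_energy_scale[of m 0 0 0] by (simp add: zero_fun_def)
  have "GE m (push j u) (push j u) \<le> (5/3) * B" for m
  proof -
    have "GE m (push j u) (push j u) \<le> GE (Suc m) (push j u) (push j u)" by (rule graph_energy_mono)
    also have "\<dots> = (5/3) * (\<Sum>i\<in>UNIV. if i = j then GE m u u else 0)"
    proof -
      have "GE m (if i = j then u else 0) (if i = j then u else 0) = (if i = j then GE m u u else 0)" for i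
        by (simp add: z)
      then show ?thesis unfolding graph_energy_Suc r by simp
    qed
    finally show ?thesis using B[of m] by simp
  qed
  moreover have "push j u (a i) = 0" for i
  proof -
    have "push j u (F i (a i)) = pull i (push j u) (a i)" using vertex_in_X by (simp add: pull_def)
    then show ?thesis unfolding r using u by (auto simp: gasket_map_vertex dom0_iff)
  qed
  ultimately show ?thesis using CX unfolding dom0_iff dom_iff by blast
qed

lemma pull_push_dom0: "u \<in> dom0 \<Longrightarrow> pull i (push j u) = (if i = j then u else 0)"
  by (intro pull_push) (auto simp: dom0_iff dom_CX)

lemma pull_eq_imp_eq:
  assumes "u \<in> CX" "v \<in> CX" "\<And>j. pull j u = pull j v"
  shows "u = v"
proof (rule CX_eqI[OF assms(1,2)])
  fix x assume "x \<in> X"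
  then obtain j y where "y \<in> X" "x = F j y" using X_cases by blast
  then show "u x = v x" using fun_cong[OF assms(3)[of j], of y] by (simp add: pull_def)
qed

lemma ip_push: assumes "u \<in> dom0" "v \<in> CX" shows "ip (push j u) v = ip u (pull j v) / 3"
proof -
  have "ip (push j u) v = (\<Sum>i\<in>UNIV. if i = j then ip u (pull j v) else 0) / 3"
    unfolding ip_pull[OF dom0_CX[OF push_dom0[OF assms(1)]] assms(2)] pull_push_dom0[OF assms(1)]
    using pull_CX[OF assms(2)] by (intro arg_cong[of _ _ "\<lambda>s. s / 3"] sum.cong) auto
  then show ?thesis by simp
qed

lemma energy_0: "v \<in> dom \<Longrightarrow> EN 0 v = 0"
  using energy_scale[of v v 0] by (simp add: zero_fun_def)

lemma energy_push: assumes "u \<in> dom0" "v \<in> dom" shows "EN (push j u) v = (5/3) * EN u (pull j v)"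
proof -
  have "EN (push j u) v = (5/3) * (\<Sum>i\<in>UNIV. if i = j then EN u (pull j v) else 0)"
    unfolding energy_pull[OF dom0_dom[OF push_dom0[OF assms(1)]] assms(2)] pull_push_dom0[OF assms(1)]
    using pull_dom[OF assms(2)] energy_0 by (intro arg_cong[of _ _ "\<lambda>s. (5/3) * s"] sum.cong) auto
  then show ?thesis by simp
qed

section \<open>Symmetries of the triangle\<close>

definition affine_perm :: "(3 \<Rightarrow> 3) \<Rightarrow> plane \<Rightarrow> plane" where
  "affine_perm s x = (\<Sum>j\<in>UNIV. bary a x j *\<^sub>R a (s j))"

lemma bary_affine_perm: assumes "bij s" shows "bary a (affine_perm s x) (s j) = bary a x j"
proof -
  have inv: "s (inv_into UNIV s k) = k" "inv_into UNIV s (s k) = k" for k using assms by (auto simp: bij_is_surj surj_f_inv_f bij_is_inj)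
  have "affine_perm s x = (\<Sum>k\<in>UNIV. bary a x (inv_into UNIV s k) *\<^sub>R a k)"
    unfolding affine_perm_def by (rule sum.reindex_bij_witness[of _ "inv_into UNIV s" s]) (auto simp: inv)
  moreover have "(\<Sum>k\<in>UNIV. bary a x (inv_into UNIV s k)) = 1"
    using sum_bij_3[OF bij_imp_bij_inv[OF assms], of "bary a x"] bary_sum by simp
  ultimately show ?thesis using bary_unique[of "\<lambda>k. bary a x (inv_into UNIV s k)" "s j"] by (simp add: inv)
qed

lemma affine_perm_F: assumes "bij s" shows "affine_perm s (F j x) = F (s j) (affine_perm s x)"
proof (rule bary_eqI)
  fix k
  obtain l where l: "k = s l" using assms by (metis bij_pointE)
  show "bary a (affine_perm s (F j x)) k = bary a (F (s j) (affine_perm s x)) k"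
    unfolding l bary_F bary_affine_perm[OF assms] using assms by (simp add: bij_is_inj inj_eq)
qed

lemma affine_perm_vertex: "affine_perm s (a j) = a (s j)"
proof -
  have "affine_perm s (a j) = (\<Sum>k\<in>UNIV. if k = j then a (s j) else 0)"
    unfolding affine_perm_def bary_vertex by (intro sum.cong) auto
  then show ?thesis by simp
qed

lemma affine_perm_comp: assumes "bij s" "bij t" shows "affine_perm s (affine_perm t x) = affine_perm (s \<circ> t) x"
proof (rule bary_eqI)
  fix k
  obtain l where l: "k = s (t l)" using assms by (metis bij_pointE)
  show "bary a (affine_perm s (affine_perm t x)) k = bary a (affine_perm (s \<circ> t) x) k"
    using bary_affine_perm[OF assms(1), of _ "t l"] bary_affine_perm[OF assms(2), of x l]
      bary_affine_perm[OF bij_comp[OF assms(2,1)], of x l] by (simp add: l)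
qed

lemma continuous_on_affine_perm: "continuous_on S (affine_perm s)"
  unfolding affine_perm_def by (intro continuous_intros continuous_on_bary)

text \<open>The image of \<open>X\<close> is covered by its own images under the maps
  \<open>F j\<close>, because a symmetry merely permutes these maps.\<close>

lemma affine_perm_X: assumes "bij s" "x \<in> X" shows "affine_perm s x \<in> X"
proof -
  have "affine_perm s ` X \<subseteq> X"
  proof (rule invariant_compact_subset)
    show "compact (affine_perm s ` X)" by (rule compact_continuous_image[OF continuous_on_affine_perm compact_X])
    show "affine_perm s ` X \<subseteq> (\<Union>j. F j ` affine_perm s ` X)"
    proof
      fix y assume "y \<in> affine_perm s ` X"
      then obtain x where x: "x \<in> X" "y = affine_perm s x" by blast
      obtain j z where "z \<in> X" "x = F j z" using X_cases[OF x(1)] by blast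
      then have "y = F (s j) (affine_perm s z)" using x affine_perm_F[OF assms(1)] by simp
      then show "y \<in> (\<Union>j. F j ` affine_perm s ` X)" using \<open>z \<in> X\<close> by blast
    qed
  qed
  then show ?thesis using assms(2) by blast
qed

definition act :: "(3 \<Rightarrow> 3) \<Rightarrow> (plane \<Rightarrow> real) \<Rightarrow> plane \<Rightarrow> real" where
  "act s u x = (if x \<in> X then u (affine_perm s x) else 0)"

lemma act_add: "act s (u + v) = act s u + act s v"
  and act_scale: "act s (\<lambda>x. c * u x) = (\<lambda>x. c * act s u x)"
  by (auto simp: act_def fun_eq_iff)

lemma act_CX: assumes "bij s" "u \<in> CX" shows "act s u \<in> CX"
proof (rule CX_cong)
  show "continuous_on X (u \<circ> affine_perm s)"
    using CX_cont[OF assms(2)] affine_perm_X[OF assms(1)]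
    by (intro continuous_on_compose continuous_on_affine_perm) (auto intro: continuous_on_subset)
qed (auto simp: act_def)

lemma act_act: assumes "bij s" "bij t" shows "act t (act s u) = act (s \<circ> t) u"
  using affine_perm_X[OF assms(2)] affine_perm_comp[OF assms] by (auto simp: act_def)

lemma pull_act: assumes "bij s" shows "pull j (act s u) = act s (pull (s j) u)"
  using affine_perm_X[OF assms] F_in_X by (auto simp: pull_def act_def affine_perm_F[OF assms])

lemma act_vertex: "act s u (a j) = u (a (s j))"
  by (simp add: act_def vertex_in_X affine_perm_vertex)

lemma graph_energy_act: assumes "bij s" shows "GE m (act s u) (act s v) = GE m u v"
proof (induction m arbitrary: u v)
  case 0
  have "(\<Sum>i\<in>UNIV. \<Sum>j\<in>UNIV. (u (a (s i)) - u (a (s j))) * (v (a (s i)) - v (a (s j))))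
     = (\<Sum>i\<in>UNIV. \<Sum>j\<in>UNIV. (u (a (s i)) - u (a j)) * (v (a (s i)) - v (a j)))"
    by (intro sum.cong refl sum_bij_3[OF assms, of "\<lambda>j. (u (a (s _)) - u (a j)) * (v (a (s _)) - v (a j))"])
  also have "\<dots> = (\<Sum>i\<in>UNIV. \<Sum>j\<in>UNIV. (u (a i) - u (a j)) * (v (a i) - v (a j)))"
    by (rule sum_bij_3[OF assms, of "\<lambda>i. \<Sum>j\<in>UNIV. (u (a i) - u (a j)) * (v (a i) - v (a j))"])
  finally show ?case by (simp add: graph_energy_0 Q0_def act_vertex)
next
  case (Suc m)
  show ?case unfolding graph_energy_Suc pull_act[OF assms] Suc
    using sum_bij_3[OF assms, of "\<lambda>j. GE m (pull j u) (pull j v)"] by simp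
qed

lemma act_dom: "bij s \<Longrightarrow> u \<in> dom \<Longrightarrow> act s u \<in> dom"
  using act_CX by (auto simp: dom_iff graph_energy_act)

lemma act_dom0: "bij s \<Longrightarrow> u \<in> dom0 \<Longrightarrow> act s u \<in> dom0"
  using act_dom by (auto simp: dom0_iff act_vertex)

lemma energy_act: "bij s \<Longrightarrow> EN (act s u) (act s v) = EN u v"
  unfolding energy_def by (simp add: graph_energy_act)

text \<open>A symmetry permutes the words of each length and moves the sample point. The limit of
  the averages does not see the sample point, which yields invariance of the inner product.\<close>

lemma avg_act: assumes "bij s" shows "b \<in> X \<Longrightarrow> avg n b (act s f) = avg n (affine_perm s b) f"
proof (induction n arbitrary: f)
  case 0
  then show ?case by (simp add: avg_def act_def)
next
  case (Suc n)
  show ?case unfolding avg_Suc[OF Suc.prems] avg_Suc[OF affine_perm_X[OF assms Suc.prems]] pull_act[OF assms]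
      Suc.IH[OF Suc.prems] using sum_bij_3[OF assms, of "\<lambda>j. avg n (affine_perm s b) (pull j f)"] by simp
qed

lemma ip_act: assumes s: "bij s" and "u \<in> CX" "v \<in> CX" shows "ip (act s u) (act s v) = ip u v"
proof -
  obtain b where b: "b \<in> X" using X_ne by blast
  let ?f = "\<lambda>x. u x * v x"
  have f: "?f \<in> CX" using CX_mult assms by blast
  have "act s ?f = (\<lambda>x. act s u x * act s v x)" by (auto simp: act_def)
  moreover have "(\<integral>x. act s ?f x \<partial>\<mu>) = (\<integral>x. ?f x \<partial>\<mu>)"
    using avg_tendsto[OF act_CX[OF s f] b] avg_tendsto[OF f affine_perm_X[OF s b]] LIMSEQ_unique
    unfolding avg_act[OF s b] by blast
  ultimately show ?thesis by (simp add: ip_def L2_inner_def)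
qed

end

lemma sum_fun_apply: "(\<Sum>i\<in>I. f i) x = (\<Sum>i\<in>I. f i x :: 'b::comm_monoid_add)"
  by (induction I rule: infinite_finite_induct) auto

context gasket
begin

section \<open>Restriction and extension along words\<close>

fun pullw :: "3 list \<Rightarrow> (plane \<Rightarrow> real) \<Rightarrow> plane \<Rightarrow> real" where
  "pullw [] u = u"
| "pullw (j # w) u = pullw w (pull j u)"

fun pushw :: "3 list \<Rightarrow> (plane \<Rightarrow> real) \<Rightarrow> plane \<Rightarrow> real" where
  "pushw [] u = u"
| "pushw (j # w) u = push j (pushw w u)"

lemma pull_add: "pull j (u + v) = pull j u + pull j v"
  and pull_scale: "pull j (\<lambda>x. c * u x) = (\<lambda>x. c * pull j u x)"
  by (auto simp: pull_def fun_eq_iff)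

lemma pullw_add: "pullw w (u + v) = pullw w u + pullw w v"
  and pullw_scale: "pullw w (\<lambda>x. c * u x) = (\<lambda>x. c * pullw w u x)"
  by (induction w arbitrary: u v) (auto simp: pull_add pull_scale)

lemma pullw_0: "pullw w 0 = 0"
  using pullw_scale[of w 0 0] by (simp add: zero_fun_def)

lemma pushw_add: "pushw w (u + v) = pushw w u + pushw w v"
  and pushw_scale: "pushw w (\<lambda>x. c * u x) = (\<lambda>x. c * pushw w u x)"
  by (induction w arbitrary: u v) (auto simp: push_add push_scale)

lemma pushw_0: "pushw w 0 = 0"
  using pushw_scale[of w 0 0] by (simp add: zero_fun_def)

lemma pullw_CX: "u \<in> CX \<Longrightarrow> pullw w u \<in> CX"
  by (induction w arbitrary: u) (auto intro: pull_CX)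

lemma pullw_dom: "u \<in> dom \<Longrightarrow> pullw w u \<in> dom"
  by (induction w arbitrary: u) (auto intro: pull_dom)

lemma pushw_dom0: "u \<in> dom0 \<Longrightarrow> pushw w u \<in> dom0"
  by (induction w arbitrary: u) (auto intro: push_dom0)

text \<open>For a nonempty word \<open>push\<close> performs the cutoff; for the empty word only
  membership in \<open>CX\<close> makes \<open>u\<close> vanish outside \<open>X\<close>.\<close>

lemma pushw_support: "x \<notin> cell_map w ` X \<Longrightarrow> w \<noteq> [] \<or> u \<in> CX \<Longrightarrow> pushw w u x = 0"
proof (induction w arbitrary: x)
  case Nil
  then show ?case using CX_out by auto
next
  case (Cons j w)
  show ?case
  proof (cases "x \<in> F j ` X")
    case True
    then obtain y where y: "y \<in> X" "x = F j y" by blast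
    have yw: "y \<notin> cell_map w ` X" using Cons.prems y by force
    then have "w \<noteq> []" using y by (cases w) auto
    then have "pushw w u y = 0" using Cons.IH[OF yw] by simp
    then show ?thesis using y by (simp add: push_F)
  qed (simp add: push_def)
qed

lemma ip_pushw: "u \<in> dom0 \<Longrightarrow> v \<in> CX \<Longrightarrow> ip (pushw w u) v = ip u (pullw w v) / 3 ^ length w"
  by (induction w arbitrary: v) (auto simp: ip_push pushw_dom0 pull_CX)

lemma pullw_pushw:
  "u \<in> dom0 \<Longrightarrow> length w = length w' \<Longrightarrow> pullw w (pushw w' u) = (if w = w' then u else 0)"
proof (induction w arbitrary: w')
  case (Cons j w)
  then obtain i v where "w' = i # v" "length w = length v" by (metis Suc_length_conv length_Cons)
  then show ?case using Cons by (auto simp: pull_push_dom0 pushw_dom0 pullw_0)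
qed simp

lemma ip_words: "u \<in> CX \<Longrightarrow> v \<in> CX \<Longrightarrow> ip u v = (\<Sum>w\<in>words n. ip (pullw w u) (pullw w v)) / 3 ^ n"
proof (induction n arbitrary: u v)
  case (Suc n)
  have "ip (pull j u) (pull j v) = (\<Sum>w\<in>words n. ip (pullw (j # w) u) (pullw (j # w) v)) / 3 ^ n" for j
    using Suc.IH[OF pull_CX pull_CX] Suc.prems by simp
  then show ?case unfolding ip_pull[OF Suc.prems] sum_words_Suc by (simp flip: sum_divide_distrib)
qed simp

lemma energy_words:
  "u \<in> dom \<Longrightarrow> v \<in> dom \<Longrightarrow> EN u v = (5/3) ^ n * (\<Sum>w\<in>words n. EN (pullw w u) (pullw w v))"
proof (induction n arbitrary: u v)
  case (Suc n)
  have "EN (pull j u) (pull j v) = (5/3) ^ n * (\<Sum>w\<in>words n. EN (pullw (j # w) u) (pullw (j # w) v))" for j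
    using Suc.IH[OF pull_dom pull_dom] Suc.prems by simp
  then show ?case unfolding energy_pull[OF Suc.prems] sum_words_Suc by (simp flip: sum_distrib_left)
qed simp

lemma pullw_eq_0:
  assumes "u \<in> CX" "\<And>w. w \<in> words n \<Longrightarrow> pullw w u = 0"
  shows "u = 0"
proof (rule ip_eq_0[OF assms(1)])
  show "ip u u = 0" unfolding ip_words[OF assms(1,1), of n] using assms(2) C_0 by simp
qed

text \<open>A cell of level \<open>n\<close> carries mass 3^-n, hence the normalising factor.
  Functions from different cells are orthogonal because each restricts to zero on the cell of the
  other.\<close>

lemma ons_pushw:
  assumes b: "ons I b" "\<And>i. i \<in> I \<Longrightarrow> b i \<in> dom0"
  shows "ons (words n \<times> I) (\<lambda>(w, i) x. sqrt (3 ^ n) * pushw w (b i) x)"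
  unfolding ons_def
proof (intro conjI ballI)
  fix p q assume "p \<in> words n \<times> I" "q \<in> words n \<times> I"
  then obtain w i v j where p: "p = (w, i)" "w \<in> words n" "i \<in> I" and q: "q = (v, j)" "v \<in> words n" "j \<in> I"
    by auto
  have F: "pushw w (b i) \<in> dom0" "pushw v (b j) \<in> dom0" using p q b pushw_dom0 by auto
  show "(case p of (w, i) \<Rightarrow> \<lambda>x. sqrt (3 ^ n) * pushw w (b i) x) \<in> CX"
    using C_scale[OF dom0_CX[OF F(1)]] p by simp
  have "ip (pushw w (b i)) (pushw v (b j)) = (if w = v then ip (b i) (b j) else 0) / 3 ^ n"
    using p q b F ons_in_C[OF b(1)] by (auto simp: ip_pushw dom0_CX pullw_pushw words_def)
  moreover have "sqrt (3 ^ n) * (sqrt (3 ^ n) * t) = 3 ^ n * t" for t :: real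
    by (simp add: mult.assoc[symmetric])
  ultimately show "ip (case p of (w, i) \<Rightarrow> \<lambda>x. sqrt (3 ^ n) * pushw w (b i) x)
      (case q of (w, i) \<Rightarrow> \<lambda>x. sqrt (3 ^ n) * pushw w (b i) x) = (if p = q then 1 else 0)"
    using p q F ons_ip[OF b(1)] by (simp add: ip_scale ip_scale_right dom0_CX C_scale)
qed

section \<open>Antisymmetrisation\<close>

definition perm_sign :: "(3 \<Rightarrow> 3) \<Rightarrow> real" where "perm_sign s = of_int (sign s)"

definition antisym :: "(plane \<Rightarrow> real) \<Rightarrow> plane \<Rightarrow> real" where
  "antisym u = (\<Sum>s | bij s. (\<lambda>x. perm_sign s * act s u x))"

lemma perm_sign_comp: assumes "bij s" "bij t" shows "perm_sign (s \<circ> t) = perm_sign s * perm_sign t"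
proof -
  have "permutation u" if "bij u" for u :: "3 \<Rightarrow> 3"
    unfolding permutation_permutes using that by (intro exI[of _ UNIV]) (auto simp: permutes_def bij_iff)
  then show ?thesis using assms by (simp add: perm_sign_def sign_compose)
qed

lemma perm_sign_inv: "bij s \<Longrightarrow> perm_sign (inv_into UNIV s) = perm_sign s"
proof -
  assume s: "bij s"
  have p: "permutation s"
    unfolding permutation_permutes using s by (intro exI[of _ UNIV]) (auto simp: permutes_def bij_iff)
  show ?thesis using sign_inverse[OF p] by (simp add: perm_sign_def)
qed

lemma act_id: "u \<in> CX \<Longrightarrow> act id u = u"
  using CX_out by (auto simp: act_def affine_perm_def bary_combine)

lemma act_inverse: assumes "bij s" "v \<in> CX" shows "act s (act (inv_into UNIV s) v) = v"
  using act_act[OF bij_imp_bij_inv[OF assms(1)] assms(1)] act_id[OF assms(2)] bij_is_inj[OF assms(1)] by simp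

lemma act_adjoint_ip:
  assumes "bij s" "u \<in> CX" "v \<in> CX"
  shows "ip (act s u) v = ip u (act (inv_into UNIV s) v)"
  using ip_act[OF assms(1,2) act_CX[OF bij_imp_bij_inv[OF assms(1)] assms(3)]] act_inverse[OF assms(1,3)] by simp

lemma act_adjoint_energy:
  assumes "bij s" "v \<in> CX"
  shows "EN (act s u) v = EN u (act (inv_into UNIV s) v)"
  using energy_act[OF assms(1), of u "act (inv_into UNIV s) v"] act_inverse[OF assms] by simp

lemma antisym_apply: "antisym u x = (\<Sum>s | bij s. perm_sign s * act s u x)"
  by (simp add: antisym_def sum_fun_apply)

lemma antisym_add: "antisym (u + v) = antisym u + antisym v"
  by (simp add: fun_eq_iff antisym_apply act_add distrib_left sum.distrib)

lemma antisym_scale: "antisym (\<lambda>x. c * u x) = (\<lambda>x. c * antisym u x)"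
  by (simp add: fun_eq_iff antisym_apply act_scale sum_distrib_left mult.left_commute)

lemma antisym_dom: "u \<in> dom \<Longrightarrow> antisym u \<in> dom"
  unfolding antisym_def by (intro rfun.subspace_sum[OF subspace_dom] rfun.subspace_scale[OF subspace_dom] act_dom) auto

lemma antisym_CX: "u \<in> CX \<Longrightarrow> antisym u \<in> CX"
  unfolding antisym_def by (intro C_sum C_scale act_CX) auto

lemma sum_bij_inv: "(\<Sum>s | bij s. f (inv_into UNIV s)) = (\<Sum>s | bij (s :: 3 \<Rightarrow> 3). f s)"
  by (rule sum.reindex_bij_witness[of _ "inv_into UNIV" "inv_into UNIV"]) (auto simp: bij_imp_bij_inv inv_inv_eq)

end

section \<open>Localised eigenfunctions\<close>

context gasket
begin

text \<open>The transposition of the two other vertices fixes \<open>a j\<close> and reverses every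
  sign, so the value at \<open>a j\<close> equals its own negative. Since \<open>u\<close> has free
  vertex values here, this is what later admits test functions from all of
  \<open>dom\<close>.\<close>

lemma antisym_dom0: assumes "u \<in> dom" shows "antisym u \<in> dom0"
proof -
  have "antisym u (a j) = 0" for j
  proof -
    obtain k l :: 3 where kl: "k \<noteq> l" "k \<noteq> j" "l \<noteq> j"
    proof -
      have "j = 1 \<or> j = 2 \<or> j = 3" by (rule exhaust_3)
      then show ?thesis using that[of 2 3] that[of 1 3] that[of 1 2] by auto
    qed
    let ?t = "Transposition.transpose k l"
    have t: "bij ?t" "?t \<circ> ?t = id" "?t j = j" using kl by (auto simp: transpose_apply_other)
    have sgt: "perm_sign ?t = -1" using kl by (simp add: perm_sign_def sign_swap_id)
    have "antisym u (a j) = (\<Sum>s | bij s. perm_sign s * u (a (s j)))"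
      unfolding antisym_def sum_fun_apply by (simp add: act_vertex)
    also have "\<dots> = (\<Sum>s | bij s. perm_sign (s \<circ> ?t) * u (a ((s \<circ> ?t) j)))"
    proof (rule sum.reindex_bij_witness[of _ "\<lambda>s. s \<circ> ?t" "\<lambda>s. s \<circ> ?t"])
      fix s :: "3 \<Rightarrow> 3"
      show "s \<circ> ?t \<circ> ?t = s" using t(2) by (simp add: comp_assoc)
      then show "s \<circ> ?t \<circ> ?t = s" .
      show "s \<circ> ?t \<in> {s. bij s}" if "s \<in> {s. bij s}" using that t(1) bij_comp by blast
      then show "s \<circ> ?t \<in> {s. bij s}" if "s \<in> {s. bij s}" using that .
      show "perm_sign (s \<circ> ?t \<circ> ?t) * u (a ((s \<circ> ?t \<circ> ?t) j)) = perm_sign s * u (a (s j))"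
        using t(2) by (simp add: comp_assoc)
    qed
    also have "\<dots> = - (\<Sum>s | bij s. perm_sign s * u (a (s j)))"
      using t sgt perm_sign_comp by (simp add: sum_negf[symmetric])
    also have "(\<Sum>s | bij s. perm_sign s * u (a (s j))) = antisym u (a j)"
      unfolding antisym_def sum_fun_apply by (simp add: act_vertex)
    finally show ?thesis by simp
  qed
  then show ?thesis using antisym_dom[OF assms] by (simp add: dom0_iff)
qed

lemma energy_lincomb:
  assumes "\<And>i. i \<in> I \<Longrightarrow> f i \<in> dom" "v \<in> dom"
  shows "EN (\<Sum>i\<in>I. (\<lambda>x. c i * f i x)) v = (\<Sum>i\<in>I. c i * EN (f i) v)"
  using assms(1)
proof (induction I rule: infinite_finite_induct)
  case (insert i I)
  have "(\<lambda>x. c i * f i x) \<in> dom" "(\<Sum>i\<in>I. (\<lambda>x. c i * f i x)) \<in> dom"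
    using insert.prems by (auto intro!: rfun.subspace_sum[OF subspace_dom] rfun.subspace_scale[OF subspace_dom])
  then have "EN ((\<lambda>x. c i * f i x) + (\<Sum>i\<in>I. (\<lambda>x. c i * f i x))) v
      = c i * EN (f i) v + EN (\<Sum>i\<in>I. (\<lambda>x. c i * f i x)) v"
    using insert.prems assms(2) energy_scale[of "f i" v "c i"] by (subst energy_add) auto
  moreover have "EN (\<Sum>i\<in>I. (\<lambda>x. c i * f i x)) v = (\<Sum>i\<in>I. c i * EN (f i) v)"
    using insert.IH insert.prems by blast
  ultimately show ?case unfolding sum.insert[OF insert.hyps] by (simp only:)
qed (auto simp: energy_0[OF assms(2)])

text \<open>Each symmetry preserves the form, so its adjoint is the action of the inverse, and
  inversion permutes the group without changing signs.\<close>

lemma antisym_adjoint_ip: assumes "u \<in> CX" "v \<in> CX" shows "ip (antisym u) v = ip u (antisym v)"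
proof -
  have "ip (antisym u) v = (\<Sum>s | bij s. perm_sign s * ip (act s u) v)"
    unfolding antisym_def using assms act_CX by (intro ip_lincomb) auto
  also have "\<dots> = (\<Sum>s | bij s. perm_sign (inv_into UNIV s) * ip u (act (inv_into UNIV s) v))"
    using assms by (intro sum.cong) (auto simp: perm_sign_inv act_adjoint_ip)
  also have "\<dots> = (\<Sum>s | bij s. perm_sign s * ip u (act s v))" by (rule sum_bij_inv)
  also have "\<dots> = ip u (antisym v)"
    unfolding antisym_def using assms act_CX by (intro ip_lincomb_right[symmetric]) auto
  finally show ?thesis .
qed

lemma antisym_adjoint_energy: assumes "u \<in> dom" "v \<in> dom" shows "EN (antisym u) v = EN u (antisym v)"
proof -
  have "EN (antisym u) v = (\<Sum>s | bij s. perm_sign s * EN (act s u) v)"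
    unfolding antisym_def using assms act_dom by (intro energy_lincomb) auto
  also have "\<dots> = (\<Sum>s | bij s. perm_sign (inv_into UNIV s) * EN u (act (inv_into UNIV s) v))"
    using assms by (intro sum.cong) (auto simp: perm_sign_inv act_adjoint_energy dom_CX)
  also have "\<dots> = (\<Sum>s | bij s. perm_sign s * EN (act s v) u)"
    unfolding energy_sym[of u] by (rule sum_bij_inv)
  also have "\<dots> = EN (antisym v) u"
    unfolding antisym_def using assms act_dom by (intro energy_lincomb[symmetric]) auto
  finally show ?thesis by (simp add: energy_sym)
qed

lemma act_push: assumes s: "bij s" and u: "u \<in> dom0" shows "act s (push j u) = push (inv_into UNIV s j) (act s u)"
proof (rule pull_eq_imp_eq)
  show "act s (push j u) \<in> CX" using act_CX[OF s] push_dom0[OF u] dom0_CX by blast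
  show "push (inv_into UNIV s j) (act s u) \<in> CX" using push_dom0[OF act_dom0[OF s u]] dom0_CX by blast
  fix i
  have i: "s i = j \<longleftrightarrow> i = inv_into UNIV s j" using s by (metis bij_inv_eq_iff)
  have "act s 0 = 0" using act_scale[of s 0 0] by (simp add: zero_fun_def)
  then show "pull i (act s (push j u)) = pull i (push (inv_into UNIV s j) (act s u))"
    unfolding pull_act[OF s] pull_push_dom0[OF u] pull_push_dom0[OF act_dom0[OF s u]] i by simp
qed

text \<open>
  Every permutation of the three letters fixing the word \<open>[1, 2]\<close> is trivial, so the
  antisymmetrisation of a function supported in the cell of this word restricts to it unchanged.
\<close>

lemma pullw_antisym_pushw: assumes x: "x \<in> dom0" shows "pullw [1, 2] (antisym (pushw [1, 2] x)) = x"
proof -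
  let ?y = "pushw [1, 2] x"
  have lin: "pullw w (\<Sum>s\<in>S. (\<lambda>t. c s * g s t)) = (\<Sum>s\<in>S. (\<lambda>t. c s * pullw w (g s) t))" for w S c
      and g :: "(3 \<Rightarrow> 3) \<Rightarrow> plane \<Rightarrow> real"
  proof (induction S rule: infinite_finite_induct)
    case (insert s S)
    show ?case unfolding sum.insert[OF insert.hyps] pullw_add pullw_scale insert.IH by (rule refl)
  next
    case empty
    show ?case unfolding sum.empty by (rule pullw_0)
  next
    case (infinite S)
    show ?case unfolding sum.infinite[OF infinite] by (rule pullw_0)
  qed
  have r: "pullw [1, 2] (act s ?y) = (if s = id then x else 0)" if s: "bij s" for s
  proof -
    have "pullw [1, 2] (act s ?y) = act s (pull (s 2) (pull (s 1) (push 1 (push 2 x))))"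
      by (simp add: pull_act[OF s])
    also have "\<dots> = act s (if s 1 = 1 \<and> s 2 = 2 then x else 0)"
    proof -
      have "pull (s 2) 0 = 0" using pull_scale[of "s 2" 0 0] by (simp add: zero_fun_def)
      then show ?thesis by (auto simp: pull_push_dom0[OF push_dom0[OF x]] pull_push_dom0[OF x])
    qed
    also have "\<dots> = (if s = id then x else 0)"
    proof -
      have "s = id" if "s 1 = 1" "s 2 = 2"
      proof
        fix k
        have "s 3 \<noteq> s 1" "s 3 \<noteq> s 2" using s by (auto simp: bij_is_inj inj_eq)
        then have "s 3 \<noteq> 1" "s 3 \<noteq> 2" using that by auto
        then have "s 3 = 3" using exhaust_3[of "s 3"] by blast
        then show "s k = id k" using exhaust_3[of k] that by auto
      qed
      moreover have "act s 0 = 0" using act_scale[of s 0 0] by (simp add: zero_fun_def)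
      ultimately show ?thesis using act_id[OF dom0_CX[OF x]] by auto
    qed
    finally show ?thesis .
  qed
  have "pullw [1, 2] (antisym ?y) = (\<Sum>s | bij s. (\<lambda>t. perm_sign s * pullw [1, 2] (act s ?y) t))"
    unfolding antisym_def by (rule lin)
  also have "\<dots> = (\<Sum>s | bij (s :: 3 \<Rightarrow> 3). if s = id then x else 0)"
  proof (intro sum.cong refl)
    fix s :: "3 \<Rightarrow> 3" assume "s \<in> {s. bij s}"
    then have s: "bij s" by simp
    have "perm_sign id = 1" by (simp add: perm_sign_def sign_id)
    then show "(\<lambda>t. perm_sign s * pullw [1, 2] (act s ?y) t) = (if s = id then x else 0)"
      unfolding r[OF s] by (cases "s = id") (simp_all add: zero_fun_def)
  qed
  also have "\<dots> = x" by simp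
  finally show ?thesis .
qed

text \<open>
  Test functions need not vanish at the vertices here, which encodes vanishing normal derivatives of
  \<open>u\<close>; this is what makes the property stable under extension by zero from a cell. Both predicates admit
  \<open>u = 0\<close>.
\<close>

definition dn_eigen :: "real \<Rightarrow> (plane \<Rightarrow> real) \<Rightarrow> bool" where
  "dn_eigen l u \<longleftrightarrow> u \<in> dom0 \<and> (\<forall>v\<in>dom. EN u v = l * ip u v)"

definition dirichlet_eigen :: "real \<Rightarrow> (plane \<Rightarrow> real) \<Rightarrow> bool" where
  "dirichlet_eigen l u \<longleftrightarrow> u \<in> dom0 \<and> (\<forall>v\<in>dom0. EN u v = l * ip u v)"

lemma dn_eigen_dirichlet_eigen: "dn_eigen l u \<Longrightarrow> dirichlet_eigen l u"
  by (auto simp: dn_eigen_def dirichlet_eigen_def dom0_dom)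

text \<open>The restriction of a test function to a cell stays in \<open>dom\<close> but need not
  vanish at the vertices; this is where testing against all of \<open>dom\<close> pays off. The
  factor is 5 = (5/3) / (1/3) per letter.\<close>

lemma dn_eigen_pushw: "dn_eigen l u \<Longrightarrow> dn_eigen (5 ^ length w * l) (pushw w u)"
proof (induction w)
  case (Cons j w)
  then have *: "dn_eigen (5 ^ length w * l) (pushw w u)" by blast
  then show ?case
    by (auto simp: dn_eigen_def push_dom0 energy_push ip_push pull_dom dom_CX)
qed simp

lemma dn_eigen_act: assumes s: "bij s" and "dn_eigen l u" shows "dn_eigen l (act s u)"
proof -
  have u: "u \<in> dom0" using assms(2) by (simp add: dn_eigen_def)
  have "EN (act s u) v = l * ip (act s u) v" if v: "v \<in> dom" for v
    unfolding act_adjoint_energy[OF s dom_CX[OF v]] act_adjoint_ip[OF s dom0_CX[OF u] dom_CX[OF v]]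
    using assms act_dom[OF bij_imp_bij_inv[OF s] v] by (simp add: dn_eigen_def)
  then show ?thesis using act_dom0[OF s u] by (simp add: dn_eigen_def)
qed

text \<open>Antisymmetrisation is self-adjoint for both forms and sends every test function into
  \<open>dom0\<close>, where the Dirichlet equation for \<open>u\<close> applies.\<close>

lemma dirichlet_eigen_antisym: assumes "dirichlet_eigen l u" shows "dn_eigen l (antisym u)"
proof -
  have u: "u \<in> dom0" using assms by (simp add: dirichlet_eigen_def)
  have "EN (antisym u) v = l * ip (antisym u) v" if v: "v \<in> dom" for v
    unfolding antisym_adjoint_energy[OF dom0_dom[OF u] v] antisym_adjoint_ip[OF dom0_CX[OF u] dom_CX[OF v]]
    using assms antisym_dom0[OF v] by (simp add: dirichlet_eigen_def)
  then show ?thesis using antisym_dom0[OF dom0_dom[OF u]] by (simp add: dn_eigen_def)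
qed

text \<open>Orthogonality is required for all eigenvalues at once, which makes the space stable
  under restriction to cells; the cut at a spectral level comes from intersecting with
  \<open>eigspan L\<close>.\<close>

definition nonlocal :: "(plane \<Rightarrow> real) set" where
  "nonlocal = {f\<in>CX. \<forall>l u. dn_eigen l u \<longrightarrow> ip f u = 0}"

lemma subspace_nonlocal: "rfun.subspace nonlocal"
proof -
  have *: "u \<in> CX" if "dn_eigen l u" for l u using that dom0_CX by (simp add: dn_eigen_def)
  show ?thesis
    by (rule rfun.subspaceI)
       (auto simp: nonlocal_def C_0 C_add C_scale ip_add[OF _ _ *] ip_scale[OF _ *] ip_0[OF *])
qed

lemma nonlocal_CX: "f \<in> nonlocal \<Longrightarrow> f \<in> CX"
  by (simp add: nonlocal_def)

text \<open>Up to a factor, restriction to a cell is adjoint to extension by zero, and the latter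
  preserves the property \<open>dn_eigen\<close> with a different eigenvalue.\<close>

lemma nonlocal_pullw: assumes "f \<in> nonlocal" shows "pullw w f \<in> nonlocal"
proof -
  have "ip (pullw w f) u = 0" if u: "dn_eigen l u" for l u
  proof -
    have F: "u \<in> dom0" using u by (simp add: dn_eigen_def)
    have "ip f (pushw w u) = 0" using assms dn_eigen_pushw[OF u] by (auto simp: nonlocal_def)
    then have "ip u (pullw w f) = 0" using ip_pushw[OF F nonlocal_CX[OF assms], of w] by (simp add: ip_sym)
    then show ?thesis by (simp add: ip_sym)
  qed
  then show ?thesis using pullw_CX[OF nonlocal_CX[OF assms]] by (auto simp: nonlocal_def)
qed

lemma nonlocal_act: assumes s: "bij s" and "f \<in> nonlocal" shows "act s f \<in> nonlocal"
proof -
  have "ip (act s f) u = 0" if u: "dn_eigen l u" for l u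
    using dn_eigen_act[OF bij_imp_bij_inv[OF s] u] assms(2) act_adjoint_ip[OF s nonlocal_CX[OF assms(2)], of u] u
    by (auto simp: nonlocal_def dn_eigen_def dom0_CX)
  then show ?thesis using act_CX[OF s] nonlocal_CX[OF assms(2)] by (auto simp: nonlocal_def)
qed

end

section \<open>Spectral subspaces and the counting function\<close>

locale gasket_spectrum = gasket +
  fixes lam :: "nat \<Rightarrow> real" and \<phi> :: "nat \<Rightarrow> plane \<Rightarrow> real"
  assumes eigenbasis: "eigenbasis a X \<mu> lam \<phi>"
begin

lemma mono_lam: "mono lam" and lam_pos: "0 < lam n" and lam_at_top: "filterlim lam at_top sequentially"
  and eigen_phi: "eigenfunction a X \<mu> (lam n) (\<phi> n)"
  and ip_phi: "ip (\<phi> m) (\<phi> n) = (if m = n then 1 else 0)"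
  using eigenbasis by (auto simp: eigenbasis_def ip_def)

lemma eigenfunction_iff_dirichlet_eigen: "eigenfunction a X \<mu> l u \<longleftrightarrow> u \<noteq> 0 \<and> dirichlet_eigen l u"
proof -
  have *: "L2_inner \<mu> (\<lambda>x. - (- (l * u x))) v = l * ip u v" for v
    by (simp add: ip_def L2_inner_def mult.assoc)
  have "square_integrable \<mu> (\<lambda>x. - (l * u x))" if "u \<in> dom0"
  proof -
    have 1: "(\<lambda>x. (- l) * u x) \<in> CX" by (rule C_scale[OF dom0_CX[OF that]])
    have eq: "(\<lambda>x. - (l * u x)) = (\<lambda>x. (- l) * u x)" by simp
    show ?thesis unfolding eq square_integrable_def power2_eq_square
      using CX_measurable[OF 1] CX_integrable[OF CX_mult[OF 1 1]] by blast
  qed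
  then show ?thesis
    unfolding eigenfunction_def dirichlet_laplacian_def dirichlet_eigen_def dom0_def[symmetric] * by (auto simp: zero_fun_def)
qed

lemma dirichlet_eigen_phi: "dirichlet_eigen (lam n) (\<phi> n)"
  using eigen_phi eigenfunction_iff_dirichlet_eigen by blast

lemma phi_dom0: "\<phi> n \<in> dom0"
  using dirichlet_eigen_phi by (simp add: dirichlet_eigen_def)

lemma phi_CX: "\<phi> n \<in> CX"
  using phi_dom0 dom0_CX by blast

lemma ons_phi: "ons I \<phi>"
  using ip_phi phi_CX by (auto simp: ons_def)

lemma energy_phi: "v \<in> dom0 \<Longrightarrow> EN (\<phi> n) v = lam n * ip (\<phi> n) v"
  using dirichlet_eigen_phi by (simp add: dirichlet_eigen_def)

lemma parseval_sums: assumes "f \<in> CX" shows "(\<lambda>n. (ip f (\<phi> n))\<^sup>2) sums ip f f"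
proof -
  have "square_integrable \<mu> f"
    using CX_measurable[OF assms] CX_integrable[OF CX_mult[OF assms assms]]
    by (simp add: square_integrable_def power2_eq_square)
  then have l: "(\<lambda>N. \<integral>x. (f x - (\<Sum>n<N. L2_inner \<mu> f (\<phi> n) * \<phi> n x))\<^sup>2 \<partial>\<mu>) \<longlonglongrightarrow> 0"
    using eigenbasis by (auto simp: eigenbasis_def)
  have "(\<integral>x. (f x - (\<Sum>n<N. L2_inner \<mu> f (\<phi> n) * \<phi> n x))\<^sup>2 \<partial>\<mu>) = ip f f - (\<Sum>n<N. (ip f (\<phi> n))\<^sup>2)" for N
    unfolding ip_residual[OF ons_phi finite_lessThan assms, symmetric]
    by (simp add: ip_def L2_inner_def power2_eq_square sum_fun_apply)
  then have "(\<lambda>N. ip f f - (\<Sum>n<N. (ip f (\<phi> n))\<^sup>2)) \<longlonglongrightarrow> 0" using l by simp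
  then have "(\<lambda>N. ip f f - (ip f f - (\<Sum>n<N. (ip f (\<phi> n))\<^sup>2))) \<longlonglongrightarrow> ip f f - 0"
    by (intro tendsto_intros)
  then show ?thesis by (simp add: sums_def)
qed

lemma ortho_phi_imp_0: assumes "f \<in> CX" "\<And>n. ip f (\<phi> n) = 0" shows "f = 0"
proof (rule ip_eq_0[OF assms(1)])
  show "ip f f = 0" using parseval_sums[OF assms(1)] assms(2) sums_unique2[OF _ sums_zero] by simp
qed

text \<open>As the enumeration is monotone and tends to infinity, this is also the index of the
  first eigenvalue above \<open>L\<close>, and spectral subspaces are spans of initial
  segments.\<close>

definition eigcount :: "real \<Rightarrow> nat" where "eigcount L = card {n. lam n \<le> L}"

definition eigspan :: "real \<Rightarrow> (plane \<Rightarrow> real) set" where "eigspan L = rfun.span (\<phi> ` {..<eigcount L})"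

lemma lam_le_iff: "lam n \<le> L \<longleftrightarrow> n < eigcount L"
proof -
  obtain N where N: "L < lam N"
    using lam_at_top unfolding filterlim_at_top_dense eventually_sequentially by blast
  define m where "m = (LEAST n. L < lam n)"
  have m: "L < lam m" unfolding m_def using N by (rule LeastI)
  have eq: "lam n \<le> L \<longleftrightarrow> n < m" for n
  proof
    assume "lam n \<le> L"
    then show "n < m" using m monoD[OF mono_lam, of m n] by (cases "n < m") auto
  next
    assume "n < m"
    then show "lam n \<le> L" using not_less_Least[of n "\<lambda>n. L < lam n"] by (auto simp: m_def)
  qed
  then have "{n. lam n \<le> L} = {..<m}" by auto
  then show ?thesis using eq by (simp add: eigcount_def)
qed

lemma eigcount_at_top: "filterlim eigcount at_top at_top"
  unfolding filterlim_at_top eventually_at_top_linorder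
proof
  fix Z
  have "Z \<le> eigcount L" if "lam Z \<le> L" for L using that lam_le_iff[of Z L] by simp
  then show "\<exists>N. \<forall>n\<ge>N. Z \<le> eigcount n" by blast
qed

lemma subspace_eigspan: "rfun.subspace (eigspan L)" and fin_dim_eigspan: "fin_dim (eigspan L)"
  unfolding eigspan_def by (auto intro: fin_dim_span)

lemma eigspan_dom0: "eigspan L \<subseteq> dom0"
  unfolding eigspan_def using phi_dom0 subspace_dom0 by (intro rfun.span_minimal) auto

lemma eigspan_CX: "eigspan L \<subseteq> CX"
  using eigspan_dom0 dom0_CX by blast

lemma dim_eigspan: "rfun.dim (eigspan L) = eigcount L"
  unfolding eigspan_def using dim_span_ons[OF ons_phi, of "{..<eigcount L}"] by simp

lemma phi_eigspan: "n < eigcount L \<Longrightarrow> \<phi> n \<in> eigspan L"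
  unfolding eigspan_def by (intro rfun.span_base) auto

lemma eigspan_iff: "u \<in> eigspan L \<longleftrightarrow> u \<in> CX \<and> (\<forall>n\<ge>eigcount L. ip u (\<phi> n) = 0)"
proof
  assume u: "u \<in> eigspan L"
  have "ip u (\<phi> n) = 0" if "n \<ge> eigcount L" for n
  proof -
    have "ip (\<phi> n) u = 0"
      by (rule ip_ortho_span[of "\<phi> ` {..<eigcount L}"]) (use u that in \<open>auto simp: eigspan_def phi_CX ip_phi\<close>)
    then show ?thesis by (simp add: ip_sym)
  qed
  then show "u \<in> CX \<and> (\<forall>n\<ge>eigcount L. ip u (\<phi> n) = 0)" using u eigspan_CX by blast
next
  assume u: "u \<in> CX \<and> (\<forall>n\<ge>eigcount L. ip u (\<phi> n) = 0)"
  let ?p = "\<Sum>n<eigcount L. (\<lambda>x. ip u (\<phi> n) * \<phi> n x)"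
  have p: "?p \<in> eigspan L"
    by (auto intro!: rfun.subspace_sum[OF subspace_eigspan] rfun.subspace_scale[OF subspace_eigspan] phi_eigspan)
  then have pC: "?p \<in> CX" using eigspan_CX by blast
  have "ip ?p (\<phi> n) = (if n < eigcount L then ip u (\<phi> n) else 0)" for n
  proof -
    have "ip ?p (\<phi> n) = (\<Sum>m<eigcount L. ip u (\<phi> m) * ip (\<phi> m) (\<phi> n))"
      by (intro ip_lincomb) (auto simp: phi_CX)
    also have "\<dots> = (\<Sum>m<eigcount L. if m = n then ip u (\<phi> n) else 0)"
      by (intro sum.cong) (auto simp: ip_phi)
    finally show ?thesis by simp
  qed
  then have "u - ?p = 0"
    using u pC by (intro ortho_phi_imp_0) (auto simp: C_diff ip_diff phi_CX)
  then show "u \<in> eigspan L" using p by simp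
qed

lemma dirichlet_eigen_ip_phi: assumes "dirichlet_eigen l u" "ip u (\<phi> n) \<noteq> 0" shows "l = lam n"
proof -
  have "EN u (\<phi> n) = l * ip u (\<phi> n)" using assms(1) phi_dom0 by (simp add: dirichlet_eigen_def)
  moreover have "EN (\<phi> n) u = lam n * ip (\<phi> n) u" using assms(1) by (intro energy_phi) (simp add: dirichlet_eigen_def)
  ultimately show ?thesis using assms(2) by (simp add: energy_sym[of u] ip_sym[of u])
qed

lemma dirichlet_eigen_in_eigspan: assumes "dirichlet_eigen l u" "l \<le> L" shows "u \<in> eigspan L"
  using dirichlet_eigen_ip_phi[OF assms(1)] assms lam_le_iff[of _ L] dom0_CX by (force simp: eigspan_iff dirichlet_eigen_def)

lemma dirichlet_eigen_ortho_eigspan: assumes "dirichlet_eigen l u" "L < l" "f \<in> eigspan L" shows "ip f u = 0"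
proof -
  have *: "ip u (\<phi> n) = 0" if "n < eigcount L" for n
    using dirichlet_eigen_ip_phi[OF assms(1), of n] assms(2) that lam_le_iff[of n L] by force
  have "ip u f = 0"
    by (rule ip_ortho_span[of "\<phi> ` {..<eigcount L}"]) (use assms * in \<open>auto simp: eigspan_def phi_CX dirichlet_eigen_def dom0_CX\<close>)
  then show ?thesis by (simp add: ip_sym)
qed

lemma eigenspace_upto_eq: "eigenspace_upto a X \<mu> L = eigspan L"
proof
  show "eigenspace_upto a X \<mu> L \<subseteq> eigspan L"
    unfolding eigenspace_upto_def eigenfunction_iff_dirichlet_eigen using dirichlet_eigen_in_eigspan
    by (intro rfun.span_minimal subspace_eigspan) auto
  show "eigspan L \<subseteq> eigenspace_upto a X \<mu> L"
    unfolding eigenspace_upto_def eigspan_def using eigen_phi lam_le_iff by (intro rfun.span_mono) auto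
qed

section \<open>Rayleigh quotients and decoupling of cells\<close>

lemma energy_upper: assumes "f \<in> eigspan L" shows "EN f f \<le> L * ip f f"
proof -
  have f: "f = (\<Sum>n<eigcount L. (\<lambda>x. ip f (\<phi> n) * \<phi> n x))"
    using assms unfolding eigspan_def by (intro ons_expand[OF ons_phi]) auto
  have F: "f \<in> dom0" using assms eigspan_dom0 by blast
  have "EN f f = EN (\<Sum>n<eigcount L. (\<lambda>x. ip f (\<phi> n) * \<phi> n x)) f" using f by simp
  also have "\<dots> = (\<Sum>n<eigcount L. ip f (\<phi> n) * EN (\<phi> n) f)"
    by (intro energy_lincomb) (auto simp: dom0_dom phi_dom0 F)
  also have "\<dots> \<le> (\<Sum>n<eigcount L. L * (ip f (\<phi> n))\<^sup>2)"
  proof (rule sum_mono)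
    fix n assume "n \<in> {..<eigcount L}"
    then have "lam n * (ip f (\<phi> n))\<^sup>2 \<le> L * (ip f (\<phi> n))\<^sup>2"
      using lam_le_iff[of n L] by (intro mult_right_mono) auto
    then show "ip f (\<phi> n) * EN (\<phi> n) f \<le> L * (ip f (\<phi> n))\<^sup>2"
      using energy_phi[OF F, of n] by (simp add: ip_sym[of f] power2_eq_square mult_ac)
  qed
  also have "\<dots> = L * ip f f"
    using parseval_sq[OF ons_phi, of "{..<eigcount L}" f] assms eigspan_CX
    by (auto simp: eigspan_def simp flip: sum_distrib_left)
  finally show ?thesis .
qed

text \<open>Completeness of the eigenbasis is known for the inner product only, so the energy is
  estimated through partial sums: subtracting one leaves nonnegative energy. A single nonzero
  coefficient \<open>c m\<close> provides a surplus that survives the limit and makes the inequality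
  strict.\<close>

lemma energy_lower:
  assumes f: "f \<in> dom0" and o: "\<And>n. n < eigcount L \<Longrightarrow> ip f (\<phi> n) = 0" and "f \<noteq> 0"
  shows "L * ip f f < EN f f"
proof -
  define c where "c n = ip f (\<phi> n)" for n
  obtain m where m: "c m \<noteq> 0" using ortho_phi_imp_0[OF dom0_CX[OF f]] assms(3) by (auto simp: c_def)
  have lamc: "L * (c n)\<^sup>2 \<le> lam n * (c n)\<^sup>2" for n
    using o[of n] lam_le_iff[of n L] by (cases "n < eigcount L") (auto simp: c_def intro!: mult_right_mono)
  have mm: "L < lam m" using o[of m] m lam_le_iff[of m L] by (auto simp: c_def not_less)
  have up: "(\<Sum>n<N. lam n * (c n)\<^sup>2) \<le> EN f f" for N
  proof -
    let ?p = "\<Sum>n<N. (\<lambda>x. c n * \<phi> n x)"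
    have p: "?p \<in> dom0"
      by (auto intro!: rfun.subspace_sum[OF subspace_dom0] rfun.subspace_scale[OF subspace_dom0] phi_dom0)
    have dom: "f \<in> dom" "?p \<in> dom" "f - ?p \<in> dom"
      using dom0_dom[OF f] dom0_dom[OF p] dom0_dom[OF rfun.subspace_diff[OF subspace_dom0 f p]] by auto
    have pv: "EN ?p v = (\<Sum>n<N. c n * (lam n * ip (\<phi> n) v))" if "v \<in> dom0" for v
      using energy_lincomb[of "{..<N}" \<phi> v c] that energy_phi[OF that] by (simp add: phi_dom0 dom0_dom)
    have pf: "EN ?p f = (\<Sum>n<N. lam n * (c n)\<^sup>2)"
      unfolding pv[OF f] by (intro sum.cong) (simp_all add: c_def ip_sym[of f] power2_eq_square)
    have cp: "ip (\<phi> n) ?p = c n" if "n < N" for n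
      using ons_ip_lincomb[OF ons_phi, of "{..<N}" n c] that by (simp add: ip_sym)
    have pp: "EN ?p ?p = (\<Sum>n<N. lam n * (c n)\<^sup>2)"
      unfolding pv[OF p] using cp by (intro sum.cong) (simp_all add: power2_eq_square)
    have "EN f f = EN ((f - ?p) + ?p) f" by simp
    also have "\<dots> = EN (f - ?p) f + EN ?p f" using dom by (intro energy_add)
    also have "EN (f - ?p) f = EN ((f - ?p) + ?p) (f - ?p)" by (simp add: energy_sym)
    also have "\<dots> = EN (f - ?p) (f - ?p) + EN ?p (f - ?p)" using dom by (intro energy_add)
    also have "EN ?p (f - ?p) = EN ((f - ?p) + ?p) ?p - EN ?p ?p"
      using energy_add[OF dom(3,2,2)] by (simp add: energy_sym)
    also have "\<dots> = EN ?p f - EN ?p ?p" by (simp add: energy_sym)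
    finally have "EN f f = EN (f - ?p) (f - ?p) + (EN ?p f - EN ?p ?p) + EN ?p f" .
    then show ?thesis using energy_nonneg[OF dom(3)] pf pp by linarith
  qed
  let ?K = "(lam m - L) * (c m)\<^sup>2"
  have "?K \<le> EN f f - L * ip f f"
  proof (rule LIMSEQ_le_const)
    have "(\<lambda>N. \<Sum>n<N. (c n)\<^sup>2) \<longlonglongrightarrow> ip f f"
      using parseval_sums[OF dom0_CX[OF f]] by (simp add: sums_def c_def)
    then show "(\<lambda>N. EN f f - L * (\<Sum>n<N. (c n)\<^sup>2)) \<longlonglongrightarrow> EN f f - L * ip f f" by (intro tendsto_intros)
    show "\<exists>N. \<forall>n\<ge>N. ?K \<le> EN f f - L * (\<Sum>n<n. (c n)\<^sup>2)"
    proof (intro exI allI impI)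
      fix N assume N: "Suc m \<le> N"
      have "?K \<le> (\<Sum>n<N. (lam n - L) * (c n)\<^sup>2)"
        using N lamc by (intro member_le_sum) (auto simp: left_diff_distrib)
      also have "\<dots> = (\<Sum>n<N. lam n * (c n)\<^sup>2) - L * (\<Sum>n<N. (c n)\<^sup>2)"
        by (simp add: left_diff_distrib sum_subtractf sum_distrib_left)
      finally show "?K \<le> EN f f - L * (\<Sum>n<N. (c n)\<^sup>2)" using up[of N] by linarith
    qed
  qed
  moreover have "0 < ?K" using m mm by (intro mult_pos_pos) auto
  ultimately show ?thesis by linarith
qed

text \<open>Bookkeeping of scales: the energy factor (5/3)^n divided by 5^n is the mass 3^-n of a
  cell.\<close>

lemma scaled_ip_words:
  assumes "f \<in> CX"
  shows "(5/3) ^ n * (\<Sum>w\<in>words n. L / 5 ^ n * ip (pullw w f) (pullw w f)) = L * ip f f"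
proof -
  have "(\<Sum>w\<in>words n. L / 5 ^ n * ip (pullw w f) (pullw w f)) = L / 5 ^ n * (\<Sum>w\<in>words n. ip (pullw w f) (pullw w f))"
    by (simp only: sum_distrib_left)
  then show ?thesis unfolding ip_words[OF assms assms, of n] by (simp add: power_divide)
qed

text \<open>The vertex conditions make each restriction a Dirichlet function, so
  \<open>energy_lower\<close> applies in every cell at the rescaled threshold. Summed over the
  cells, the Rayleigh quotient of a nonzero \<open>f\<close> would exceed \<open>L\<close>, contrary
  to \<open>energy_upper\<close>.\<close>

lemma cellwise_vanishing:
  assumes f: "f \<in> eigspan L"
    and v: "\<And>w j. w \<in> words n \<Longrightarrow> pullw w f (a j) = 0"
    and o: "\<And>w k. w \<in> words n \<Longrightarrow> k < eigcount (L / 5 ^ n) \<Longrightarrow> ip (pullw w f) (\<phi> k) = 0"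
  shows "f = 0"
proof (rule ccontr)
  assume "f \<noteq> 0"
  have F: "f \<in> dom0" "f \<in> dom" "f \<in> CX" using f eigspan_dom0 dom0_dom dom0_CX by auto
  then obtain w where w: "w \<in> words n" "pullw w f \<noteq> 0" using pullw_eq_0[of f n] \<open>f \<noteq> 0\<close> by blast
  have g: "pullw u f \<in> dom0" if "u \<in> words n" for u
    using pullw_dom[OF F(2)] v[OF that] by (simp add: dom0_iff)
  have s: "L / 5 ^ n * ip (pullw u f) (pullw u f) < EN (pullw u f) (pullw u f)"
    if "u \<in> words n" "pullw u f \<noteq> 0" for u
    using o[OF that(1)] that by (intro energy_lower g) auto
  have le: "L / 5 ^ n * ip (pullw u f) (pullw u f) \<le> EN (pullw u f) (pullw u f)"
    if "u \<in> words n" for u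
  proof (cases "pullw u f = 0")
    case True
    then show ?thesis using energy_0[OF dom0_dom[OF g[OF that]]] C_0 by simp
  next
    case False
    then show ?thesis using s[OF that] by simp
  qed
  have "L * ip f f = (5/3) ^ n * (\<Sum>u\<in>words n. L / 5 ^ n * ip (pullw u f) (pullw u f))"
    by (rule scaled_ip_words[OF F(3), symmetric])
  also have "\<dots> < (5/3) ^ n * (\<Sum>u\<in>words n. EN (pullw u f) (pullw u f))"
    using sum_strict_mono_ex1[of "words n" "\<lambda>u. L / 5 ^ n * ip (pullw u f) (pullw u f)" "\<lambda>u. EN (pullw u f) (pullw u f)"]
      s[OF w] le w(1) by (intro mult_strict_left_mono) auto
  also have "\<dots> = EN f f" by (rule energy_words[OF F(2,2), symmetric])
  finally show False using energy_upper[OF f] by simp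
qed

text \<open>A count of conditions: three vertex values in each of the 3^n cells, and orthogonality
  to \<open>K\<close>; a nonzero \<open>f\<close> satisfying all of them contradicts
  \<open>cellwise_vanishing\<close>. How \<open>K\<close> entails \<open>o\<close> is left open, so
  that \<open>nonlocal_dim_rec\<close> can do with fewer conditions than there are pushed
  eigenfunctions.\<close>

lemma dim_le_trial:
  assumes U: "rfun.subspace U" "U \<subseteq> eigspan L" and K: "finite K" "K \<subseteq> CX"
    and o: "\<And>f w k. f \<in> U \<Longrightarrow> (\<And>y. y \<in> K \<Longrightarrow> ip f y = 0) \<Longrightarrow> w \<in> words n \<Longrightarrow> k < eigcount (L / 5 ^ n)
      \<Longrightarrow> ip (pullw w f) (\<phi> k) = 0"
  shows "rfun.dim U \<le> 3 ^ n * 3 + card K"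
proof (rule ccontr)
  assume big: "\<not> rfun.dim U \<le> 3 ^ n * 3 + card K"
  let ?I = "(words n \<times> (UNIV :: 3 set)) <+> K"
  let ?L = "\<lambda>i f. case i of Inl p \<Rightarrow> pullw (fst p) f (a (snd p)) | Inr y \<Rightarrow> ip f y"
  have UC: "U \<subseteq> CX" using U(2) eigspan_CX by blast
  have card: "card ?I < rfun.dim U"
    using big K(1) by (simp add: card_Plus card_cartesian_product card_words)
  have fin: "finite ?I" using K(1) by simp
  obtain f where f: "f \<in> U" "f \<noteq> 0" "\<And>i. i \<in> ?I \<Longrightarrow> ?L i f = 0"
  proof (rule kernel_nonzero[OF fin U(1) fin_dim_subset[OF fin_dim_eigspan U(2)] card, of ?L])
    fix i x y assume "i \<in> ?I" "x \<in> U" "y \<in> U"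
    then show "?L i (x + y) = ?L i x + ?L i y"
      using UC K(2) by (auto simp: pullw_add ip_add subset_iff split: sum.split)
  next
    fix i c x assume "i \<in> ?I" "x \<in> U"
    then show "?L i (\<lambda>t. c * x t) = c * ?L i x"
      using UC K(2) by (auto simp: pullw_scale ip_scale subset_iff split: sum.split)
  next
    fix u assume "u \<in> U" "u \<noteq> 0" and z: "\<And>i. i \<in> ?I \<Longrightarrow> ?L i u = 0"
    then show thesis by (intro that[of u] z)
  qed
  have v: "pullw w f (a j) = 0" if "w \<in> words n" for w j
    using f(3)[of "Inl (w, j)"] that by auto
  have "ip f y = 0" if "y \<in> K" for y using f(3)[of "Inr y"] that by auto
  then have "f = 0" using U(2) f(1) v o[OF f(1)] by (intro cellwise_vanishing[of f L n]) auto
  then show False using f(2) by simp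
qed

text \<open>Dirichlet bracketing. The additive error counts the vertex conditions; for fixed
  \<open>n\<close> it is constant in \<open>L\<close> and so negligible.\<close>

lemma eigcount_upper: "eigcount L \<le> 3 ^ n * 3 + 3 ^ n * eigcount (L / 5 ^ n)"
proof -
  let ?K = "(\<lambda>(w, k). pushw w (\<phi> k)) ` (words n \<times> {..<eigcount (L / 5 ^ n)})"
  have "rfun.dim (eigspan L) \<le> 3 ^ n * 3 + card ?K"
  proof (rule dim_le_trial[OF subspace_eigspan order_refl])
    show "?K \<subseteq> CX" using pushw_dom0[OF phi_dom0] dom0_CX by auto
    fix f w k assume f: "f \<in> eigspan L" "\<And>y. y \<in> ?K \<Longrightarrow> ip f y = 0" and w: "w \<in> words n" "k < eigcount (L / 5 ^ n)"
    have "ip f (pushw w (\<phi> k)) = 0" using f(2) w by auto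
    moreover have "f \<in> CX" using f(1) eigspan_CX by blast
    ultimately show "ip (pullw w f) (\<phi> k) = 0"
      using ip_pushw[OF phi_dom0, of f w k] by (simp add: ip_sym)
  qed simp
  moreover have "card ?K \<le> 3 ^ n * eigcount (L / 5 ^ n)"
    using card_image_le[of "words n \<times> {..<eigcount (L / 5 ^ n)}" "\<lambda>(w, k). pushw w (\<phi> k)"]
    by (simp add: card_cartesian_product card_words)
  ultimately show ?thesis unfolding dim_eigspan by linarith
qed

text \<open>The min-max principle: eigenfunctions extended by zero from the cells span a space of
  Dirichlet functions with Rayleigh quotients at most \<open>L\<close>. If its dimension exceeded
  that of \<open>eigspan L\<close>, a nonzero element orthogonal to \<open>eigspan L\<close> would
  contradict \<open>energy_lower\<close>.\<close>

lemma eigcount_lower: "3 ^ n * eigcount (L / 5 ^ n) \<le> eigcount L"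
proof (rule ccontr)
  assume less: "\<not> ?thesis"
  let ?d = "eigcount (L / 5 ^ n)"
  let ?I = "words n \<times> {..<?d}"
  let ?e = "\<lambda>(w, k) x. sqrt (3 ^ n) * pushw w (\<phi> k) x"
  have e: "ons ?I ?e" by (rule ons_pushw[OF ons_phi phi_dom0])
  have fin: "finite ?I" by simp
  define T where "T = rfun.span (?e ` ?I)"
  have eF: "?e ` ?I \<subseteq> dom0" using rfun.subspace_scale[OF subspace_dom0] pushw_dom0[OF phi_dom0] by auto
  have T: "rfun.subspace T" "fin_dim T" "T \<subseteq> dom0" "T \<subseteq> CX"
    using eF subspace_dom0 dom0_CX rfun.span_minimal[OF eF subspace_dom0] fin_dim_span[of "?e ` ?I"] by (auto simp: T_def)
  have "rfun.dim (eigspan L) < rfun.dim T"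
    using less dim_span_ons[OF e fin] by (simp add: T_def dim_eigspan card_cartesian_product card_words)
  then obtain f where f: "f \<in> T" "f \<noteq> 0" "\<And>v. v \<in> eigspan L \<Longrightarrow> ip f v = 0"
    using ortho_nonzero[OF T(1,2,4) fin_dim_eigspan eigspan_CX] by blast
  have F: "f \<in> dom0" "f \<in> dom" "f \<in> CX" using f T dom0_dom by auto
  have r: "pullw w f \<in> eigspan (L / 5 ^ n)" if w: "w \<in> words n" for w
  proof -
    have sub: "rfun.subspace {f. pullw w f \<in> eigspan (L / 5 ^ n)}"
      using rfun.subspace_0[OF subspace_eigspan] rfun.subspace_add[OF subspace_eigspan] rfun.subspace_scale[OF subspace_eigspan]
      by (intro rfun.subspaceI) (auto simp only: mem_Collect_eq pullw_0 pullw_add pullw_scale)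
    have "?e ` ?I \<subseteq> {f. pullw w f \<in> eigspan (L / 5 ^ n)}"
    proof
      fix g assume "g \<in> ?e ` ?I"
      then obtain v k where g: "g = (\<lambda>x. sqrt (3 ^ n) * pushw v (\<phi> k) x)" "v \<in> words n" "k < ?d" by auto
      have "pullw w (pushw v (\<phi> k)) = (if w = v then \<phi> k else 0)"
        using w g(2) by (intro pullw_pushw[OF phi_dom0]) (simp add: words_def)
      then have "pullw w (pushw v (\<phi> k)) \<in> eigspan (L / 5 ^ n)"
        using phi_eigspan[OF g(3)] rfun.subspace_0[OF subspace_eigspan] by (cases "w = v") (simp_all only: if_True if_False simp_thms)
      then show "g \<in> {f. pullw w f \<in> eigspan (L / 5 ^ n)}"
        unfolding g(1) mem_Collect_eq pullw_scale by (rule rfun.subspace_scale[OF subspace_eigspan])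
    qed
    then show ?thesis using rfun.span_minimal[OF _ sub] f(1) by (auto simp: T_def)
  qed
  have "EN f f = (5/3) ^ n * (\<Sum>w\<in>words n. EN (pullw w f) (pullw w f))" by (rule energy_words[OF F(2,2)])
  also have "\<dots> \<le> (5/3) ^ n * (\<Sum>w\<in>words n. L / 5 ^ n * ip (pullw w f) (pullw w f))"
    using energy_upper[OF r] by (intro mult_left_mono sum_mono) auto
  also have "\<dots> = L * ip f f"
    by (rule scaled_ip_words[OF F(3)])
  finally have "EN f f \<le> L * ip f f" .
  moreover have "L * ip f f < EN f f" using f(3)[OF phi_eigspan] f(2) F(1) by (intro energy_lower) auto
  ultimately show False by simp
qed

section \<open>The recursion for the nonlocal dimension\<close>

definition nonlocal_dim :: "real \<Rightarrow> nat" where "nonlocal_dim L = rfun.dim (eigspan L \<inter> nonlocal)"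

lemma subspace_eigspan_nonlocal: "rfun.subspace (eigspan L \<inter> nonlocal)"
  by (rule rfun.subspace_inter[OF subspace_eigspan subspace_nonlocal])

lemma fin_dim_eigspan_nonlocal: "fin_dim (eigspan L \<inter> nonlocal)"
  by (rule fin_dim_subset[OF fin_dim_eigspan]) auto

lemma nonlocal_dim_le_eigcount: "nonlocal_dim L \<le> eigcount L"
  unfolding nonlocal_dim_def dim_eigspan[symmetric] by (intro dim_mono_fin_dim fin_dim_eigspan) auto

text \<open>Moved to the other side, antisymmetrisation turns each \<open>\<phi> n\<close> into a
  function to which \<open>f\<close> is orthogonal by definition; completeness does the
  rest.\<close>

lemma nonlocal_antisym: assumes "f \<in> nonlocal" shows "antisym f = 0"
proof (rule ortho_phi_imp_0)
  show "antisym f \<in> CX" using antisym_CX nonlocal_CX assms by blast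
  fix n
  have "ip f (antisym (\<phi> n)) = 0" using assms dirichlet_eigen_antisym[OF dirichlet_eigen_phi] by (auto simp: nonlocal_def)
  then show "ip (antisym f) (\<phi> n) = 0" using antisym_adjoint_ip[OF nonlocal_CX[OF assms] phi_CX] by simp
qed

text \<open>Every \<open>dn_eigen\<close> function lies in \<open>eigspan L\<close> or is orthogonal
  to it, so the projection \<open>p\<close> of \<open>g\<close> to \<open>eigspan L\<close> is again
  nonlocal. The smaller space \<open>eigspan L \<inter> nonlocal\<close> can thus replace
  \<open>eigspan L\<close> as the set of conditions, which closes the recursion.\<close>

lemma nonlocal_ortho_eigspan:
  assumes g: "g \<in> nonlocal" and o: "\<And>x. x \<in> eigspan L \<inter> nonlocal \<Longrightarrow> ip g x = 0" and k: "k < eigcount L"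
  shows "ip g (\<phi> k) = 0"
proof -
  define p where "p = (\<Sum>n<eigcount L. (\<lambda>x. ip g (\<phi> n) * \<phi> n x))"
  have gC: "g \<in> CX" using nonlocal_CX[OF g] .
  have p: "p \<in> eigspan L"
    unfolding p_def
    by (auto intro!: rfun.subspace_sum[OF subspace_eigspan] rfun.subspace_scale[OF subspace_eigspan] phi_eigspan)
  have pC: "p \<in> CX" using p eigspan_CX by blast
  have gp: "ip v p = (\<Sum>n<eigcount L. ip g (\<phi> n) * ip v (\<phi> n))" if "v \<in> CX" for v
    unfolding p_def by (rule ip_lincomb_right) (auto simp: phi_CX that)
  have "ip p u = 0" if u: "dn_eigen l u" for l u
  proof (cases "l \<le> L")
    case True
    then have uE: "u \<in> eigspan L" by (rule dirichlet_eigen_in_eigspan[OF dn_eigen_dirichlet_eigen[OF u]])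
    then have uC: "u \<in> CX" using eigspan_CX by blast
    have "ip u g = (\<Sum>n<eigcount L. ip u (\<phi> n) * ip g (\<phi> n))"
      using uE gC unfolding eigspan_def by (intro parseval[OF ons_phi]) auto
    also have "\<dots> = ip u p" unfolding gp[OF uC] by (simp add: mult.commute)
    finally show ?thesis using g u by (auto simp: nonlocal_def ip_sym[of u])
  next
    case False
    then show ?thesis using dirichlet_eigen_ortho_eigspan[OF dn_eigen_dirichlet_eigen[OF u] _ p] by simp
  qed
  then have "p \<in> eigspan L \<inter> nonlocal" using p pC by (auto simp: nonlocal_def)
  then have "ip g p = 0" by (rule o)
  then have "(\<Sum>n<eigcount L. (ip g (\<phi> n))\<^sup>2) = 0" unfolding gp[OF gC] by (simp add: power2_eq_square)
  then show ?thesis using k by (simp add: sum_nonneg_eq_0_iff)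
qed

text \<open>Each symmetry carries the cell of \<open>[1, 2]\<close> to another cell of level two and
  acts on the function inside it, so every summand is a pushed copy.\<close>

lemma antisym_pushw_in_span:
  assumes Y: "rfun.subspace Y" and "x \<in> dom0"
    and "\<And>s v. bij s \<Longrightarrow> v \<in> words 2 \<Longrightarrow> pushw v (act s x) \<in> Y"
  shows "antisym (pushw [1, 2] x) \<in> Y"
proof -
  have "act s (pushw [1, 2] x) \<in> Y" if s: "bij s" for s
  proof -
    have "act s (pushw [1, 2] x) = pushw [inv_into UNIV s 1, inv_into UNIV s 2] (act s x)"
      using assms(2) by (simp add: act_push[OF s] push_dom0)
    then show ?thesis using assms(3)[OF s, of "[inv_into UNIV s 1, inv_into UNIV s 2]"] by (simp add: words_def)
  qed
  then show ?thesis unfolding antisym_def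
    by (intro rfun.subspace_sum[OF Y] rfun.subspace_scale[OF Y]) auto
qed

lemma eigspan_act: assumes s: "bij s" and f: "f \<in> eigspan L" shows "act s f \<in> eigspan L"
proof -
  have "dirichlet_eigen (lam n) (act s (\<phi> n))" for n
    unfolding dirichlet_eigen_def using act_dom0[OF s phi_dom0] act_dom0[OF bij_imp_bij_inv[OF s]]
    by (auto simp: act_adjoint_energy[OF s] act_adjoint_ip[OF s] dom0_CX phi_CX energy_phi)
  then have "act s (\<phi> n) \<in> eigspan L" if "n < eigcount L" for n
    using dirichlet_eigen_in_eigspan lam_le_iff that by blast
  moreover have "rfun.subspace {f. act s f \<in> eigspan L}"
  proof -
    have "act s 0 = 0" using act_scale[of s 0 0] by (simp add: zero_fun_def)
    then show ?thesis
      using rfun.subspace_0[OF subspace_eigspan] rfun.subspace_add[OF subspace_eigspan] rfun.subspace_scale[OF subspace_eigspan]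
      by (intro rfun.subspaceI) (auto simp only: mem_Collect_eq act_add act_scale)
  qed
  ultimately have "eigspan L \<subseteq> {f. act s f \<in> eigspan L}"
    unfolding eigspan_def by (intro rfun.span_minimal) auto
  then show ?thesis using f by blast
qed

text \<open>
  Of the nine scaled copies of the smaller space at level two, the antisymmetrised combinations
  are orthogonal to \<open>nonlocal\<close> for free; this is the gain of one unit over the trivial factor 9.
\<close>

lemma nonlocal_dim_rec: "nonlocal_dim L \<le> 27 + 8 * nonlocal_dim (L / 25)"
proof -
  define R where "R = eigspan (L / 25) \<inter> nonlocal"
  obtain b where b: "finite b" "b \<subseteq> R" "rfun.independent b" "R \<subseteq> rfun.span b" "card b = rfun.dim R"
    by (rule fin_dim_basis[OF fin_dim_eigspan_nonlocal[of "L / 25"]]) (auto simp: R_def)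
  have RF: "R \<subseteq> dom0" and RN: "R \<subseteq> nonlocal" and Rsub: "rfun.subspace R"
    using eigspan_dom0 subspace_eigspan_nonlocal by (auto simp: R_def)
  have spb: "rfun.span b = R" using b Rsub rfun.span_minimal by blast
  \<comment> \<open>Nine copies of \<open>R\<close>, one per cell of level two: a function
    orthogonal to all of them has restrictions orthogonal to \<open>R\<close>.\<close>
  define Y0 where "Y0 = (\<lambda>(w, x). pushw w x) ` (words 2 \<times> b)"
  define Y where "Y = rfun.span Y0"
  have Y0: "finite Y0" "card Y0 \<le> 9 * card b" "Y0 \<subseteq> dom0"
    using b(1,2) RF pushw_dom0 card_image_le[of "words 2 \<times> b" "\<lambda>(w, x). pushw w x"]
    by (auto simp: Y0_def card_cartesian_product card_words)
  have Ysub: "rfun.subspace Y" and Yfd: "fin_dim Y" and YC: "Y \<subseteq> CX"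
    using Y0 rfun.span_minimal[OF Y0(3) subspace_dom0] dom0_CX by (auto simp: Y_def intro: fin_dim_span)
  have extY: "pushw w x \<in> Y" if w: "w \<in> words 2" and x: "x \<in> R" for w x
  proof -
    have "rfun.subspace {x. pushw w x \<in> Y}"
      using rfun.subspace_0[OF Ysub] rfun.subspace_add[OF Ysub] rfun.subspace_scale[OF Ysub]
      by (intro rfun.subspaceI) (auto simp only: mem_Collect_eq pushw_0 pushw_add pushw_scale)
    moreover have "b \<subseteq> {x. pushw w x \<in> Y}" using w by (auto simp: Y_def Y0_def intro!: rfun.span_base)
    ultimately have "rfun.span b \<subseteq> {x. pushw w x \<in> Y}" by (intro rfun.span_minimal)
    then show ?thesis using x spb by blast
  qed
  define \<Psi> where "\<Psi> x = antisym (pushw [1, 2] x)" for x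
  have PsiY: "\<Psi> x \<in> Y" if x: "x \<in> R" for x
    unfolding \<Psi>_def
  proof (rule antisym_pushw_in_span[OF Ysub])
    show "x \<in> dom0" using x RF by blast
    fix s v assume "bij (s :: 3 \<Rightarrow> 3)" "v \<in> words 2"
    then show "pushw v (act s x) \<in> Y" using x eigspan_act nonlocal_act by (intro extY) (auto simp: R_def)
  qed
  interpret pr: vector_space_pair "\<lambda>(c::real) (f :: plane \<Rightarrow> real) x. c * f x" "\<lambda>(c::real) (f :: plane \<Rightarrow> real) x. c * f x" ..
  have lin: "Vector_Spaces.linear (\<lambda>(c::real) (f :: plane \<Rightarrow> real) x. c * f x) (\<lambda>c f x. c * f x) \<Psi>"
    by unfold_locales (simp_all only: \<Psi>_def pushw_add pushw_scale antisym_add antisym_scale)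
  have inj: "inj_on \<Psi> (rfun.span b)"
    unfolding spb by (rule inj_on_inverseI[of _ "pullw [1, 2]"]) (use RF pullw_antisym_pushw in \<open>auto simp: \<Psi>_def\<close>)
  have ind: "rfun.independent (\<Psi> ` b)" by (rule pr.linear_independent_injective_image[OF lin b(3) inj])
  have cardPsi: "card (\<Psi> ` b) = card b"
    using inj rfun.span_superset[of b] by (intro card_image) (auto intro: inj_on_subset)
  \<comment> \<open>A basis of \<open>Y\<close> containing the image of \<open>b\<close> under
    \<open>\<Psi>\<close>. That image has \<open>card b\<close> elements, to which nonlocal
    functions are orthogonal anyway; at most 8 * \<open>card b\<close> genuine conditions
    remain.\<close>
  obtain K where K: "\<Psi> ` b \<subseteq> K" "K \<subseteq> Y" "rfun.independent K" "Y \<subseteq> rfun.span K"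
    using rfun.maximal_independent_subset_extend[OF _ ind, of Y] PsiY b(2) by blast
  have Kfin: "finite K" "card K \<le> 9 * card b"
    using card_le_dim_fin_dim[OF K(3,2) Yfd] rfun.dim_le_card[of Y Y0] Y0 by (auto simp: Y_def)
  have "rfun.dim (eigspan L \<inter> nonlocal) \<le> 3 ^ 2 * 3 + card (K - \<Psi> ` b)"
  proof (rule dim_le_trial[OF subspace_eigspan_nonlocal])
    show "finite (K - \<Psi> ` b)" "K - \<Psi> ` b \<subseteq> CX" using Kfin K YC by auto
    fix f w k
    assume f: "f \<in> eigspan L \<inter> nonlocal" "\<And>y. y \<in> K - \<Psi> ` b \<Longrightarrow> ip f y = 0" and w: "w \<in> words 2" and k: "k < eigcount (L / 5\<^sup>2)"
    have fC: "f \<in> CX" and fN: "f \<in> nonlocal" using f(1) nonlocal_CX by auto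
    have fPsi: "ip f (\<Psi> x) = 0" if "x \<in> b" for x
    proof -
      have "pushw [1, 2] x \<in> CX" using that b(2) RF pushw_dom0 dom0_CX by blast
      then show ?thesis
        using antisym_adjoint_ip[OF fC, of "pushw [1, 2] x"] nonlocal_antisym[OF fN] by (simp add: \<Psi>_def)
    qed
    have fK: "ip f y = 0" if "y \<in> K" for y using f(2) fPsi that by blast
    have fY: "ip f y = 0" if "y \<in> Y" for y
      by (rule ip_ortho_span[of K]) (use K YC fC fK that in auto)
    show "ip (pullw w f) (\<phi> k) = 0"
    proof (rule nonlocal_ortho_eigspan[OF nonlocal_pullw[OF fN]])
      show "k < eigcount (L / 25)" using k by simp
      fix x assume "x \<in> eigspan (L / 25) \<inter> nonlocal"
      then have x: "x \<in> R" by (simp add: R_def)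
      then have "ip f (pushw w x) = 0" using fY extY[OF w x] by blast
      then show "ip (pullw w f) x = 0"
        using ip_pushw[of x f w] x RF fC by (auto simp: ip_sym)
    qed
  qed auto
  moreover have "card (K - \<Psi> ` b) \<le> 8 * card b"
    using card_Diff_subset[of "\<Psi> ` b" K] Kfin K(1) b(1) cardPsi by auto
  ultimately show ?thesis using b(5) by (simp add: nonlocal_dim_def R_def)
qed

text \<open>Adding 4 makes the recursion homogeneous, since 27 + 4 is at most 8 * 4. The assumption
  ensures \<open>eigcount (L / 25 ^ k)\<close> is at least 1, so the 4 is absorbed by the factor 5;
  \<open>eigcount_lower\<close> at level 2 k supplies 9^k.\<close>

lemma nonlocal_dim_bound:
  assumes "lam 0 \<le> L / 25 ^ k"
  shows "real (nonlocal_dim L) \<le> 5 * (8 / 9) ^ k * eigcount L"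
proof -
  have "nonlocal_dim L + 4 \<le> 8 ^ k * (nonlocal_dim (L / 25 ^ k) + 4)" for L
  proof (induction k arbitrary: L)
    case (Suc k)
    have "nonlocal_dim L + 4 \<le> 8 * (nonlocal_dim (L / 25) + 4)" using nonlocal_dim_rec[of L] by simp
    also have "\<dots> \<le> 8 * (8 ^ k * (nonlocal_dim (L / 25 / 25 ^ k) + 4))" using Suc[of "L / 25"] by (intro mult_left_mono) auto
    finally show ?case by simp
  qed simp
  note this[of L]
  also have "nonlocal_dim (L / 25 ^ k) + 4 \<le> 5 * eigcount (L / 25 ^ k)"
    using nonlocal_dim_le_eigcount[of "L / 25 ^ k"] lam_le_iff[of 0 "L / 25 ^ k"] assms by simp
  finally have "nonlocal_dim L \<le> 8 ^ k * (5 * eigcount (L / 25 ^ k))" by simp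
  then have 1: "real (nonlocal_dim L) \<le> 8 ^ k * (5 * real (eigcount (L / 25 ^ k)))"
    by (metis (mono_tags, lifting) of_nat_le_iff of_nat_mult of_nat_numeral of_nat_power)
  have "9 ^ k * eigcount (L / 25 ^ k) \<le> eigcount L" using eigcount_lower[of "2 * k" L] by (simp add: power_mult)
  then have "9 ^ k * real (eigcount (L / 25 ^ k)) \<le> real (eigcount L)"
    by (metis (mono_tags, lifting) of_nat_le_iff of_nat_mult of_nat_numeral of_nat_power)
  then have "real (eigcount (L / 25 ^ k)) \<le> eigcount L / 9 ^ k" by (simp add: field_simps)
  then have "8 ^ k * (5 * real (eigcount (L / 25 ^ k))) \<le> 8 ^ k * (5 * (eigcount L / 9 ^ k))" by (intro mult_left_mono) auto
  also have "\<dots> = 5 * (8 / 9) ^ k * eigcount L" by (simp add: power_divide)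
  finally show ?thesis using 1 by linarith
qed

section \<open>Orthonormal systems supported in small cells\<close>

definition localized :: "real \<Rightarrow> (plane \<Rightarrow> real) set" where
  "localized L = rfun.span {u. \<exists>l\<le>L. dn_eigen l u}"

lemma localized_eigspan: "localized L \<subseteq> eigspan L"
  unfolding localized_def using dirichlet_eigen_in_eigspan dn_eigen_dirichlet_eigen by (intro rfun.span_minimal subspace_eigspan) blast

lemma pushw_localized: assumes "u \<in> localized L" shows "pushw w u \<in> localized (5 ^ length w * L)"
proof -
  have sub: "rfun.subspace (localized L)" for L unfolding localized_def by (rule rfun.subspace_span)
  have "rfun.subspace {u. pushw w u \<in> localized (5 ^ length w * L)}"
    using rfun.subspace_0[OF sub] rfun.subspace_add[OF sub] rfun.subspace_scale[OF sub]
    by (intro rfun.subspaceI) (auto simp only: mem_Collect_eq pushw_0 pushw_add pushw_scale)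
  moreover have "{u. \<exists>l\<le>L. dn_eigen l u} \<subseteq> {u. pushw w u \<in> localized (5 ^ length w * L)}"
  proof
    fix u assume "u \<in> {u. \<exists>l\<le>L. dn_eigen l u}"
    then obtain l where l: "l \<le> L" "dn_eigen l u" by blast
    then have "dn_eigen (5 ^ length w * l) (pushw w u)" "5 ^ length w * l \<le> 5 ^ length w * L"
      using dn_eigen_pushw by auto
    then have "pushw w u \<in> {u. \<exists>l\<le>5 ^ length w * L. dn_eigen l u}" by blast
    then have "pushw w u \<in> localized (5 ^ length w * L)" unfolding localized_def by (rule rfun.span_base)
    then show "u \<in> {u. pushw w u \<in> localized (5 ^ length w * L)}" by simp
  qed
  ultimately show ?thesis using assms rfun.span_minimal unfolding localized_def by blast
qed

text \<open>The orthogonal complement of \<open>localized L\<close> in \<open>eigspan L\<close> is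
  nonlocal: \<open>dn_eigen\<close> functions with eigenvalue above \<open>L\<close> are orthogonal
  to \<open>eigspan L\<close> already.\<close>

lemma dim_localized: "eigcount L \<le> nonlocal_dim L + rfun.dim (localized L)"
proof -
  have fd: "fin_dim (localized L)" "localized L \<subseteq> CX"
    using fin_dim_subset[OF fin_dim_eigspan localized_eigspan] order_trans[OF localized_eigspan eigspan_CX] by blast+
  have "{u\<in>eigspan L. \<forall>v\<in>localized L. ip u v = 0} \<subseteq> eigspan L \<inter> nonlocal"
  proof
    fix f assume f: "f \<in> {u\<in>eigspan L. \<forall>v\<in>localized L. ip u v = 0}"
    have "ip f u = 0" if u: "dn_eigen l u" for l u
    proof (cases "l \<le> L")
      case True
      then have "u \<in> localized L" unfolding localized_def using u by (intro rfun.span_base) auto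
      then show ?thesis using f by auto
    next
      case False
      then show ?thesis using dirichlet_eigen_ortho_eigspan[OF dn_eigen_dirichlet_eigen[OF u], of L f] f by simp
    qed
    then show "f \<in> eigspan L \<inter> nonlocal" using f eigspan_CX by (auto simp: nonlocal_def)
  qed
  then have "rfun.dim {u\<in>eigspan L. \<forall>v\<in>localized L. ip u v = 0} \<le> nonlocal_dim L"
    unfolding nonlocal_dim_def by (rule dim_mono_fin_dim[OF _ fin_dim_eigspan_nonlocal])
  then show ?thesis using ortho_complement_dim[OF subspace_eigspan fin_dim_eigspan eigspan_CX fd, of L] by (simp add: dim_eigspan)
qed

text \<open>An orthonormal basis of \<open>localized (L / 5 ^ n)\<close> is copied into every cell
  of level \<open>n\<close>. Half of \<epsilon> pays for the nonlocal part at the rescaled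
  threshold, the other half for the vertex conditions in \<open>eigcount_upper\<close>.\<close>

lemma localized_system:
  fixes \<epsilon> :: real
  assumes "0 < \<epsilon>"
  shows "\<forall>\<^sub>F L in at_top. \<exists>k e. ons (words n \<times> {..<k}) e \<and>
    (\<forall>w\<in>words n. \<forall>i<k. e (w, i) \<in> eigspan L \<and> (\<forall>x. x \<notin> cell_map w ` X \<longrightarrow> e (w, i) x = 0)) \<and>
    (1 - \<epsilon>) * eigcount L \<le> 3 ^ n * real k"
proof -
  have "(\<lambda>m. 5 * (8/9 :: real) ^ m) \<longlonglongrightarrow> 5 * 0" by (intro tendsto_intros LIMSEQ_realpow_zero) auto
  then have "\<forall>\<^sub>F m in sequentially. 5 * (8/9 :: real) ^ m < \<epsilon> / 2" using assms by (intro order_tendstoD(2)[where y = "5 * 0"]) auto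
  then obtain m where m: "5 * (8/9 :: real) ^ m < \<epsilon> / 2" by (auto simp: eventually_sequentially)
  have "filterlim (\<lambda>L. real (eigcount L)) at_top at_top" by (rule filterlim_compose[OF filterlim_real_sequentially eigcount_at_top])
  then have "\<forall>\<^sub>F L in at_top. 2 * 3 ^ n * 3 / \<epsilon> \<le> real (eigcount L)" by (auto simp: filterlim_at_top)
  moreover have "\<forall>\<^sub>F L in at_top. lam 0 * 25 ^ m * 5 ^ n \<le> L" by (rule eventually_ge_at_top)
  ultimately show ?thesis
  proof eventually_elim
    case (elim L)
    define L' where "L' = L / 5 ^ n"
    define k where "k = rfun.dim (localized L')"
    have localized: "rfun.subspace (localized L')" "fin_dim (localized L')" "localized L' \<subseteq> CX" "localized L' \<subseteq> dom0"
      using rfun.subspace_span fin_dim_subset[OF fin_dim_eigspan localized_eigspan] order_trans[OF localized_eigspan eigspan_CX]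
        order_trans[OF localized_eigspan eigspan_dom0] unfolding localized_def by blast+
    obtain b where b: "ons {..<k} b" "\<And>i. i < k \<Longrightarrow> b i \<in> localized L'"
      using ons_exists[OF localized(1-3)] unfolding k_def by blast
    define e where "e = (\<lambda>(w, i) x. sqrt (3 ^ n) * pushw w (b i) x)"
    have "ons (words n \<times> {..<k}) e"
      unfolding e_def using b localized(4) by (intro ons_pushw) auto
    moreover have "e (w, i) \<in> eigspan L \<and> (\<forall>x. x \<notin> cell_map w ` X \<longrightarrow> e (w, i) x = 0)" if w: "w \<in> words n" and i: "i < k" for w i
    proof
      have "pushw w (b i) \<in> localized (5 ^ n * L')" using pushw_localized[OF b(2)[OF i], of w] w by (simp add: words_def)
      then have "pushw w (b i) \<in> eigspan L" using localized_eigspan by (auto simp: L'_def)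
      then show "e (w, i) \<in> eigspan L" unfolding e_def by (auto intro: rfun.subspace_scale[OF subspace_eigspan])
      show "\<forall>x. x \<notin> cell_map w ` X \<longrightarrow> e (w, i) x = 0"
        using pushw_support[of _ w "b i"] ons_in_C[OF b(1), of i] i by (auto simp: e_def)
    qed
    moreover have "(1 - \<epsilon>) * eigcount L \<le> 3 ^ n * real k"
    proof -
      have "lam 0 \<le> L' / 25 ^ m" using elim(2) by (simp add: L'_def field_simps)
      then have "real (nonlocal_dim L') \<le> 5 * (8/9) ^ m * eigcount L'" by (rule nonlocal_dim_bound)
      also have "\<dots> \<le> \<epsilon> / 2 * eigcount L'" using m by (intro mult_right_mono) auto
      finally have "real (nonlocal_dim L') \<le> \<epsilon> / 2 * eigcount L'" .
      moreover have "real (eigcount L') \<le> nonlocal_dim L' + real k" using dim_localized[of L'] by (simp add: k_def flip: of_nat_add)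
      ultimately have k: "(1 - \<epsilon> / 2) * eigcount L' \<le> real k" by (simp add: algebra_simps)
      have "real (eigcount L) \<le> real (3 ^ n * 3 + 3 ^ n * eigcount L')" using eigcount_upper[of L n] by (simp only: of_nat_le_iff L'_def)
      then have up: "real (eigcount L) \<le> 3 ^ n * 3 + 3 ^ n * real (eigcount L')" by simp
      have "real (3 ^ n * eigcount L') \<le> real (eigcount L)" using eigcount_lower[of n L] by (simp only: of_nat_le_iff L'_def)
      then have low: "3 ^ n * real (eigcount L') \<le> real (eigcount L)" by simp
      have big: "3 ^ n * 3 \<le> \<epsilon> / 2 * real (eigcount L)" using elim(1) assms by (simp add: field_simps)
      have "(1 - \<epsilon>) * eigcount L \<le> 3 ^ n * real (eigcount L') - \<epsilon> / 2 * eigcount L" using up big by (simp add: algebra_simps)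
      also have "\<dots> \<le> 3 ^ n * real (eigcount L') - \<epsilon> / 2 * (3 ^ n * real (eigcount L'))"
        using low assms by (simp add: mult_left_mono)
      also have "\<dots> = 3 ^ n * ((1 - \<epsilon> / 2) * eigcount L')" by (simp add: algebra_simps)
      also have "\<dots> \<le> 3 ^ n * real k" using k by (intro mult_left_mono) auto
      finally show ?thesis .
    qed
    ultimately show ?case by blast
  qed
qed

end

section \<open>The limit theorem\<close>

context gasket
begin

lemma ip_mono_scaled:
  assumes "f \<in> CX" "g \<in> CX" "0 \<le> \<delta>" "\<And>x. \<bar>g x\<bar> \<le> \<delta> * \<bar>f x\<bar>"
  shows "ip g g \<le> \<delta>\<^sup>2 * ip f f"
proof -
  have "(\<integral>x. g x * g x \<partial>\<mu>) \<le> (\<integral>x. \<delta>\<^sup>2 * (f x * f x) \<partial>\<mu>)"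
  proof (rule integral_mono)
    show "integrable \<mu> (\<lambda>x. g x * g x)" by (rule CX_integrable[OF CX_mult[OF assms(2,2)]])
    show "integrable \<mu> (\<lambda>x. \<delta>\<^sup>2 * (f x * f x))"
      by (intro integrable_mult_right CX_integrable[OF CX_mult[OF assms(1,1)]])
    fix x
    have "\<bar>g x\<bar> * \<bar>g x\<bar> \<le> (\<delta> * \<bar>f x\<bar>) * (\<delta> * \<bar>f x\<bar>)"
      using assms(3,4) by (intro mult_mono) auto
    then show "g x * g x \<le> \<delta>\<^sup>2 * (f x * f x)" by (simp add: power2_eq_square mult_ac abs_mult[symmetric])
  qed
  then show ?thesis by (simp add: ip_def L2_inner_def)
qed

end

context gasket_spectrum
begin

lemma spectral_projection_eq:
  assumes f: "f \<in> CX"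
  shows "spectral_projection a X \<mu> L f = (\<Sum>n<eigcount L. (\<lambda>x. ip f (\<phi> n) * \<phi> n x))"
proof -
  let ?p = "\<Sum>n<eigcount L. (\<lambda>x. ip f (\<phi> n) * \<phi> n x)"
  have L2: "L2_inner \<mu> (\<lambda>x. f x - g x) h = ip (f - g) h" for g h
    by (simp add: ip_def fun_diff_def)
  have p: "?p \<in> eigspan L"
    by (auto intro!: rfun.subspace_sum[OF subspace_eigspan] rfun.subspace_scale[OF subspace_eigspan] phi_eigspan)
  then have pC: "?p \<in> CX" using eigspan_CX by blast
  have o: "ip (f - ?p) h = 0" if h: "h \<in> eigspan L" for h
  proof (rule ip_ortho_span[of "\<phi> ` {..<eigcount L}"])
    show "\<phi> ` {..<eigcount L} \<subseteq> CX" using phi_CX by auto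
    show "f - ?p \<in> CX" using f pC by (rule C_diff)
    show "h \<in> rfun.span (\<phi> ` {..<eigcount L})" using h by (simp add: eigspan_def)
    fix b assume "b \<in> \<phi> ` {..<eigcount L}"
    then obtain n where n: "n < eigcount L" "b = \<phi> n" by auto
    have "ip ?p (\<phi> n) = ip f (\<phi> n)" using n(1) by (intro ons_ip_lincomb[OF ons_phi]) auto
    then show "ip (f - ?p) b = 0" unfolding n(2) using ip_diff[OF f pC phi_CX] by simp
  qed
  show ?thesis unfolding spectral_projection_def eigenspace_upto_eq L2
  proof (rule the_equality)
    show "?p \<in> eigspan L \<and> (\<forall>h\<in>eigspan L. ip (f - ?p) h = 0)" using p o by blast
    fix g assume g: "g \<in> eigspan L \<and> (\<forall>h\<in>eigspan L. ip (f - g) h = 0)"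
    then have gC: "g \<in> CX" using eigspan_CX by blast
    have d: "g - ?p \<in> eigspan L" using g p by (intro rfun.subspace_diff[OF subspace_eigspan]) auto
    then have dC: "g - ?p \<in> CX" using eigspan_CX by blast
    have "ip (f - g) (g - ?p) = 0" "ip (f - ?p) (g - ?p) = 0" using g o d by auto
    then have "ip (g - ?p) (g - ?p) = 0"
      unfolding ip_diff[OF f gC dC] ip_diff[OF f pC dC] ip_diff[OF gC pC dC] by linarith
    then have "g - ?p = 0" by (rule ip_eq_0[OF dC])
    then show "g = ?p" by (simp only: right_minus_eq)
  qed
qed

lemma eigspan_expand: "u \<in> eigspan L \<Longrightarrow> u = (\<Sum>n<eigcount L. (\<lambda>x. ip u (\<phi> n) * \<phi> n x))"
  unfolding eigspan_def by (rule ons_expand[OF ons_phi]) auto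

end

section \<open>Matrices of the compressed operator and of multiplication by the limit symbol\<close>

locale symbol = gasket_spectrum +
  fixes p :: "plane \<Rightarrow> real \<Rightarrow> real" and q :: "plane \<Rightarrow> real"
  assumes cont_p: "\<And>n. continuous_on X (\<lambda>x. p x (lam n))"
    and unif_p: "uniform_limit X (\<lambda>n x. p x (lam n)) q sequentially"
begin

lemma cont_q: "continuous_on X q"
  by (rule uniform_limit_theorem[OF always_eventually[OF allI[OF cont_p]] unif_p]) simp

definition pm :: "nat \<Rightarrow> (plane \<Rightarrow> real) \<Rightarrow> plane \<Rightarrow> real" where
  "pm n f x = (if x \<in> X then p x (lam n) * f x else 0)"

definition qm :: "(plane \<Rightarrow> real) \<Rightarrow> plane \<Rightarrow> real" where
  "qm f x = (if x \<in> X then q x * f x else 0)"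

lemma pm_CX: "f \<in> CX \<Longrightarrow> pm n f \<in> CX"
  by (rule CX_cong[OF continuous_on_mult[OF cont_p[of n] CX_cont[of f]]]) (auto simp: pm_def)

lemma qm_CX: "f \<in> CX \<Longrightarrow> qm f \<in> CX"
  by (rule CX_cong[OF continuous_on_mult[OF cont_q CX_cont[of f]]]) (auto simp: qm_def)

lemma ip_qm: "ip (qm f) g = ip f (qm g)" if "f \<in> CX" "g \<in> CX"
proof -
  have "qm f x * g x = f x * qm g x" for x using CX_out that by (auto simp: qm_def)
  then show ?thesis by (simp add: ip_def L2_inner_def)
qed

text \<open>Column \<open>n\<close> uses the symbol frozen at \<open>lam n\<close>, which is why
  this matrix need not be symmetric.\<close>

definition PM :: "nat \<Rightarrow> nat \<Rightarrow> real" where "PM m n = ip (pm n (\<phi> n)) (\<phi> m)"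

definition QM :: "nat \<Rightarrow> nat \<Rightarrow> real" where "QM m n = ip (qm (\<phi> n)) (\<phi> m)"

lemma QM_sym: "QM m n = QM n m"
  unfolding QM_def using ip_qm[OF phi_CX phi_CX, of n m] by (simp add: ip_sym)

abbreviation "TL L \<equiv> compression a X \<mu> lam \<phi> p L"

lemma compression_eq: assumes u: "u \<in> eigspan L" shows "TL L u = mat_op (eigcount L) \<phi> PM u"
proof -
  have uC: "u \<in> CX" using u eigspan_CX by blast
  have out: "ip u (\<phi> n) = 0" if "n \<ge> eigcount L" for n using u that by (simp add: eigspan_iff)
  have pd: "pseudo_diff_op \<mu> lam \<phi> p u = (\<Sum>n<eigcount L. (\<lambda>x. ip u (\<phi> n) * pm n (\<phi> n) x))"
  proof
    fix x
    have "pseudo_diff_op \<mu> lam \<phi> p u x = (\<Sum>n<eigcount L. p x (lam n) * ip u (\<phi> n) * \<phi> n x)"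
      unfolding pseudo_diff_op_def ip_def[symmetric] using out by (intro suminf_finite) auto
    also have "\<dots> = (\<Sum>n<eigcount L. ip u (\<phi> n) * pm n (\<phi> n) x)"
      using CX_out[OF phi_CX] by (intro sum.cong) (auto simp: pm_def)
    finally show "pseudo_diff_op \<mu> lam \<phi> p u x = (\<Sum>n<eigcount L. (\<lambda>x. ip u (\<phi> n) * pm n (\<phi> n) x)) x"
      by (simp add: sum_fun_apply)
  qed
  have pdC: "(\<Sum>n<eigcount L. (\<lambda>x. ip u (\<phi> n) * pm n (\<phi> n) x)) \<in> CX"
    by (intro C_sum C_scale pm_CX phi_CX)
  have "ip (\<Sum>n<eigcount L. (\<lambda>x. ip u (\<phi> n) * pm n (\<phi> n) x)) (\<phi> m) = (\<Sum>n<eigcount L. PM m n * ip u (\<phi> n))" for m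
    by (subst ip_lincomb) (auto simp: pm_CX phi_CX PM_def mult.commute)
  then show ?thesis
    unfolding compression_def spectral_projection_eq[OF uC] eigspan_expand[OF u, symmetric] pd
      spectral_projection_eq[OF pdC] mat_op_def by simp
qed

text \<open>By Bessel, column \<open>n\<close> of the difference has squared length at most
  \<open>D n\<close>, which tends to 0 since the convergence of the symbols is uniform. The first
  \<open>n0\<close> columns contribute a constant, each further one at most \<eta>/2.\<close>

lemma hilbert_schmidt_small:
  assumes "0 < \<eta>"
  shows "\<forall>\<^sub>F d in sequentially. (\<Sum>m<d. \<Sum>n<d. (PM m n - QM m n)\<^sup>2) \<le> \<eta> * real d"
proof -
  define D where "D n = ip (pm n (\<phi> n) - qm (\<phi> n)) (pm n (\<phi> n) - qm (\<phi> n))" for n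
  have DC: "pm n (\<phi> n) - qm (\<phi> n) \<in> CX" for n by (intro C_diff pm_CX qm_CX phi_CX)
  have "0 < sqrt (\<eta> / 2)" using assms by simp
  then have "\<forall>\<^sub>F n in sequentially. \<forall>x\<in>X. dist (p x (lam n)) (q x) < sqrt (\<eta> / 2)"
    using unif_p unfolding uniform_limit_iff by blast
  then obtain n0 where n0: "\<And>n x. n \<ge> n0 \<Longrightarrow> x \<in> X \<Longrightarrow> \<bar>p x (lam n) - q x\<bar> < sqrt (\<eta> / 2)"
    by (auto simp: eventually_sequentially dist_real_def)
  have D: "D n \<le> \<eta> / 2" if "n \<ge> n0" for n
  proof -
    have "D n \<le> (sqrt (\<eta> / 2))\<^sup>2 * ip (\<phi> n) (\<phi> n)"
      unfolding D_def
    proof (rule ip_mono_scaled[OF phi_CX DC])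
      fix x
      have "\<bar>(p x (lam n) - q x) * \<phi> n x\<bar> \<le> sqrt (\<eta> / 2) * \<bar>\<phi> n x\<bar>" if "x \<in> X"
        unfolding abs_mult using n0[OF \<open>n \<ge> n0\<close> that] by (intro mult_right_mono) auto
      then show "\<bar>(pm n (\<phi> n) - qm (\<phi> n)) x\<bar> \<le> sqrt (\<eta> / 2) * \<bar>\<phi> n x\<bar>"
        using assms by (auto simp: pm_def qm_def left_diff_distrib)
    qed (use assms in auto)
    then show ?thesis using assms by (simp add: ip_phi)
  qed
  define c where "c = (\<Sum>n<n0. D n)"
  have D0: "0 \<le> D n" for n unfolding D_def by (rule ip_nonneg[OF DC])
  have bound: "(\<Sum>m<d. \<Sum>n<d. (PM m n - QM m n)\<^sup>2) \<le> c + \<eta> / 2 * real d" for d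
  proof -
    have "(\<Sum>m<d. \<Sum>n<d. (PM m n - QM m n)\<^sup>2) = (\<Sum>n<d. \<Sum>m<d. (ip (pm n (\<phi> n) - qm (\<phi> n)) (\<phi> m))\<^sup>2)"
      by (subst sum.swap) (simp add: PM_def QM_def ip_diff pm_CX qm_CX phi_CX)
    also have "\<dots> \<le> (\<Sum>n<d. D n)"
      unfolding D_def by (intro sum_mono bessel[OF ons_phi _ DC]) auto
    also have "\<dots> \<le> (\<Sum>n<d. (if n < n0 then D n else 0) + \<eta> / 2)"
      using D assms by (intro sum_mono) (auto simp: not_less)
    also have "\<dots> = (\<Sum>n<d. if n < n0 then D n else 0) + \<eta> / 2 * real d"
      by (simp add: sum.distrib)
    also have "(\<Sum>n<d. if n < n0 then D n else 0) = (\<Sum>n\<in>{..<d} \<inter> {..<n0}. D n)"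
      by (simp add: sum.inter_restrict flip: lessThan_iff)
    also have "\<dots> \<le> c" unfolding c_def using D0 by (intro sum_mono2) auto
    finally show ?thesis by simp
  qed
  have "\<forall>\<^sub>F d in sequentially. 2 * c / \<eta> \<le> real d"
    using filterlim_real_sequentially by (auto simp: filterlim_at_top)
  then show ?thesis
  proof eventually_elim
    case (elim d)
    then have "c \<le> \<eta> / 2 * real d" using assms by (simp add: field_simps)
    then show ?case using bound[of d] by (simp add: field_simps)
  qed
qed

text \<open>On the support of \<open>e\<close> the function \<open>q\<close> is nearly the constant
  \<open>c\<close>, so \<open>e\<close> is nearly an eigenvector of multiplication by
  \<open>q\<close>; projecting the error to \<open>eigspan L\<close> can only shrink it.\<close>

lemma localized_approx:
  assumes e: "e \<in> eigspan L" and "ip e e = 1" and supp: "\<And>x. x \<notin> S \<Longrightarrow> e x = 0"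
    and c: "\<And>x. x \<in> S \<Longrightarrow> x \<in> X \<Longrightarrow> \<bar>q x - c\<bar> \<le> \<delta>" and "0 \<le> \<delta>"
  shows "ip (mat_op (eigcount L) \<phi> QM e - (\<lambda>x. c * e x)) (mat_op (eigcount L) \<phi> QM e - (\<lambda>x. c * e x)) \<le> \<delta>\<^sup>2"
proof -
  let ?v = "mat_op (eigcount L) \<phi> QM e - (\<lambda>x. c * e x)"
  let ?g = "qm e - (\<lambda>x. c * e x)"
  have eC: "e \<in> CX" using e eigspan_CX by blast
  have ceE: "(\<lambda>x. c * e x) \<in> eigspan L" using e by (rule rfun.subspace_scale[OF subspace_eigspan])
  have mE: "mat_op (eigcount L) \<phi> QM e \<in> eigspan L" unfolding eigspan_def by (rule mat_op_in_span)
  have vE: "?v \<in> eigspan L" using mE ceE by (rule rfun.subspace_diff[OF subspace_eigspan])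
  have C: "(\<lambda>x. c * e x) \<in> CX" "mat_op (eigcount L) \<phi> QM e \<in> CX" "?v \<in> CX" "?g \<in> CX"
    using ceE mE vE eigspan_CX C_diff[OF qm_CX[OF eC] C_scale[OF eC]] by auto
  \<comment> \<open>\<open>?v\<close> is the orthogonal projection of \<open>?g\<close> onto
    \<open>eigspan L\<close>.\<close>
  have "ip ?v (\<phi> m) = ip ?g (\<phi> m)" if m: "m < eigcount L" for m
  proof -
    have "ip (mat_op (eigcount L) \<phi> QM e) (\<phi> m) = (\<Sum>n<eigcount L. QM m n * ip e (\<phi> n))"
      unfolding mat_op_def using m by (intro ons_ip_lincomb[OF ons_phi]) auto
    also have "\<dots> = (\<Sum>n<eigcount L. ip e (\<phi> n) * ip (qm (\<phi> m)) (\<phi> n))"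
      unfolding QM_sym[of m] by (simp add: QM_def mult.commute)
    also have "\<dots> = ip e (qm (\<phi> m))"
      using e unfolding eigspan_def by (intro parseval[OF ons_phi, symmetric]) (auto simp: qm_CX phi_CX)
    also have "\<dots> = ip (qm e) (\<phi> m)" by (rule ip_qm[OF eC phi_CX, symmetric])
    finally have "ip (mat_op (eigcount L) \<phi> QM e) (\<phi> m) = ip (qm e) (\<phi> m)" .
    then show ?thesis
      unfolding ip_diff[OF C(2,1) phi_CX] ip_diff[OF qm_CX[OF eC] C(1) phi_CX] by simp
  qed
  then have "ip ?v ?v = (\<Sum>m<eigcount L. (ip ?g (\<phi> m))\<^sup>2)"
    using parseval_sq[OF ons_phi _ _ C(3), of "{..<eigcount L}"] vE by (simp add: eigspan_def)
  also have "\<dots> \<le> ip ?g ?g" by (rule bessel[OF ons_phi _ C(4)]) simp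
  also have "\<dots> \<le> \<delta>\<^sup>2 * ip e e"
  proof (rule ip_mono_scaled[OF eC C(4) \<open>0 \<le> \<delta>\<close>])
    fix x
    show "\<bar>?g x\<bar> \<le> \<delta> * \<bar>e x\<bar>"
    proof (cases "x \<in> S \<and> x \<in> X")
      case True
      then have "\<bar>(q x - c) * e x\<bar> \<le> \<delta> * \<bar>e x\<bar>" unfolding abs_mult using c by (intro mult_right_mono) auto
      then show ?thesis using True by (simp add: qm_def left_diff_distrib)
    next
      case False
      then have "e x = 0" using supp CX_out[OF eC] by blast
      then show ?thesis by (simp add: qm_def)
    qed
  qed
  finally show ?thesis using assms(2) by simp
qed

text \<open>\<open>G\<close> is controlled on the whole line because it is evaluated on the spectrum
  and on the values of \<open>q\<close>, whose position relative to \<open>S\<close> is not yet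
  known.\<close>

lemma szego_trace:
  fixes G :: "real \<Rightarrow> real"
  assumes spec: "\<And>L. L > 0 \<Longrightarrow> endo_eigenvalues (eigspan L) (TL L) \<subseteq> complex_of_real ` S"
    and bdd: "\<And>t. \<bar>G t\<bar> \<le> b"
    and uc: "\<And>\<epsilon>. 0 < \<epsilon> \<Longrightarrow> \<exists>\<delta>>0. \<forall>s t. \<bar>s - t\<bar> < \<delta> \<longrightarrow> \<bar>G s - G t\<bar> < \<epsilon>"
  shows "((\<lambda>L. trace_fun G (eigspan L) (TL L) / real (eigcount L)) \<longlongrightarrow> (\<integral>x. G (q x) \<partial>\<mu>)) at_top"
proof (rule tendstoI)
  fix r :: real assume r: "0 < r"
  \<comment> \<open>The errors add up to 6 \<epsilon>: four from the comparison of traces, one from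
    the missing dimensions and one from the Riemann sum.\<close>
  define \<epsilon> where "\<epsilon> = r / 7"
  have eps: "0 < \<epsilon>" using r by (simp add: \<epsilon>_def)
  have b0: "0 \<le> b" using bdd[of 0] by linarith
  obtain \<delta> where \<delta>: "0 < \<delta>" "\<And>s t. \<bar>s - t\<bar> < \<delta> \<Longrightarrow> \<bar>G s - G t\<bar> < \<epsilon>" using uc[OF eps] by blast
  \<comment> \<open>At distances of at least \<delta> the trivial bound 2 b is below
    \<open>K\<close> times the squared distance, which gives the quadratic modulus that
    \<open>trace_comparison\<close> asks for.\<close>
  define K where "K = 2 * b / \<delta>\<^sup>2"
  have K0: "0 \<le> K" using b0 by (simp add: K_def)
  have GK: "\<bar>G s - G t\<bar> \<le> \<epsilon> + K * (s - t)\<^sup>2" for s t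
  proof (cases "\<bar>s - t\<bar> < \<delta>")
    case True
    have "0 \<le> K * (s - t)\<^sup>2" using K0 by simp
    then show ?thesis using \<delta>(2)[OF True] by linarith
  next
    case False
    then have "\<delta>\<^sup>2 \<le> (s - t)\<^sup>2" using \<delta>(1) power_mono[of \<delta> "\<bar>s - t\<bar>" 2] by simp
    then have "K * \<delta>\<^sup>2 \<le> K * (s - t)\<^sup>2" using K0 by (intro mult_left_mono)
    moreover have "K * \<delta>\<^sup>2 = 2 * b" using \<delta>(1) by (simp add: K_def)
    moreover have "\<bar>G s - G t\<bar> \<le> 2 * b" using bdd[of s] bdd[of t] by linarith
    ultimately show ?thesis using eps by linarith
  qed
  \<comment> \<open>Here and below, 3 and 15 compensate the constants of
    \<open>schur_overlap_bound\<close>, and the summand 1 in \<open>K + 1\<close> and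
    \<open>b + 1\<close> guards against division by zero.\<close>
  define \<epsilon>1 where "\<epsilon>1 = sqrt (\<epsilon> / (3 * (K + 1)))"
  have e1: "0 < \<epsilon>1" "\<epsilon>1\<^sup>2 = \<epsilon> / (3 * (K + 1))" using eps K0 by (auto simp: \<epsilon>1_def)
  have Ke1: "K * (3 * \<epsilon>1\<^sup>2) \<le> \<epsilon>" unfolding e1(2) using eps K0 by (simp add: divide_le_eq field_simps)
  define \<eta> where "\<eta> = \<epsilon> / (15 * (K + 1))"
  have eta: "0 < \<eta>" "K * (15 * \<eta>) \<le> \<epsilon>" using eps K0 by (auto simp: \<eta>_def divide_le_eq field_simps)
  define \<epsilon>2 where "\<epsilon>2 = \<epsilon> / (b + 1)"
  have e2: "0 < \<epsilon>2" "b * \<epsilon>2 \<le> \<epsilon>" using eps b0 by (auto simp: \<epsilon>2_def divide_le_eq field_simps)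
  define Gq where "Gq x = (if x \<in> X then G (q x) else 0)" for x
  have contG: "continuous_on UNIV G"
    unfolding continuous_on_iff dist_real_def using uc by (metis abs_minus_commute)
  have Gq: "Gq \<in> CX"
    by (rule CX_cong[OF continuous_on_compose2[OF contG cont_q]]) (auto simp: Gq_def)
  have intG: "(\<integral>x. G (q x) \<partial>\<mu>) = (\<integral>x. Gq x \<partial>\<mu>)"
    by (rule Bochner_Integration.integral_cong) (auto simp: Gq_def space_mu)
  obtain x0 where x0: "x0 \<in> X" using X_ne by blast
  obtain n1 n2 where n1: "\<forall>n\<ge>n1. \<forall>w\<in>words n. \<forall>x\<in>X. \<forall>y\<in>X. \<bar>q (cell_map w x) - q (cell_map w y)\<bar> < \<epsilon>1"
    and n2: "\<forall>n\<ge>n2. \<forall>w\<in>words n. \<forall>x\<in>X. \<forall>y\<in>X. \<bar>Gq (cell_map w x) - Gq (cell_map w y)\<bar> < \<epsilon>"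
    using cell_oscillation[OF cont_q e1(1)] cell_oscillation[OF CX_cont[OF Gq] eps] by blast
  define n where "n = max n1 n2"
  have osc: "\<bar>q (cell_map w x) - q (cell_map w y)\<bar> < \<epsilon>1" if "w \<in> words n" "x \<in> X" "y \<in> X" for w x y
    by (rule n1[rule_format, OF _ that]) (simp add: n_def)
  have oscG: "\<bar>Gq (cell_map w x) - Gq (cell_map w y)\<bar> < \<epsilon>" if "w \<in> words n" "x \<in> X" "y \<in> X" for w x y
    by (rule n2[rule_format, OF _ that]) (simp add: n_def)
  define I where "I = (\<integral>x. Gq x \<partial>\<mu>)"
  define V where "V = avg n x0 Gq"
  have IV: "\<bar>I - V\<bar> \<le> \<epsilon>"
    unfolding I_def V_def using oscG[OF _ _ x0] by (intro avg_close[OF Gq x0]) (auto intro: less_imp_le)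
  have Vb: "\<bar>V\<bar> \<le> b"
  proof -
    have "\<bar>\<Sum>w\<in>words n. Gq (cell_map w x0)\<bar> \<le> (\<Sum>w\<in>words n. b)"
      using bdd b0 by (intro order_trans[OF sum_abs] sum_mono) (auto simp: Gq_def)
    then show ?thesis by (simp add: V_def avg_def card_words field_simps)
  qed
  have "\<forall>\<^sub>F L in at_top. (\<Sum>m<eigcount L. \<Sum>k<eigcount L. (PM m k - QM m k)\<^sup>2) \<le> \<eta> * real (eigcount L)"
    using eventually_compose_filterlim[OF hilbert_schmidt_small[OF eta(1)] eigcount_at_top] .
  moreover have "\<forall>\<^sub>F L in at_top. lam 0 \<le> L" by (rule eventually_ge_at_top)
  moreover note localized_system[OF e2(1), of n]
  ultimately show "\<forall>\<^sub>F L in at_top. dist (trace_fun G (eigspan L) (TL L) / real (eigcount L)) (\<integral>x. G (q x) \<partial>\<mu>) < r"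
  proof eventually_elim
    case (elim L)
    define d where "d = eigcount L"
    have d0: "0 < real d" using elim(2) lam_le_iff[of 0 L] by (simp add: d_def)
    have localized: "0 < L" using elim(2) lam_pos[of 0] by linarith
    have ELd: "eigspan L = rfun.span (\<phi> ` {..<d})" by (simp add: eigspan_def d_def)
    obtain \<psi> s where \<psi>: "ons {..<d} \<psi>" "\<psi> ` {..<d} \<subseteq> rfun.span (\<phi> ` {..<d})"
      "\<And>i k. i \<le> k \<Longrightarrow> k < d \<Longrightarrow> ip (mat_op d \<phi> PM (\<psi> i)) (\<psi> k) = (if i = k then s i else 0)"
      "\<And>F. trace_fun F (rfun.span (\<phi> ` {..<d})) (TL L) = (\<Sum>i<d. F (s i))"
    proof (rule trace_fun_via_schur[OF ons_phi])
      show "TL L u = mat_op d \<phi> PM u" if "u \<in> rfun.span (\<phi> ` {..<d})" for u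
        using compression_eq[of u L] that by (simp add: ELd d_def eigspan_def)
      show "endo_eigenvalues (rfun.span (\<phi> ` {..<d})) (TL L) \<subseteq> complex_of_real ` S"
        using spec[OF localized] by (simp add: ELd)
    qed blast
    obtain k e where e: "ons (words n \<times> {..<k}) e"
      "\<And>w i. w \<in> words n \<Longrightarrow> i < k \<Longrightarrow> e (w, i) \<in> eigspan L"
      "\<And>w i x. w \<in> words n \<Longrightarrow> i < k \<Longrightarrow> x \<notin> cell_map w ` X \<Longrightarrow> e (w, i) x = 0"
      "(1 - \<epsilon>2) * eigcount L \<le> 3 ^ n * real k"
      using elim(3) by blast
    define J where "J = words n \<times> {..<k}"
    have J: "finite J" "real (card J) = 3 ^ n * real k"
      by (simp_all add: J_def card_cartesian_product card_words)
    \<comment> \<open>The approximate eigenvalue depends on the cell only, and each cell carries the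
      same number of functions, so the sum over \<open>J\<close> becomes \<open>card J\<close> times
      the average \<open>V\<close>.\<close>
    define c where "c j = q (cell_map (fst j) x0)" for j :: "3 list \<times> nat"
    have eE: "e ` J \<subseteq> eigspan L" using e(2) by (auto simp: J_def)
    have spsi: "rfun.span (\<psi> ` {..<d}) = eigspan L"
      by (rule ons_spans[OF \<psi>(1) _ _ fin_dim_eigspan eigspan_CX subspace_eigspan])
        (use \<psi>(2) in \<open>simp_all add: ELd[symmetric] dim_eigspan d_def[symmetric]\<close>)
    have Jd: "card J \<le> d"
      using ons_card_le_dim[OF e(1)[folded J_def] J(1) eE fin_dim_eigspan] by (simp add: dim_eigspan d_def)
    define h where "h = 15 * (\<Sum>m<d. \<Sum>k<d. (PM m k - QM m k)\<^sup>2) + 3 * \<epsilon>1\<^sup>2 * card J"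
    have near: "(\<Sum>i<d. \<Sum>j\<in>J. (s i - c j)\<^sup>2 * (ip (\<psi> i) (e j))\<^sup>2) \<le> h"
      unfolding h_def
    proof (rule schur_overlap_bound[OF ons_phi \<psi>(1,2) \<psi>(3) QM_sym e(1)[folded J_def] J(1)])
      fix j assume "j \<in> J"
      then obtain w i where j: "j = (w, i)" "w \<in> words n" "i < k" by (auto simp: J_def)
      show "ip (mat_op d \<phi> QM (e j) - (\<lambda>x. c j * e j x)) (mat_op d \<phi> QM (e j) - (\<lambda>x. c j * e j x)) \<le> \<epsilon>1\<^sup>2"
        unfolding d_def j(1)
      proof (rule localized_approx[where S = "cell_map w ` X"])
        show "ip (e (w, i)) (e (w, i)) = 1" using ons_ip[OF e(1), of "(w, i)" "(w, i)"] j by simp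
        show "\<bar>q x - c (w, i)\<bar> \<le> \<epsilon>1" if "x \<in> cell_map w ` X" for x
          using that osc[OF j(2) _ x0] by (auto simp: c_def intro: less_imp_le)
      qed (use e(2,3) j e1 in auto)
    qed
    have "\<bar>(\<Sum>i<d. G (s i)) - (\<Sum>j\<in>J. G (c j))\<bar> \<le> b * (real d - card J) + \<epsilon> * card J + K * h"
      using eE spsi GK bdd near eps K0
      by (intro trace_comparison[OF \<psi>(1) e(1)[folded J_def] J(1)]) auto
    moreover have "b * (real d - card J) \<le> \<epsilon> * d"
    proof -
      have "real d - card J \<le> \<epsilon>2 * d" using e(4) J(2) by (simp add: d_def algebra_simps)
      then have "b * (real d - card J) \<le> b * (\<epsilon>2 * d)" using b0 by (intro mult_left_mono)
      also have "\<dots> \<le> \<epsilon> * d" using e2(2) mult_right_mono[of "b * \<epsilon>2" \<epsilon> "real d"] by (simp add: mult.assoc)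
      finally show ?thesis .
    qed
    moreover have "\<epsilon> * card J \<le> \<epsilon> * d" using Jd eps by simp
    moreover have "K * h \<le> 2 * \<epsilon> * d"
    proof -
      have "h \<le> 15 * (\<eta> * d) + 3 * \<epsilon>1\<^sup>2 * d"
        unfolding h_def using elim(1) Jd by (intro add_mono mult_left_mono) (auto simp: d_def)
      then have "K * h \<le> K * (15 * (\<eta> * d) + 3 * \<epsilon>1\<^sup>2 * d)" using K0 by (intro mult_left_mono)
      also have "\<dots> = (K * (15 * \<eta>) + K * (3 * \<epsilon>1\<^sup>2)) * d" by (simp add: algebra_simps)
      also have "\<dots> \<le> (\<epsilon> + \<epsilon>) * d" using eta(2) Ke1 by (intro mult_right_mono add_mono) auto
      finally show ?thesis by simp
    qed
    ultimately have 1: "\<bar>(\<Sum>i<d. G (s i)) - (\<Sum>j\<in>J. G (c j))\<bar> \<le> 4 * \<epsilon> * d" by linarith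
    have "(\<Sum>j\<in>J. G (c j)) = (\<Sum>(w, i)\<in>words n \<times> {..<k}. G (q (cell_map w x0)))"
      unfolding J_def c_def by (rule sum.cong) auto
    also have "\<dots> = (\<Sum>w\<in>words n. \<Sum>i<k. G (q (cell_map w x0)))"
      by (rule sum.cartesian_product[symmetric])
    also have "\<dots> = card J * V"
    proof -
      have "V = (\<Sum>w\<in>words n. G (q (cell_map w x0))) / 3 ^ n"
        unfolding V_def avg_def using cell_map_in_X[OF x0] by (simp add: Gq_def)
      then show ?thesis unfolding J(2) by (simp flip: sum_distrib_left)
    qed
    finally have c: "(\<Sum>j\<in>J. G (c j)) = card J * V" .
    have 2: "\<bar>card J * V - d * V\<bar> \<le> \<epsilon> * d"
    proof -
      have "\<bar>card J * V - d * V\<bar> = (real d - card J) * \<bar>V\<bar>"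
        using Jd by (simp add: abs_mult flip: left_diff_distrib)
      also have "\<dots> \<le> (real d - card J) * b" using Vb Jd by (intro mult_left_mono) auto
      also have "\<dots> \<le> \<epsilon> * d" using \<open>b * (real d - card J) \<le> \<epsilon> * d\<close> by (simp add: mult.commute)
      finally show ?thesis .
    qed
    have 3: "\<bar>d * V - d * I\<bar> \<le> \<epsilon> * d"
    proof -
      have "\<bar>d * V - d * I\<bar> = d * \<bar>I - V\<bar>" by (simp add: abs_mult abs_minus_commute flip: right_diff_distrib)
      also have "\<dots> \<le> d * \<epsilon>" using IV by (intro mult_left_mono) auto
      finally show ?thesis by (simp add: mult.commute)
    qed
    have "\<bar>(\<Sum>i<d. G (s i)) - d * I\<bar> \<le> 6 * \<epsilon> * d" using 1 2 3 unfolding c by linarith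
    also have "\<dots> < r * d" using r d0 by (simp add: \<epsilon>_def)
    finally have "\<bar>(\<Sum>i<d. G (s i)) - d * I\<bar> < r * d" .
    moreover have "\<bar>(\<Sum>i<d. G (s i)) / d - I\<bar> = \<bar>(\<Sum>i<d. G (s i)) - d * I\<bar> / d"
    proof -
      have "(\<Sum>i<d. G (s i)) / d - I = ((\<Sum>i<d. G (s i)) - d * I) / d"
        using d0 by (simp add: diff_divide_distrib)
      then show ?thesis by (simp only: abs_divide abs_of_nat)
    qed
    ultimately have "\<bar>(\<Sum>i<d. G (s i)) / d - I\<bar> < r" using d0 by (simp add: divide_less_eq)
    then show ?case unfolding intG I_def[symmetric] ELd \<psi>(4) dist_real_def d_def[symmetric] .
  qed
qed

lemma trace_fun_cong:
  assumes spec: "endo_eigenvalues (eigspan L) (TL L) \<subseteq> complex_of_real ` S"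
    and "\<And>t. t \<in> S \<Longrightarrow> G t = H t"
  shows "trace_fun G (eigspan L) (TL L) = trace_fun H (eigspan L) (TL L)"
  unfolding trace_fun_def using assms by (intro sum.cong) auto

text \<open>\<open>G\<close> is the squared distance to the interval, truncated at 1 to be bounded.
  It vanishes on every eigenvalue, so the limit, the integral of \<open>G\<close> along
  \<open>q\<close>, is 0. Being a square, this integral is \<open>ip f f\<close> for a continuous
  \<open>f\<close>, and definiteness gives the claim at every point of \<open>X\<close>.\<close>

lemma q_in_spectral_interval:
  assumes "A \<le> B" and spec: "\<And>L. L > 0 \<Longrightarrow> endo_eigenvalues (eigspan L) (TL L) \<subseteq> complex_of_real ` {A..B}"
    and x: "x \<in> X"
  shows "q x \<in> {A..B}"
proof -
  define g where "g t = min 1 \<bar>t - max A (min B t)\<bar>" for t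
  define G where "G t = g t * g t" for t
  have g: "0 \<le> g t" "g t \<le> 1" for t by (auto simp: g_def)
  have lip: "\<bar>g s - g t\<bar> \<le> \<bar>s - t\<bar>" for s t
    using assms(1) unfolding g_def by (auto simp: min_def max_def abs_if)
  have Glip: "\<bar>G s - G t\<bar> \<le> 2 * \<bar>s - t\<bar>" for s t
  proof -
    have "G s - G t = (g s - g t) * (g s + g t)" by (simp add: G_def algebra_simps)
    moreover have "\<bar>g s + g t\<bar> \<le> 2" using g[of s] g[of t] by linarith
    ultimately show ?thesis
      using mult_mono[OF lip[of s t] \<open>\<bar>g s + g t\<bar> \<le> 2\<close>] by (simp add: abs_mult)
  qed
  have "((\<lambda>L. trace_fun G (eigspan L) (TL L) / real (eigcount L)) \<longlongrightarrow> (\<integral>x. G (q x) \<partial>\<mu>)) at_top"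
  proof (rule szego_trace[OF spec])
    show "\<bar>G t\<bar> \<le> 1" for t using g[of t] by (simp add: G_def abs_mult mult_le_one)
    show "\<exists>\<delta>>0. \<forall>s t. \<bar>s - t\<bar> < \<delta> \<longrightarrow> \<bar>G s - G t\<bar> < \<epsilon>" if "0 < \<epsilon>" for \<epsilon>
    proof (intro exI[of _ "\<epsilon> / 2"] conjI allI impI)
      fix s t assume "\<bar>s - t\<bar> < \<epsilon> / 2"
      then have "2 * \<bar>s - t\<bar> < \<epsilon>" by simp
      with Glip[of s t] show "\<bar>G s - G t\<bar> < \<epsilon>" by (rule le_less_trans)
    qed (use that in simp)
  qed auto
  moreover have "\<forall>\<^sub>F L in at_top. trace_fun G (eigspan L) (TL L) / real (eigcount L) = 0"
    using eventually_gt_at_top[of 0]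
  proof eventually_elim
    case (elim L)
    have "trace_fun G (eigspan L) (TL L) = trace_fun (\<lambda>t. 0) (eigspan L) (TL L)"
      by (rule trace_fun_cong[OF spec[OF elim]]) (auto simp: G_def g_def)
    then show ?case by (simp add: trace_fun_def)
  qed
  then have "((\<lambda>L. trace_fun G (eigspan L) (TL L) / real (eigcount L)) \<longlongrightarrow> 0) at_top"
    by (rule tendsto_eventually)
  ultimately have int0: "(\<integral>x. G (q x) \<partial>\<mu>) = 0"
    by (rule tendsto_unique[OF trivial_limit_at_top_linorder])
  define f where "f x = (if x \<in> X then g (q x) else 0)" for x
  have contg: "continuous_on UNIV g" unfolding g_def by (intro continuous_intros)
  have f: "f \<in> CX" by (rule CX_cong[OF continuous_on_compose2[OF contg cont_q]]) (auto simp: f_def)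
  have "ip f f = (\<integral>x. G (q x) \<partial>\<mu>)"
    unfolding ip_def L2_inner_def by (rule Bochner_Integration.integral_cong) (auto simp: f_def G_def space_mu)
  then have "f = 0" using ip_eq_0[OF f] int0 by simp
  then have "f x = 0" by simp
  then have "g (q x) = 0" using x by (simp add: f_def)
  then show ?thesis using assms(1) by (auto simp: g_def min_def max_def split: if_splits)
qed

text \<open>Composition with the clamp \<open>cl\<close> extends \<open>h\<close> to a bounded,
  uniformly continuous function on the line. The traces do not change because the spectrum lies in
  the interval, the integral does not by \<open>q_in_spectral_interval\<close>.\<close>

lemma szego:
  fixes h :: "real \<Rightarrow> real"
  assumes spec: "\<And>L. L > 0 \<Longrightarrow> endo_eigenvalues (eigspan L) (TL L) \<subseteq> complex_of_real ` {A..B}"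
    and h: "continuous_on {A..B} h"
  shows "((\<lambda>L. trace_fun h (eigspan L) (TL L) / real (eigcount L)) \<longlongrightarrow> (\<integral>x. h (q x) \<partial>\<mu>)) at_top"
proof -
  \<comment> \<open>The spectral space at \<open>lam 0\<close> is nontrivial, so some eigenvalue
    lies in the interval, which is therefore nonempty.\<close>
  have AB: "A \<le> B"
  proof -
    have c: "eigcount (lam 0) > 0" using lam_le_iff[of 0 "lam 0"] by simp
    obtain \<psi> s where "\<And>i. i < eigcount (lam 0) \<Longrightarrow> s i \<in> {A..B}"
    proof (rule trace_fun_via_schur[OF ons_phi])
      show "TL (lam 0) u = mat_op (eigcount (lam 0)) \<phi> PM u" if "u \<in> rfun.span (\<phi> ` {..<eigcount (lam 0)})" for u
        using compression_eq[of u "lam 0"] that by (simp add: eigspan_def)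
      show "endo_eigenvalues (rfun.span (\<phi> ` {..<eigcount (lam 0)})) (TL (lam 0)) \<subseteq> complex_of_real ` {A..B}"
        using spec[OF lam_pos[of 0]] by (simp add: eigspan_def)
    qed blast
    then have "s 0 \<in> {A..B}" using c by blast
    then show ?thesis by simp
  qed
  define cl where "cl t = max A (min B t)" for t
  have cl: "cl t \<in> {A..B}" "t \<in> {A..B} \<Longrightarrow> cl t = t" for t using AB by (auto simp: cl_def)
  have cl_lip: "\<bar>cl s - cl t\<bar> \<le> \<bar>s - t\<bar>" for s t by (auto simp: cl_def min_def max_def abs_if)
  have "\<exists>b. \<forall>t\<in>{A..B}. \<bar>h t\<bar> \<le> b"
    using compact_imp_bounded[OF compact_continuous_image[OF h compact_Icc]] by (simp add: bounded_iff)
  then obtain b where b: "\<And>t. t \<in> {A..B} \<Longrightarrow> \<bar>h t\<bar> \<le> b" by blast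
  have "((\<lambda>L. trace_fun (\<lambda>t. h (cl t)) (eigspan L) (TL L) / real (eigcount L)) \<longlongrightarrow> (\<integral>x. h (cl (q x)) \<partial>\<mu>)) at_top"
  proof (rule szego_trace[OF spec])
    show "\<bar>h (cl t)\<bar> \<le> b" for t using b cl(1) by blast
    fix \<epsilon> :: real assume e: "0 < \<epsilon>"
    have "uniformly_continuous_on {A..B} h" by (rule compact_uniformly_continuous[OF h compact_Icc])
    then obtain \<delta> where \<delta>: "0 < \<delta>" "\<And>s t. s \<in> {A..B} \<Longrightarrow> t \<in> {A..B} \<Longrightarrow> dist t s < \<delta> \<Longrightarrow> dist (h t) (h s) < \<epsilon>"
      using e unfolding uniformly_continuous_on_def by metis
    show "\<exists>\<delta>>0. \<forall>s t. \<bar>s - t\<bar> < \<delta> \<longrightarrow> \<bar>h (cl s) - h (cl t)\<bar> < \<epsilon>"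
    proof (intro exI[of _ \<delta>] conjI allI impI \<delta>(1))
      fix s t assume "\<bar>s - t\<bar> < \<delta>"
      then have "dist (cl s) (cl t) < \<delta>" using cl_lip[of s t] by (simp add: dist_real_def)
      then show "\<bar>h (cl s) - h (cl t)\<bar> < \<epsilon>" using \<delta>(2)[OF cl(1) cl(1)] by (simp add: dist_real_def)
    qed
  qed auto
  moreover have "\<forall>\<^sub>F L in at_top. trace_fun (\<lambda>t. h (cl t)) (eigspan L) (TL L) / real (eigcount L)
      = trace_fun h (eigspan L) (TL L) / real (eigcount L)"
    using eventually_gt_at_top[of 0]
  proof eventually_elim
    case (elim L)
    have "trace_fun (\<lambda>t. h (cl t)) (eigspan L) (TL L) = trace_fun h (eigspan L) (TL L)"
      by (rule trace_fun_cong[OF spec[OF elim]]) (auto simp: cl(2))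
    then show ?case by simp
  qed
  moreover have "(\<integral>x. h (cl (q x)) \<partial>\<mu>) = (\<integral>x. h (q x) \<partial>\<mu>)"
    using q_in_spectral_interval[OF AB spec] cl(2)
    by (intro Bochner_Integration.integral_cong) (auto simp: space_mu)
  ultimately show ?thesis by (simp only:) (rule Lim_transform_eventually)
qed

end

theorem theorem8:
  fixes a :: "3 \<Rightarrow> plane" and X :: "plane set" and \<mu> :: "plane measure"
    and lam :: "nat \<Rightarrow> real" and \<phi> :: "nat \<Rightarrow> plane \<Rightarrow> real"
    and p :: "plane \<Rightarrow> real \<Rightarrow> real" and q :: "plane \<Rightarrow> real"
    and A B :: real and F :: "real \<Rightarrow> real"
  assumes "is_gasket a X"
    and "is_gasket_measure a X \<mu>"
    and "eigenbasis a X \<mu> lam \<phi>"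
    and "(\<lambda>(x, l). p x l) \<in> borel_measurable (restrict_space borel (X \<times> {0<..}))"
    and "bounded ((\<lambda>(x, l). p x l) ` (X \<times> {0<..}))"
    and "\<And>n. continuous_on X (\<lambda>x. p x (lam n))"
    and "uniform_limit X (\<lambda>n x. p x (lam n)) q sequentially"
    and "\<And>\<Lambda>. \<Lambda> > 0 \<Longrightarrow>
           endo_eigenvalues (eigenspace_upto a X \<mu> \<Lambda>) (compression a X \<mu> lam \<phi> p \<Lambda>)
             \<subseteq> complex_of_real ` {A..B}"
    and "continuous_on {A..B} F"
  shows "((\<lambda>\<Lambda>. trace_fun F (eigenspace_upto a X \<mu> \<Lambda>) (compression a X \<mu> lam \<phi> p \<Lambda>)
                / real (rfun.dim (eigenspace_upto a X \<mu> \<Lambda>)))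
          \<longlongrightarrow> (\<integral>x. F (q x) \<partial>\<mu>)) at_top"
proof -
  interpret symbol a X \<mu> lam \<phi> p q
    using assms(1-3,6,7) by unfold_locales
  show ?thesis
    using szego[of A B F] assms(8,9) by (simp add: eigenspace_upto_eq dim_eigspan)
qed

end
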